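(* Let $n\in\mathbf N$, $A\in\mathbb G^\infty_{n\times n}$, $t_0\in I$. The solution of the Cauchy problem $$x'-A(t)x=f,\qquad x=x_0\ \text{ if } t<t_0$$ depends continuously on $f\in\mathcal R^{n\prime}$ (with $f=0$ for $t<t_0$) and on $x_0\in\mathbf C^n$; that is, the map $(f,x_0)\mapsto x$ from $\{f\in\mathcal R^{n\prime}: f=0\text{ for }t<t_0\}\times\mathbf C^n$ to $\mathcal R^{n\prime}$ is continuous.
   Context: $I=(a,b)\subset\mathbf R$ is an open interval (e.g. $I=\mathbf R$), $\mathbf N_0=\mathbf N\cup\{0\}$; functions are identified when equal almost everywhere. $\mathbb G$ is the algebra of essentially bounded $g:I\to\mathbf C$ possessing both limits $g(t\pm)=\operatorname{ess\,lim}_{s\to t\pm}g(s)$ at every $t\in I$; $\sigma_t(g):=g(t+)-g(t-)$. $\mathbb G^\infty$ is the algebra of $g\in\mathbb G$ such that for every $k\in\mathbf N$ there is $g^{(k)}\in\mathbb G$ with $g^{(k)}(t\pm)=\operatorname{ess\,lim}_{s\to t\pm}\frac{g^{(k-1)}(s)-g^{(k-1)}(t\pm)}{s-t}$ for all $t\in I$ ($g^{(0)}=g$), with the norms $\|g\|_k=\max_{0\le i\le k}\|g^{(i)}\|_{L_\infty}$, $k\in\mathbf N_0$. For $g\in\mathbb G$, $\operatorname{supp}(g)$ is the closure in $I$ of $\{t: g(t-)\ne0\text{ or }g(t+)\ne0\}$. $\mathcal R$ is the space of $\varphi\in\mathbb G^\infty$ with compact support in $I$, with the locally convex inductive limit topology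 of the countably normed spaces $\{\varphi\in\mathbb G^\infty:\varphi=0\text{ outside }J\}$ (norms $\|\cdot\|_k$), $J$ running over bounded subintervals with $\bar J\subset I$. $\mathcal R'$ is the space of continuous linear functionals $f:\mathcal R\to\mathbf C$, $\varphi\mapsto(f,\varphi)$, with the weak* topology. For $g\in\mathbb G^\infty$, $f\in\mathcal R'$: $(gf,\varphi):=(f,g\varphi)$. Derivative: let $\mathbb C$ be the bounded continuous functions on $I$; $\mathbb F_k\subset\mathbb G^\infty$ is the set of $g$ with $g^{(i)}\in\mathbb C$ for all $i\ne k$ and $g^{(k)}$ piecewise continuous (locally finitely many discontinuities); $\mathbb F$ is the linear span of all $\mathbb F_k$, $k\in\mathbf N_0$; $\mathcal R_F=\mathcal R\cap\mathbb F$. $\Delta\subset\mathcal R'$ is the set of $g\in\mathcal R'$ for which there is $c:I\to\mathbf C$ with $(g,\varphi)=\sum_{t\in I}c(t)\sigma_t(\varphi)$ for all $\varphi\in\mathcal R_F$ (a finite sum). For $f\in\mathcal R'$ let $(\frac{df}{dt},\varphi):=-(f,\varphi')$; a derivative of $f$ is any element $f'$ of $D(f):=\frac{df}{dt}+\Delta$ (differentiation is multivalued). $\mathcal R^{n\prime}$ is the space of $\mathbf C^n$-valued distributions ($n$-tuples of elements of $\mathcal R'$, with componentwise weak* topology and operations), and $\mathbb G^\infty_{n\times n}$ the $n\times n$ matrices with entries in $\mathbb G^\infty$. "$f=0$ for $t<t_0$" means $(f,\varphi)=0$ for all $\varphi\in\mathcal R$ with $\operatorname{supp}(\varphi)\subset(a,t_0)$.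 A solution of $x'-A(t)x=h$ is $x\in\mathcal R^{n\prime}$ having some derivative $x'\in D(x)$ (componentwise) with $(x'-Ax,\varphi)=(h,\varphi)$ for all $\varphi\in\mathcal R$. For $\alpha\in\mathbf C$, $(\delta_{t_0}^\alpha,\varphi):=\alpha\varphi(t_0+)+(1-\alpha)\varphi(t_0-)$. The solution of the Cauchy problem $x'-A(t)x=f$, $x=x_0$ if $t<t_0$, is by definition the unique solution $y\in\mathcal R^{n\prime}$ of $y'-A(t)y=f+x_0\delta_{t_0}^\alpha$ with $y=0$ for $t<t_0$, where $\alpha\in\mathbf C$ is arbitrary ($y$ exists, is unique, and does not depend on $\alpha$). *)

theory Defs
  imports "HOL-Analysis.Analysis" "HOL-Probability.Essential_Supremum"
begin

text \<open>
  Functions on the open interval \<open>I\<close> are represented by total functions \<open>real \<Rightarrow> complex\<close>; values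
  outside \<open>I\<close> and on null sets are irrelevant. Every notion below is invariant under the
  identification \<open>ae_eq I\<close>, and functionals on test functions are required to respect it.
\<close>

definition ae_eq :: "real set \<Rightarrow> (real \<Rightarrow> complex) \<Rightarrow> (real \<Rightarrow> complex) \<Rightarrow> bool" where
  "ae_eq I g h \<longleftrightarrow> (AE t in lebesgue_on I. g t = h t)"


subsection \<open>Regulated functions\<close>

text \<open>
  Convergence along these filters is the one-sided essential limit: a property holds eventually
  iff it holds for almost every \<open>s\<close> in some one-sided neighbourhood of \<open>t\<close>.
\<close>

definition ess_at_right :: "real \<Rightarrow> real filter" where
  "ess_at_right t = inf (ae_filter lebesgue) (at_right t)"

definition ess_at_left :: "real \<Rightarrow> real filter" where
  "ess_at_left t = inf (ae_filter lebesgue) (at_left t)"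

definition rlim :: "(real \<Rightarrow> complex) \<Rightarrow> real \<Rightarrow> complex" where
  "rlim g t = Lim (ess_at_right t) g"

definition llim :: "(real \<Rightarrow> complex) \<Rightarrow> real \<Rightarrow> complex" where
  "llim g t = Lim (ess_at_left t) g"

definition jump :: "(real \<Rightarrow> complex) \<Rightarrow> real \<Rightarrow> complex" where
  "jump g t = rlim g t - llim g t"

definition ess_bounded :: "real set \<Rightarrow> (real \<Rightarrow> complex) \<Rightarrow> bool" where
  "ess_bounded I g \<longleftrightarrow> g \<in> borel_measurable (lebesgue_on I) \<and>
     (\<exists>C. AE t in lebesgue_on I. norm (g t) \<le> C)"

definition Linf_norm :: "real set \<Rightarrow> (real \<Rightarrow> complex) \<Rightarrow> real" where
  "Linf_norm I g = real_of_ereal (esssup (lebesgue_on I) (\<lambda>t. ereal (norm (g t))))"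

definition GG :: "real set \<Rightarrow> (real \<Rightarrow> complex) set" where
  "GG I = {g. ess_bounded I g \<and>
     (\<forall>t\<in>I. (\<exists>l. (g \<longlongrightarrow> l) (ess_at_right t)) \<and> (\<exists>l. (g \<longlongrightarrow> l) (ess_at_left t)))}"

definition has_gder :: "real set \<Rightarrow> (real \<Rightarrow> complex) \<Rightarrow> (real \<Rightarrow> complex) \<Rightarrow> bool" where
  "has_gder I g h \<longleftrightarrow> h \<in> GG I \<and>
     (\<forall>t\<in>I. ((\<lambda>s. (g s - rlim g t) / of_real (s - t)) \<longlongrightarrow> rlim h t) (ess_at_right t) \<and>
            ((\<lambda>s. (g s - llim g t) / of_real (s - t)) \<longlongrightarrow> llim h t) (ess_at_left t))"

definition Ginf :: "real set \<Rightarrow> (real \<Rightarrow> complex) set" where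
  "Ginf I = {g \<in> GG I. \<exists>d. d 0 = g \<and> (\<forall>k. has_gder I (d k) (d (Suc k)))}"

text \<open>
  An element of \<open>GG I\<close> is determined almost everywhere by its one-sided essential limits, so the
  derivative is unique up to \<open>ae_eq I\<close>; \<open>gder\<close> selects a representative.
\<close>

definition gder :: "real set \<Rightarrow> (real \<Rightarrow> complex) \<Rightarrow> (real \<Rightarrow> complex)" where
  "gder I g = (SOME h. has_gder I g h)"

definition Ginf_norm :: "real set \<Rightarrow> nat \<Rightarrow> (real \<Rightarrow> complex) \<Rightarrow> real" where
  "Ginf_norm I k g = (MAX i\<in>{..k}. Linf_norm I ((gder I ^^ i) g))"

definition supp :: "real set \<Rightarrow> (real \<Rightarrow> complex) \<Rightarrow> real set" where
  "supp I g = I \<inter> closure {t \<in> I. llim g t \<noteq> 0 \<or> rlim g t \<noteq> 0}"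


subsection \<open>Test functions and distributions\<close>

definition test :: "real set \<Rightarrow> (real \<Rightarrow> complex) set" where
  "test I = {\<phi> \<in> Ginf I. compact (supp I \<phi>)}"

definition test_on :: "real set \<Rightarrow> real set \<Rightarrow> (real \<Rightarrow> complex) set" where
  "test_on I J = {\<phi> \<in> Ginf I. AE t in lebesgue_on I. t \<notin> J \<longrightarrow> \<phi> t = 0}"

definition admissible :: "real set \<Rightarrow> real set \<Rightarrow> bool" where
  "admissible I J \<longleftrightarrow> is_interval J \<and> bounded J \<and> closure J \<subseteq> I"

definition abs_convex :: "(real \<Rightarrow> complex) set \<Rightarrow> bool" where
  "abs_convex U \<longleftrightarrow> (\<forall>u\<in>U. \<forall>v\<in>U. \<forall>\<alpha> \<beta>. norm \<alpha> + norm \<beta> \<le> 1 \<longrightarrow> (\<lambda>t. \<alpha> * u t + \<beta> * v t) \<in> U)"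

text \<open>
  The locally convex inductive limit topology: a base of neighbourhoods of \<open>0\<close> consists of the
  absolutely convex sets that meet every step \<open>test_on I J\<close> in a neighbourhood of \<open>0\<close> for the
  topology given by the norms \<open>Ginf_norm I k\<close>. These norms increase with \<open>k\<close>, so single balls
  form a base in each step.
\<close>

definition test_nbhds :: "real set \<Rightarrow> (real \<Rightarrow> complex) set set" where
  "test_nbhds I = {U. U \<subseteq> test I \<and> abs_convex U \<and>
     (\<forall>J. admissible I J \<longrightarrow>
       (\<exists>k. \<exists>\<epsilon>>0. {\<phi> \<in> test_on I J. Ginf_norm I k \<phi> < \<epsilon>} \<subseteq> U))}"

definition test_topology :: "real set \<Rightarrow> (real \<Rightarrow> complex) topology" where
  "test_topology I = topology (\<lambda>V. V \<subseteq> test I \<and>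
     (\<forall>\<phi>\<in>V. \<exists>U\<in>test_nbhds I. \<forall>u\<in>U. (\<lambda>t. \<phi> t + u t) \<in> V))"

lemma Ginf_norm_mono: "k \<le> m \<Longrightarrow> Ginf_norm I k g \<le> Ginf_norm I m g"
  unfolding Ginf_norm_def by (rule Max_mono) auto

lemma test_nbhds_Int:
  assumes "U \<in> test_nbhds I" "V \<in> test_nbhds I"
  shows "U \<inter> V \<in> test_nbhds I"
proof -
  have "\<exists>k. \<exists>\<epsilon>>0. {\<phi> \<in> test_on I J. Ginf_norm I k \<phi> < \<epsilon>} \<subseteq> U \<inter> V" if J: "admissible I J" for J
  proof -
    obtain k \<epsilon> where 1: "\<epsilon> > 0" "{\<phi> \<in> test_on I J. Ginf_norm I k \<phi> < \<epsilon>} \<subseteq> U"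
      using assms(1) J unfolding test_nbhds_def by blast
    obtain m \<eta> where 2: "\<eta> > 0" "{\<phi> \<in> test_on I J. Ginf_norm I m \<phi> < \<eta>} \<subseteq> V"
      using assms(2) J unfolding test_nbhds_def by blast
    have "Ginf_norm I k \<phi> < \<epsilon> \<and> Ginf_norm I m \<phi> < \<eta>"
      if "Ginf_norm I (max k m) \<phi> < min \<epsilon> \<eta>" for \<phi>
      using that Ginf_norm_mono[of k "max k m" I \<phi>] Ginf_norm_mono[of m "max k m" I \<phi>] by simp
    then have "{\<phi> \<in> test_on I J. Ginf_norm I (max k m) \<phi> < min \<epsilon> \<eta>} \<subseteq> U \<inter> V"
      using 1(2) 2(2) by blast
    moreover have "min \<epsilon> \<eta> > 0"
      using 1(1) 2(1) by simp
    ultimately show ?thesis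
      by blast
  qed
  moreover have "U \<inter> V \<subseteq> test I" "abs_convex (U \<inter> V)"
    using assms unfolding test_nbhds_def abs_convex_def by auto
  ultimately show ?thesis
    unfolding test_nbhds_def by blast
qed

lemma openin_test_topology:
  "openin (test_topology I) V \<longleftrightarrow> V \<subseteq> test I \<and>
     (\<forall>\<phi>\<in>V. \<exists>U\<in>test_nbhds I. \<forall>u\<in>U. (\<lambda>t. \<phi> t + u t) \<in> V)"
proof -
  have "istopology (\<lambda>V. V \<subseteq> test I \<and>
     (\<forall>\<phi>\<in>V. \<exists>U\<in>test_nbhds I. \<forall>u\<in>U. (\<lambda>t. \<phi> t + u t) \<in> V))"
    unfolding istopology_def
  proof (intro conjI allI impI ballI)
    fix S T :: "(real \<Rightarrow> complex) set" and \<phi>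
    assume S: "S \<subseteq> test I \<and> (\<forall>\<phi>\<in>S. \<exists>U\<in>test_nbhds I. \<forall>u\<in>U. (\<lambda>t. \<phi> t + u t) \<in> S)"
      and T: "T \<subseteq> test I \<and> (\<forall>\<phi>\<in>T. \<exists>U\<in>test_nbhds I. \<forall>u\<in>U. (\<lambda>t. \<phi> t + u t) \<in> T)"
    show "S \<inter> T \<subseteq> test I" using S by blast
    assume \<phi>: "\<phi> \<in> S \<inter> T"
    obtain U where U: "U \<in> test_nbhds I" "\<forall>u\<in>U. (\<lambda>t. \<phi> t + u t) \<in> S"
      using S \<phi> by blast
    obtain V where V: "V \<in> test_nbhds I" "\<forall>u\<in>V. (\<lambda>t. \<phi> t + u t) \<in> T"
      using T \<phi> by blast
    show "\<exists>U\<in>test_nbhds I. \<forall>u\<in>U. (\<lambda>t. \<phi> t + u t) \<in> S \<inter> T"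
      using test_nbhds_Int[OF U(1) V(1)] U(2) V(2) by blast
  next
    fix \<K> :: "(real \<Rightarrow> complex) set set"
    assume K: "\<forall>K\<in>\<K>. K \<subseteq> test I \<and> (\<forall>\<phi>\<in>K. \<exists>U\<in>test_nbhds I. \<forall>u\<in>U. (\<lambda>t. \<phi> t + u t) \<in> K)"
    show "\<Union>\<K> \<subseteq> test I" using K by blast
    fix \<phi> assume "\<phi> \<in> \<Union>\<K>"
    then obtain K U where "K \<in> \<K>" "U \<in> test_nbhds I" "\<forall>u\<in>U. (\<lambda>t. \<phi> t + u t) \<in> K"
      using K by blast
    then show "\<exists>U\<in>test_nbhds I. \<forall>u\<in>U. (\<lambda>t. \<phi> t + u t) \<in> \<Union>\<K>" by blast
  qed
  then show ?thesis
    unfolding test_topology_def by (simp add: topology_inverse')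
qed

text \<open>
  Functionals are taken extensional on \<open>test I\<close>, so that equality of functionals is equality in HOL
  and \<open>weak_star\<close> is the topology of pointwise convergence on \<open>test I\<close>.
\<close>

definition dist_space :: "real set \<Rightarrow> ((real \<Rightarrow> complex) \<Rightarrow> complex) set" where
  "dist_space I = {f \<in> extensional (test I).
     (\<forall>\<phi>\<in>test I. \<forall>\<psi>\<in>test I. ae_eq I \<phi> \<psi> \<longrightarrow> f \<phi> = f \<psi>) \<and>
     (\<forall>\<phi>\<in>test I. \<forall>\<psi>\<in>test I. \<forall>\<alpha> \<beta>. f (\<lambda>t. \<alpha> * \<phi> t + \<beta> * \<psi> t) = \<alpha> * f \<phi> + \<beta> * f \<psi>) \<and>
     continuous_map (test_topology I) euclidean f}"

definition weak_star :: "real set \<Rightarrow> ((real \<Rightarrow> complex) \<Rightarrow> complex) topology" where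
  "weak_star I = subtopology (product_topology (\<lambda>_. euclidean) (test I)) (dist_space I)"

definition vanishes_before :: "real set \<Rightarrow> real \<Rightarrow> ((real \<Rightarrow> complex) \<Rightarrow> complex) \<Rightarrow> bool" where
  "vanishes_before I t0 f \<longleftrightarrow> (\<forall>\<phi>\<in>test I. supp I \<phi> \<subseteq> {t \<in> I. t < t0} \<longrightarrow> f \<phi> = 0)"

definition delta :: "real set \<Rightarrow> complex \<Rightarrow> real \<Rightarrow> (real \<Rightarrow> complex) \<Rightarrow> complex" where
  "delta I \<alpha> t0 = (\<lambda>\<phi>\<in>test I. \<alpha> * rlim \<phi> t0 + (1 - \<alpha>) * llim \<phi> t0)"


subsection \<open>The multivalued derivative\<close>

definition ae_bcontinuous :: "real set \<Rightarrow> (real \<Rightarrow> complex) \<Rightarrow> bool" where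
  "ae_bcontinuous I g \<longleftrightarrow> (\<exists>c. ae_eq I g c \<and> continuous_on I c \<and> bounded (c ` I))"

definition ae_pw_continuous :: "real set \<Rightarrow> (real \<Rightarrow> complex) \<Rightarrow> bool" where
  "ae_pw_continuous I g \<longleftrightarrow> (\<exists>p. ae_eq I g p \<and>
     (\<forall>K. compact K \<and> K \<subseteq> I \<longrightarrow> finite {t \<in> K. \<not> isCont p t}))"

definition FFk :: "real set \<Rightarrow> nat \<Rightarrow> (real \<Rightarrow> complex) set" where
  "FFk I k = {g \<in> Ginf I. (\<forall>i. i \<noteq> k \<longrightarrow> ae_bcontinuous I ((gder I ^^ i) g)) \<and>
     ae_pw_continuous I ((gder I ^^ k) g)}"

definition FF :: "real set \<Rightarrow> (real \<Rightarrow> complex) set" where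
  "FF I = {(\<lambda>t. \<Sum>i<N. c i * g i t) | (N::nat) c g. \<forall>i<N. g i \<in> (\<Union>k. FFk I k)}"

text \<open>
  For \<open>\<phi> \<in> test I \<inter> FF I\<close> only finitely many jumps are nonzero, so the sum below is a genuine
  finite sum.
\<close>

definition Delta :: "real set \<Rightarrow> ((real \<Rightarrow> complex) \<Rightarrow> complex) set" where
  "Delta I = {g \<in> dist_space I. \<exists>c :: real \<Rightarrow> complex. \<forall>\<phi> \<in> test I \<inter> FF I.
     g \<phi> = (\<Sum>t | t \<in> I \<and> jump \<phi> t \<noteq> 0. c t * jump \<phi> t)}"

definition ddt :: "real set \<Rightarrow> ((real \<Rightarrow> complex) \<Rightarrow> complex) \<Rightarrow> (real \<Rightarrow> complex) \<Rightarrow> complex" where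
  "ddt I f = (\<lambda>\<phi>\<in>test I. - f (gder I \<phi>))"

definition DD :: "real set \<Rightarrow> ((real \<Rightarrow> complex) \<Rightarrow> complex) \<Rightarrow> ((real \<Rightarrow> complex) \<Rightarrow> complex) set" where
  "DD I f = {(\<lambda>\<phi>\<in>test I. ddt I f \<phi> + d \<phi>) | d. d \<in> Delta I}"


subsection \<open>Vector distributions and the Cauchy problem\<close>

definition vweak_star :: "real set \<Rightarrow> ('n \<Rightarrow> (real \<Rightarrow> complex) \<Rightarrow> complex) topology" where
  "vweak_star I = product_topology (\<lambda>_. weak_star I) UNIV"

definition mult_dist ::
  "real set \<Rightarrow> (real \<Rightarrow> complex) \<Rightarrow> ((real \<Rightarrow> complex) \<Rightarrow> complex) \<Rightarrow> (real \<Rightarrow> complex) \<Rightarrow> complex" where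
  "mult_dist I g f = (\<lambda>\<phi>\<in>test I. f (\<lambda>t. g t * \<phi> t))"

definition is_solution ::
  "real set \<Rightarrow> (real \<Rightarrow> complex)^'n^'n \<Rightarrow> ('n \<Rightarrow> (real \<Rightarrow> complex) \<Rightarrow> complex) \<Rightarrow>
     ('n \<Rightarrow> (real \<Rightarrow> complex) \<Rightarrow> complex) \<Rightarrow> bool" where
  "is_solution I A h x \<longleftrightarrow> (\<forall>i. x i \<in> dist_space I) \<and>
     (\<exists>x'. (\<forall>i. x' i \<in> DD I (x i)) \<and>
       (\<forall>\<phi>\<in>test I. \<forall>i. x' i \<phi> - (\<Sum>j\<in>UNIV. mult_dist I (A $ i $ j) (x j) \<phi>) = h i \<phi>))"

definition cauchy_solution ::
  "real set \<Rightarrow> (real \<Rightarrow> complex)^'n^'n \<Rightarrow> real \<Rightarrow> complex \<Rightarrow>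
     ('n \<Rightarrow> (real \<Rightarrow> complex) \<Rightarrow> complex) \<Rightarrow> complex^'n \<Rightarrow>
     ('n \<Rightarrow> (real \<Rightarrow> complex) \<Rightarrow> complex)" where
  "cauchy_solution I A t0 \<alpha> f x0 = (THE y.
     is_solution I A (\<lambda>i. \<lambda>\<phi>\<in>test I. f i \<phi> + x0 $ i * delta I \<alpha> t0 \<phi>) y \<and>
     (\<forall>i. vanishes_before I t0 (y i)))"

end

theory Submission imports Defs begin

text \<open>The proof is by duality. For test functions \<open>\<psi>\<close> let \<open>w\<close> solve the adjoint system
  \<open>- w' - A\<^sup>T w = \<psi>\<close> backwards from \<open>w = 0\<close> for large \<open>t\<close>, multiplied by a continuous cut-off to the left of \<open>t\<^sub>0\<close>; its components
  are test functions without jumps, although their derivatives do jump. An element of \<open>\<Delta>\<close> vanishes on every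
  jump-free test function, because piecewise polynomials from \<open>\<bbbF>\<close> approximate such a function in every norm.
  Hence pairing \<open>x' - A x = h\<close> with \<open>w\<close> gives \<open>\<Sum>\<^sub>i (x\<^sub>i, \<psi>\<^sub>i) = \<Sum>\<^sub>i (h\<^sub>i, w\<^sub>i)\<close> for every solution \<open>x\<close> that vanishes before
  \<open>t\<^sub>0\<close>. Conversely the right-hand side defines a solution: it is continuous in \<open>\<psi>\<close> since \<open>w\<close> depends on \<open>\<psi>\<close>
  continuously, and the defect in the equation vanishes on jump-free test functions, that is, lies in \<open>\<Delta>\<close>.
  So the solution is an explicit functional of \<open>h = f + x\<^sub>0 \<delta>\<close>, and its value at a fixed \<open>\<psi>\<close> only involves the values
  of \<open>f\<close> at the fixed test functions \<open>w\<^sub>i\<close>, which is weak* continuity.\<close>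

subsection \<open>One-sided essential limits and regulated functions\<close>

text \<open>A derivative of x is fixed only up to \<open>Delta\<close>, so the equation gives
  information only when paired with test functions that \<open>Delta\<close> annihilates. This is
  why the adjoint solution must be jump-free and why its cut-off has to be continuous. The condition
  defining \<open>Delta\<close> is imposed on \<open>test I \<inter> FF I\<close> alone, whereas the
  adjoint solution inherits from A discontinuities of its derivatives that need not be locally
  finite; passing from \<open>FF I\<close> to all jump-free test functions is the main analytic
  step. For the same reason the adjoint system is read as an integral equation: its right-hand side
  is only regulated. The cut-off is forced by compact support, since the backward solution in
  general does not vanish near the left end of I, and it is harmless because all functionals
  involved vanish before t0.\<close>

text \<open>The Boolean argument selects the side: \<open>True\<close> is the right, \<open>False\<close> the left.\<close>

definition ess :: "bool \<Rightarrow> real \<Rightarrow> real filter" where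
  "ess b t = (if b then ess_at_right t else ess_at_left t)"

definition side_at :: "bool \<Rightarrow> real \<Rightarrow> real filter" where
  "side_at b t = (if b then at_right t else at_left t)"

definition ess_lim :: "bool \<Rightarrow> (real \<Rightarrow> complex) \<Rightarrow> real \<Rightarrow> complex" where
  "ess_lim b g t = Lim (ess b t) g"

definition side_nbh :: "bool \<Rightarrow> real \<Rightarrow> real \<Rightarrow> real set" where
  "side_nbh b t d = (if b then {t<..<t+d} else {t-d<..<t})"

lemma rlim_ess_lim: "rlim g t = ess_lim True g t" and llim_ess_lim: "llim g t = ess_lim False g t"
  by (simp_all add: ess_lim_def ess_def rlim_def llim_def)

lemma open_side_nbh [simp]: "open (side_nbh b t d)"
  by (simp add: side_nbh_def)

lemma side_nbh_mono: "d \<le> e \<Longrightarrow> side_nbh b t d \<subseteq> side_nbh b t e"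
  by (auto simp: side_nbh_def)

lemma side_nbh_nonempty: "d > 0 \<Longrightarrow> side_nbh b t d \<noteq> {}"
  by (auto simp: side_nbh_def)

lemma side_nbh_not_self: "s \<in> side_nbh b t d \<Longrightarrow> s \<noteq> t"
  by (auto simp: side_nbh_def split: if_splits)

lemma side_nbh_subset_ball: "side_nbh b t d \<subseteq> ball t d"
  by (auto simp: side_nbh_def dist_real_def split: if_splits)

lemma eventually_side_at: "eventually P (side_at b t) \<longleftrightarrow> (\<exists>d>0. \<forall>s\<in>side_nbh b t d. P s)"
proof (cases b)
  case True
  have "(\<exists>c>t. \<forall>y>t. y < c \<longrightarrow> P y) \<longleftrightarrow> (\<exists>d>0. \<forall>s\<in>{t<..<t+d}. P s)"
  proof
    assume "\<exists>c>t. \<forall>y>t. y < c \<longrightarrow> P y"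
    then obtain c where "c > t" "\<forall>y>t. y < c \<longrightarrow> P y" by blast
    then show "\<exists>d>0. \<forall>s\<in>{t<..<t+d}. P s" by (intro exI[of _ "c - t"]) auto
  next
    assume "\<exists>d>0. \<forall>s\<in>{t<..<t+d}. P s"
    then obtain d where "d > 0" "\<forall>s\<in>{t<..<t+d}. P s" by blast
    then show "\<exists>c>t. \<forall>y>t. y < c \<longrightarrow> P y" by (intro exI[of _ "t + d"]) auto
  qed
  with True show ?thesis by (simp add: side_at_def side_nbh_def eventually_at_right_field)
next
  case False
  have "(\<exists>c<t. \<forall>y>c. y < t \<longrightarrow> P y) \<longleftrightarrow> (\<exists>d>0. \<forall>s\<in>{t-d<..<t}. P s)"
  proof
    assume "\<exists>c<t. \<forall>y>c. y < t \<longrightarrow> P y"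
    then obtain c where "c < t" "\<forall>y>c. y < t \<longrightarrow> P y" by blast
    then show "\<exists>d>0. \<forall>s\<in>{t-d<..<t}. P s" by (intro exI[of _ "t - c"]) auto
  next
    assume "\<exists>d>0. \<forall>s\<in>{t-d<..<t}. P s"
    then obtain d where "d > 0" "\<forall>s\<in>{t-d<..<t}. P s" by blast
    then show "\<exists>c<t. \<forall>y>c. y < t \<longrightarrow> P y" by (intro exI[of _ "t - d"]) auto
  qed
  with False show ?thesis by (simp add: side_at_def side_nbh_def eventually_at_left_field)
qed

lemma ess_inf: "ess b t = inf (ae_filter lebesgue) (side_at b t)"
  by (simp add: ess_def side_at_def ess_at_right_def ess_at_left_def)

lemma ess_le: "ess b t \<le> side_at b t"
  by (simp add: ess_inf)

lemma eventually_ess: "eventually P (ess b t) \<longleftrightarrow> (\<exists>d>0. AE s in lebesgue. s \<in> side_nbh b t d \<longrightarrow> P s)"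
proof
  assume "eventually P (ess b t)"
  then obtain Q R where Q: "AE s in lebesgue. Q s" and R: "eventually R (side_at b t)"
    and P: "\<And>x. Q x \<Longrightarrow> R x \<Longrightarrow> P x"
    unfolding ess_inf eventually_inf by blast
  from R obtain d where "d > 0" "\<And>s. s \<in> side_nbh b t d \<Longrightarrow> R s"
    unfolding eventually_side_at by blast
  then show "\<exists>d>0. AE s in lebesgue. s \<in> side_nbh b t d \<longrightarrow> P s"
    using P AE_mp[OF Q AE_I2, of "\<lambda>s. s \<in> side_nbh b t d \<longrightarrow> P s"] by blast
next
  assume "\<exists>d>0. AE s in lebesgue. s \<in> side_nbh b t d \<longrightarrow> P s"
  then obtain d where d: "d > 0" "AE s in lebesgue. s \<in> side_nbh b t d \<longrightarrow> P s" by blast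
  show "eventually P (ess b t)"
    unfolding ess_inf eventually_inf
    by (rule exI[of _ "\<lambda>s. s \<in> side_nbh b t d \<longrightarrow> P s"], rule exI[of _ "\<lambda>s. s \<in> side_nbh b t d"])
      (use d in \<open>auto simp: eventually_side_at\<close>)
qed

text \<open>Nonempty open sets are not null, so an almost-everywhere statement on one that does not
  mention the point must be true. Non-triviality of the essential filters and nonnegativity of
  essential bounds are obtained this way.\<close>

lemma AE_open_const:
  assumes "open U" "U \<noteq> {}" "AE s::real in lebesgue. s \<in> U \<longrightarrow> P"
  shows P
proof (rule ccontr)
  assume "\<not> P"
  with assms(3) have "AE s::real in lebesgue. s \<notin> U" by auto
  moreover have "{s \<in> space lebesgue. \<not> s \<notin> U} = U" by auto
  ultimately have "U \<in> null_sets lebesgue"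
    using assms(1) by (subst (asm) AE_iff_null) auto
  then have "negligible U" by (simp add: negligible_iff_null_sets)
  with open_not_negligible assms show False by blast
qed

text \<open>Guarantees that limits along these filters are unique, so that \<open>Lim\<close>
  returns the limit whenever there is one.\<close>

lemma ess_neq_bot [simp]: "ess b t \<noteq> bot"
proof
  assume "ess b t = bot"
  then have "eventually (\<lambda>_. False) (ess b t)" by simp
  then obtain d where "d > 0" "AE s in lebesgue. s \<in> side_nbh b t d \<longrightarrow> False"
    unfolding eventually_ess by blast
  then show False using AE_open_const[OF open_side_nbh side_nbh_nonempty] by blast
qed

lemma ess_lim_eq: "(g \<longlongrightarrow> l) (ess b t) \<Longrightarrow> ess_lim b g t = l"
  unfolding ess_lim_def by (rule tendsto_Lim) simp_all

lemma ess_lim_side: "(g \<longlongrightarrow> l) (side_at b t) \<Longrightarrow> ess_lim b g t = l"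
  by (rule ess_lim_eq) (rule tendsto_mono[OF ess_le])

lemma ess_lim_cong:
  assumes "eventually (\<lambda>s. g s = h s) (ess b t)" shows "ess_lim b g t = ess_lim b h t"
proof -
  have "filterlim g F (ess b t) = filterlim h F (ess b t)" for F
    by (rule filterlim_cong[OF refl refl assms])
  then show ?thesis unfolding ess_lim_def Topological_Spaces.Lim_def by simp
qed

section \<open>Essential one-sided limits on an open interval\<close>

locale ival =
  fixes I :: "real set"
  assumes open_I: "open I" and ne_I: "I \<noteq> {}" and int_I: "is_interval I"
begin

lemma I_sets [simp]: "I \<in> sets lebesgue" "I \<inter> space lebesgue \<in> sets lebesgue"
  using open_I by auto

lemma AE_I: "(AE t in lebesgue_on I. P t) \<longleftrightarrow> (AE t in lebesgue. t \<in> I \<longrightarrow> P t)"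
  by (rule AE_restrict_space_iff) simp

lemma side_nbh_in_I: "t \<in> I \<Longrightarrow> \<exists>e>0. \<forall>d\<le>e. side_nbh b t d \<subseteq> I"
  by (meson open_I open_contains_ball side_nbh_mono side_nbh_subset_ball subset_trans)

lemma eventually_ess_AE: "(AE t in lebesgue_on I. P t) \<Longrightarrow> t \<in> I \<Longrightarrow> eventually P (ess b t)"
proof -
  assume P: "AE t in lebesgue_on I. P t" and t: "t \<in> I"
  obtain e where e: "e > 0" "side_nbh b t e \<subseteq> I" using side_nbh_in_I[OF t, of b] by blast
  have "AE s in lebesgue. s \<in> side_nbh b t e \<longrightarrow> P s"
    using P[unfolded AE_I] by eventually_elim (use e in blast)
  with e show ?thesis unfolding eventually_ess by blast
qed

text \<open>Almost-everywhere statements survive only countable unions of exceptional sets; Lindelof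
  thins the cover by balls to a countable one.\<close>

lemma AE_local:
  assumes "\<And>t. t \<in> I \<Longrightarrow> \<exists>d>0. AE s in lebesgue. s \<in> ball t d \<longrightarrow> P s"
  shows "AE s in lebesgue_on I. P s"
proof -
  obtain d where d: "\<And>t. t \<in> I \<Longrightarrow> d t > 0" "\<And>t. t \<in> I \<Longrightarrow> AE s in lebesgue. s \<in> ball t (d t) \<longrightarrow> P s"
    using assms by metis
  obtain F where F: "F \<subseteq> (\<lambda>t. ball t (d t)) ` I" "countable F" "\<Union>F = \<Union>((\<lambda>t. ball t (d t)) ` I)"
    using Lindelof[of "(\<lambda>t. ball t (d t)) ` I"] by blast
  have 1: "AE s in lebesgue. \<forall>U\<in>F. s \<in> U \<longrightarrow> P s"
    unfolding AE_ball_countable[OF F(2)]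
  proof
    fix U assume "U \<in> F"
    then obtain t where "t \<in> I" "U = ball t (d t)" using F(1) by blast
    with d(2)[of t] show "AE s in lebesgue. s \<in> U \<longrightarrow> P s" by simp
  qed
  have 2: "I \<subseteq> \<Union>F"
  proof
    fix t assume "t \<in> I"
    moreover from this have "t \<in> ball t (d t)" using d(1) by simp
    ultimately show "t \<in> \<Union>F" unfolding F(3) by blast
  qed
  show ?thesis unfolding AE_I using 1
  proof eventually_elim
    case (elim s)
    then show ?case using 2 by (meson UnionE subsetD)
  qed
qed

text \<open>The centre belongs to neither side, but it is a null set.\<close>

lemma AE_at_ball:
  assumes "\<And>b. eventually P (ess b t)"
  shows "\<exists>d>0. AE s in lebesgue. s \<in> ball t d \<longrightarrow> P s"
proof -
  obtain d1 where d1: "d1 > 0" "AE s in lebesgue. s \<in> side_nbh True t d1 \<longrightarrow> P s"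
    using assms[of True] eventually_ess by blast
  obtain d2 where d2: "d2 > 0" "AE s in lebesgue. s \<in> side_nbh False t d2 \<longrightarrow> P s"
    using assms[of False] eventually_ess by blast
  have "{t} \<in> null_sets lebesgue"
    using negligible_sing negligible_iff_null_sets by blast
  then have 3: "AE s in lebesgue. s \<noteq> t"
    using AE_not_in[of "{t}" lebesgue] by simp
  have "AE s in lebesgue. s \<in> ball t (min d1 d2) \<longrightarrow> P s"
    using d1(2) d2(2) 3
  proof eventually_elim
    case (elim s)
    show ?case
    proof
      assume "s \<in> ball t (min d1 d2)"
      then have "s \<in> side_nbh True t d1 \<or> s \<in> side_nbh False t d2 \<or> s = t"
        by (auto simp: side_nbh_def dist_real_def)
      with elim show "P s" by blast
    qed
  qed
  then show ?thesis using d1 d2 by (intro exI[of _ "min d1 d2"]) auto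
qed

lemma AE_from_ess:
  assumes "\<And>t b. t \<in> I \<Longrightarrow> eventually P (ess b t)"
  shows "AE s in lebesgue_on I. P s"
  using AE_local AE_at_ball assms by blast

lemma GG_iff: "g \<in> GG I \<longleftrightarrow> ess_bounded I g \<and> (\<forall>t\<in>I. \<forall>b. (g \<longlongrightarrow> ess_lim b g t) (ess b t))"
proof -
  have "(\<exists>l. (g \<longlongrightarrow> l) (ess b t)) \<longleftrightarrow> (g \<longlongrightarrow> ess_lim b g t) (ess b t)" for b t
    using ess_lim_eq by blast
  from this[of True] this[of False] show ?thesis
    unfolding GG_def by (auto simp: ess_def all_bool_eq)
qed

lemma GG_I:
  assumes "g \<in> borel_measurable (lebesgue_on I)" "AE t in lebesgue_on I. norm (g t) \<le> C"
    "\<And>t b. t \<in> I \<Longrightarrow> \<exists>l. (g \<longlongrightarrow> l) (ess b t)"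
  shows "g \<in> GG I"
  unfolding GG_iff ess_bounded_def using assms ess_lim_eq by metis

lemma GG_lim: "g \<in> GG I \<Longrightarrow> t \<in> I \<Longrightarrow> (g \<longlongrightarrow> ess_lim b g t) (ess b t)"
  by (simp add: GG_iff)

lemma GG_meas: "g \<in> GG I \<Longrightarrow> g \<in> borel_measurable (lebesgue_on I)"
  by (simp add: GG_iff ess_bounded_def)

lemma GG_bound: "g \<in> GG I \<Longrightarrow> \<exists>C\<ge>0. AE t in lebesgue_on I. norm (g t) \<le> C"
proof -
  assume "g \<in> GG I"
  then obtain C where "AE t in lebesgue_on I. norm (g t) \<le> C"
    by (auto simp: GG_iff ess_bounded_def)
  then have "AE t in lebesgue_on I. norm (g t) \<le> max C 0" by eventually_elim simp
  then show ?thesis by (intro exI[of _ "max C 0"]) simp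
qed

lemma has_gder_iff: "has_gder I g h \<longleftrightarrow> h \<in> GG I \<and>
   (\<forall>t\<in>I. \<forall>b. ((\<lambda>s. (g s - ess_lim b g t) / of_real (s - t)) \<longlongrightarrow> ess_lim b h t) (ess b t))"
  unfolding has_gder_def rlim_ess_lim llim_ess_lim by (auto simp: ess_def all_bool_eq)

lemma ess_lim_bound:
  assumes "g \<in> GG I" "t \<in> I" "eventually (\<lambda>s. norm (g s - l) \<le> e) (ess b t)"
  shows "norm (ess_lim b g t - l) \<le> e"
proof -
  have "((\<lambda>s. norm (g s - l)) \<longlongrightarrow> norm (ess_lim b g t - l)) (ess b t)"
    by (intro tendsto_intros GG_lim assms)
  then show ?thesis by (rule tendsto_upperbound) (use assms in auto)
qed

lemma eventually_ess_open:
  assumes "AE s in lebesgue. s \<in> U \<longrightarrow> P s" "open U" "t \<in> U"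
  shows "eventually P (ess b t)"
proof -
  obtain e where "e > 0" "ball t e \<subseteq> U" using assms open_contains_ball by blast
  then have U: "side_nbh b t e \<subseteq> U" using side_nbh_subset_ball by blast
  have "AE s in lebesgue. s \<in> side_nbh b t e \<longrightarrow> P s"
    using assms(1) by eventually_elim (use U in blast)
  then show ?thesis
    unfolding eventually_ess using \<open>e > 0\<close> by blast
qed

text \<open>One radius controls both the values of \<open>g\<close> and all one-sided limits of
  \<open>g\<close> at nearby points, because the latter are limits of values within
  \<open>e\<close>. The bounds are non-strict so that they pass to the limit.\<close>

lemma ess_lim_near:
  assumes g: "g \<in> GG I" and t: "t \<in> I" and e: "e > 0"
  shows "\<exists>d>0. side_nbh b t d \<subseteq> I \<and> (AE s in lebesgue. s \<in> side_nbh b t d \<longrightarrow> norm (g s - ess_lim b g t) \<le> e) \<and>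
     (\<forall>s\<in>side_nbh b t d. \<forall>b'. norm (ess_lim b' g s - ess_lim b g t) \<le> e)"
proof -
  have "eventually (\<lambda>s. dist (g s) (ess_lim b g t) < e) (ess b t)"
    using GG_lim[OF g t, of b] e by (rule tendstoD)
  then obtain d1 where d1: "d1 > 0" "AE s in lebesgue. s \<in> side_nbh b t d1 \<longrightarrow> dist (g s) (ess_lim b g t) < e"
    unfolding eventually_ess by blast
  obtain d2 where d2: "d2 > 0" "\<forall>d\<le>d2. side_nbh b t d \<subseteq> I" using side_nbh_in_I[OF t, of b] by blast
  define d where "d = min d1 d2"
  have 1: "side_nbh b t d \<subseteq> I" using d2 by (simp add: d_def)
  have 2: "AE s in lebesgue. s \<in> side_nbh b t d \<longrightarrow> norm (g s - ess_lim b g t) \<le> e"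
    using d1(2) by eventually_elim (use side_nbh_mono[of d d1 b t] in \<open>auto simp: d_def dist_norm\<close>)
  have "norm (ess_lim b' g s - ess_lim b g t) \<le> e" if "s \<in> side_nbh b t d" for s b'
    using ess_lim_bound[OF g _ eventually_ess_open[OF 2 open_side_nbh that]] 1 that by blast
  moreover have "d > 0" using d1 d2 by (simp add: d_def)
  ultimately show ?thesis using 1 2 by blast
qed

text \<open>Fix a tolerance 1/(n+1). On either side of t, values and limits are both close to the
  same one-sided limit at t, so the claim holds up to the tolerance almost everywhere there, and
  \<open>AE_from_ess\<close> spreads this over \<open>I\<close>. The countably many tolerances are
  then intersected.\<close>

lemma ae_ess_lim:
  assumes g: "g \<in> GG I"
  shows "AE s in lebesgue_on I. g s = ess_lim b g s"
proof -
  have "AE s in lebesgue_on I. norm (g s - ess_lim b g s) \<le> 1 / real (Suc n)" for n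
  proof (rule AE_from_ess)
    fix t b' assume t: "t \<in> I"
    obtain d where d: "d > 0" "AE s in lebesgue. s \<in> side_nbh b' t d \<longrightarrow> norm (g s - ess_lim b' g t) \<le> 1 / real (Suc n) / 2"
      "\<forall>s\<in>side_nbh b' t d. \<forall>b''. norm (ess_lim b'' g s - ess_lim b' g t) \<le> 1 / real (Suc n) / 2"
      using ess_lim_near[OF g t, of "1 / real (Suc n) / 2" b'] by force
    have "AE s in lebesgue. s \<in> side_nbh b' t d \<longrightarrow> norm (g s - ess_lim b g s) \<le> 1 / real (Suc n)"
      using d(2)
    proof eventually_elim
      case (elim s)
      show ?case
      proof
        assume s: "s \<in> side_nbh b' t d"
        have "norm (g s - ess_lim b g s) \<le> norm (g s - ess_lim b' g t) + norm (ess_lim b g s - ess_lim b' g t)"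
          using norm_triangle_ineq4[of "g s - ess_lim b' g t" "ess_lim b g s - ess_lim b' g t"] by simp
        also have "\<dots> \<le> 1 / real (Suc n)"
          using elim[rule_format, OF s] d(3)[rule_format, OF s, of b] by (simp add: field_simps)
        finally show "norm (g s - ess_lim b g s) \<le> 1 / real (Suc n)" .
      qed
    qed
    then show "eventually (\<lambda>s. norm (g s - ess_lim b g s) \<le> 1 / real (Suc n)) (ess b' t)"
      unfolding eventually_ess using d by blast
  qed
  then have "AE s in lebesgue_on I. \<forall>n. norm (g s - ess_lim b g s) \<le> 1 / real (Suc n)"
    by (simp add: AE_all_countable)
  then show ?thesis
  proof eventually_elim
    case (elim s)
    have "norm (g s - ess_lim b g s) \<le> 0"
    proof (rule field_le_epsilon)
      fix e :: real assume "e > 0"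
      then obtain n where "1 / real (Suc n) < e"
        using nat_approx_posE by metis
      with elim show "norm (g s - ess_lim b g s) \<le> 0 + e" by (smt (verit))
    qed
    then show ?case by simp
  qed
qed

lemma ae_eq_ess_lim: "ae_eq I g h \<Longrightarrow> t \<in> I \<Longrightarrow> ess_lim b g t = ess_lim b h t"
  unfolding ae_eq_def by (rule ess_lim_cong) (rule eventually_ess_AE)

lemma ess_lim_ae_eq:
  assumes "g \<in> GG I" "h \<in> GG I" "\<And>t. t \<in> I \<Longrightarrow> ess_lim b g t = ess_lim b h t"
  shows "ae_eq I g h"
  unfolding ae_eq_def
  using ae_ess_lim[OF assms(1), of b] ae_ess_lim[OF assms(2), of b] AE_space
  by eventually_elim (use assms(3) in auto)

lemma ae_eq_refl [simp]: "ae_eq I g g" by (simp add: ae_eq_def)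

lemma ae_eq_sym:
  assumes "ae_eq I g h" shows "ae_eq I h g"
  using assms unfolding ae_eq_def by eventually_elim simp

text \<open>Rests on completeness of Lebesgue measure: preimages that differ by a null set are
  measurable together. Extension by 0 moves the question from \<open>lebesgue_on I\<close> to
  \<open>lebesgue\<close>.\<close>

lemma meas_ae_eq:
  assumes "g \<in> borel_measurable (lebesgue_on I)" "ae_eq I g h"
  shows "h \<in> borel_measurable (lebesgue_on I)"
proof -
  have 1: "(\<lambda>t. indicator I t *\<^sub>R g t) \<in> borel_measurable lebesgue"
    using assms(1) by (simp add: borel_measurable_restrict_space_iff)
  have 2: "AE t in lebesgue. indicator I t *\<^sub>R g t = indicator I t *\<^sub>R h t"
    using assms(2)[unfolded ae_eq_def AE_I] by eventually_elim (auto simp: indicator_def)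
  have "(\<lambda>t. indicator I t *\<^sub>R h t) \<in> borel_measurable lebesgue"
  proof (rule measurableI)
    fix A :: "complex set" assume A: "A \<in> sets borel"
    let ?g = "\<lambda>t. indicator I t *\<^sub>R g t" and ?h = "\<lambda>t. indicator I t *\<^sub>R h t"
    have "AE t in lebesgue. t \<in> ?g -` A \<inter> space lebesgue \<longleftrightarrow> t \<in> ?h -` A \<inter> space lebesgue"
      using 2 by eventually_elim (auto simp: indicator_def)
    then show "?h -` A \<inter> space lebesgue \<in> sets lebesgue"
      by (rule completion.in_sets_AE) (use measurable_sets[OF 1 A] in auto)
  qed simp
  then show ?thesis by (simp add: borel_measurable_restrict_space_iff)
qed

lemma GG_ae_eq:
  assumes g: "g \<in> GG I" and e: "ae_eq I g h"
  shows "h \<in> GG I"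
proof -
  obtain C where C: "AE t in lebesgue_on I. norm (g t) \<le> C" using GG_bound[OF g] by blast
  have "AE t in lebesgue_on I. norm (h t) \<le> C"
    using C e[unfolded ae_eq_def] by eventually_elim simp
  moreover have "(h \<longlongrightarrow> ess_lim b g t) (ess b t)" if "t \<in> I" for t b
    using GG_lim[OF g that, of b] tendsto_cong[OF eventually_ess_AE[OF e[unfolded ae_eq_def] that]]
    by blast
  ultimately show ?thesis using GG_I[OF meas_ae_eq[OF GG_meas[OF g] e]] by blast
qed

section \<open>The algebra of regulated functions\<close>

lemma GG_const: "(\<lambda>_. c) \<in> GG I"
  by (rule GG_I[where C="norm c"]) auto

lemma GG_add:
  assumes "f \<in> GG I" "g \<in> GG I" shows "(\<lambda>t. f t + g t) \<in> GG I"
proof -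
  obtain C D where C: "AE t in lebesgue_on I. norm (f t) \<le> C" and D: "AE t in lebesgue_on I. norm (g t) \<le> D"
    using assms GG_bound by blast
  have "AE t in lebesgue_on I. norm (f t + g t) \<le> C + D"
    using C D by eventually_elim (rule norm_triangle_le, simp)
  then show ?thesis using assms GG_meas tendsto_add[OF GG_lim GG_lim]
    by (intro GG_I[where C="C+D"]) (blast intro: borel_measurable_add)+
qed

lemma GG_mult:
  assumes "f \<in> GG I" "g \<in> GG I" shows "(\<lambda>t. f t * g t) \<in> GG I"
proof -
  obtain C D where C: "AE t in lebesgue_on I. norm (f t) \<le> C" "C \<ge> 0"
    and D: "AE t in lebesgue_on I. norm (g t) \<le> D"
    using assms GG_bound by blast
  have "AE t in lebesgue_on I. norm (f t * g t) \<le> C * D"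
    using C(1) D by eventually_elim (simp add: norm_mult mult_mono' C(2))
  then show ?thesis using assms GG_meas tendsto_mult[OF GG_lim GG_lim]
    by (intro GG_I[where C="C*D"]) (blast intro: borel_measurable_times)+
qed

lemma GG_cmult: "f \<in> GG I \<Longrightarrow> (\<lambda>t. c * f t) \<in> GG I"
  by (rule GG_mult[OF GG_const])

lemma GG_sum: "(\<And>i. i \<in> S \<Longrightarrow> f i \<in> GG I) \<Longrightarrow> (\<lambda>t. \<Sum>i\<in>S. f i t) \<in> GG I"
  by (induction S rule: infinite_finite_induct) (auto intro: GG_const GG_add)

lemma ess_lim_add: "f \<in> GG I \<Longrightarrow> g \<in> GG I \<Longrightarrow> t \<in> I \<Longrightarrow> ess_lim b (\<lambda>t. f t + g t) t = ess_lim b f t + ess_lim b g t"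
  by (intro ess_lim_eq tendsto_add GG_lim)

lemma ess_lim_mult: "f \<in> GG I \<Longrightarrow> g \<in> GG I \<Longrightarrow> t \<in> I \<Longrightarrow> ess_lim b (\<lambda>t. f t * g t) t = ess_lim b f t * ess_lim b g t"
  by (intro ess_lim_eq tendsto_mult GG_lim)

lemma ess_lim_cmult: "f \<in> GG I \<Longrightarrow> t \<in> I \<Longrightarrow> ess_lim b (\<lambda>t. c * f t) t = c * ess_lim b f t"
  by (intro ess_lim_eq tendsto_mult tendsto_const GG_lim)

lemma ess_lim_const [simp]: "ess_lim b (\<lambda>_. c) t = c"
  by (intro ess_lim_eq tendsto_const)

lemma ess_lim_sum: "(\<And>i. i \<in> S \<Longrightarrow> f i \<in> GG I) \<Longrightarrow> t \<in> I \<Longrightarrow> ess_lim b (\<lambda>t. \<Sum>i\<in>S. f i t) t = (\<Sum>i\<in>S. ess_lim b (f i) t)"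
  by (intro ess_lim_eq tendsto_sum GG_lim)

section \<open>One-sided derivatives and their calculus\<close>

lemma has_gder_GG: "has_gder I g h \<Longrightarrow> h \<in> GG I"
  by (simp add: has_gder_iff)

lemma has_gder_quot: "has_gder I g h \<Longrightarrow> t \<in> I \<Longrightarrow>
    ((\<lambda>s. (g s - ess_lim b g t) / of_real (s - t)) \<longlongrightarrow> ess_lim b h t) (ess b t)"
  by (simp add: has_gder_iff)

lemma has_gder_ae_eq:
  assumes gh: "has_gder I g h" and g: "ae_eq I g g'" and h: "ae_eq I h h'"
  shows "has_gder I g' h'"
  unfolding has_gder_iff
proof (intro conjI ballI allI)
  show "h' \<in> GG I" using GG_ae_eq[OF has_gder_GG[OF gh] h] .
  fix t b assume t: "t \<in> I"
  have "eventually (\<lambda>s. (g s - ess_lim b g t) / of_real (s - t) = (g' s - ess_lim b g' t) / of_real (s - t)) (ess b t)"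
    using eventually_ess_AE[OF g[unfolded ae_eq_def] t]
    by eventually_elim (simp add: ae_eq_ess_lim[OF g t])
  from tendsto_cong[OF this] show "((\<lambda>s. (g' s - ess_lim b g' t) / of_real (s - t)) \<longlongrightarrow> ess_lim b h' t) (ess b t)"
    using has_gder_quot[OF gh t, of b] ae_eq_ess_lim[OF h t, of b] by simp
qed

text \<open>The quotients determine the one-sided limits of a derivative, and these determine an
  element of \<open>GG I\<close> up to a null set.\<close>

lemma has_gder_unique:
  assumes "has_gder I g h" "has_gder I g h'"
  shows "ae_eq I h h'"
proof (rule ess_lim_ae_eq)
  fix t b assume t: "t \<in> I"
  show "ess_lim b h t = ess_lim b h' t"
    using tendsto_unique[OF ess_neq_bot has_gder_quot[OF assms(1) t] has_gder_quot[OF assms(2) t]] .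
qed (use assms has_gder_GG in blast)+

lemma has_gder_add:
  assumes f: "f \<in> GG I" "has_gder I f f'" and g: "g \<in> GG I" "has_gder I g g'"
  shows "has_gder I (\<lambda>t. f t + g t) (\<lambda>t. f' t + g' t)"
  unfolding has_gder_iff
proof (intro conjI ballI allI)
  show "(\<lambda>t. f' t + g' t) \<in> GG I" using f g has_gder_GG GG_add by blast
  fix t b assume t: "t \<in> I"
  have "((\<lambda>s. (f s - ess_lim b f t) / of_real (s - t) + (g s - ess_lim b g t) / of_real (s - t))
      \<longlongrightarrow> ess_lim b f' t + ess_lim b g' t) (ess b t)"
    by (intro tendsto_add has_gder_quot f g t)
  then show "((\<lambda>s. (f s + g s - ess_lim b (\<lambda>t. f t + g t) t) / of_real (s - t)) \<longlongrightarrow> ess_lim b (\<lambda>t. f' t + g' t) t) (ess b t)"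
    using f g has_gder_GG t by (simp add: ess_lim_add add_divide_distrib[symmetric] add_diff_add)
qed

lemma has_gder_mult:
  assumes f: "f \<in> GG I" "has_gder I f f'" and g: "g \<in> GG I" "has_gder I g g'"
  shows "has_gder I (\<lambda>t. f t * g t) (\<lambda>t. f' t * g t + f t * g' t)"
  unfolding has_gder_iff
proof (intro conjI ballI allI)
  have f': "f' \<in> GG I" and g': "g' \<in> GG I" using f g has_gder_GG by blast+
  show "(\<lambda>t. f' t * g t + f t * g' t) \<in> GG I" using f g f' g' GG_mult GG_add by blast
  fix t b assume t: "t \<in> I"
  have 1: "((\<lambda>s. (f s - ess_lim b f t) / of_real (s - t) * g s + ess_lim b f t * ((g s - ess_lim b g t) / of_real (s - t)))
      \<longlongrightarrow> ess_lim b f' t * ess_lim b g t + ess_lim b f t * ess_lim b g' t) (ess b t)"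
    by (intro tendsto_add tendsto_mult tendsto_const has_gder_quot GG_lim f g t)
  have 2: "(f s - ess_lim b f t) / of_real (s - t) * g s + ess_lim b f t * ((g s - ess_lim b g t) / of_real (s - t))
      = (f s * g s - ess_lim b f t * ess_lim b g t) / of_real (s - t)" for s
    by (simp add: field_simps add_divide_distrib[symmetric] diff_divide_distrib[symmetric])
  show "((\<lambda>s. (f s * g s - ess_lim b (\<lambda>t. f t * g t) t) / of_real (s - t)) \<longlongrightarrow>
      ess_lim b (\<lambda>t. f' t * g t + f t * g' t) t) (ess b t)"
    using 1[unfolded 2] f g f' g' t by (simp add: ess_lim_add ess_lim_mult GG_mult)
qed

lemma has_gder_const: "has_gder I (\<lambda>_. c) (\<lambda>_. 0)"
  unfolding has_gder_iff by (simp add: GG_const)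

lemma has_gder_cmult:
  assumes "f \<in> GG I" "has_gder I f f'"
  shows "has_gder I (\<lambda>t. c * f t) (\<lambda>t. c * f' t)"
  using has_gder_mult[OF GG_const has_gder_const assms, of c] by simp

section \<open>The chosen derivative and the norms of finite order\<close>

lemma has_gder_gder: "has_gder I g h \<Longrightarrow> has_gder I g (gder I g)"
  unfolding gder_def by (rule someI[of "has_gder I g"])

lemma gder_ae_eq: "has_gder I g h \<Longrightarrow> ae_eq I (gder I g) h"
  using has_gder_unique has_gder_gder by blast

text \<open>\<open>gnorm_le k C g\<close> is \<open>Ginf_norm I k g \<le> C\<close> for \<open>g\<close> that need only be \<open>k\<close> times differentiable, stated
  without the choice hidden in \<open>gder\<close> so that it can be proved by induction on \<open>k\<close> (see \<open>Ginf_norm_le\<close>).\<close>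

fun gnorm_le :: "nat \<Rightarrow> real \<Rightarrow> (real \<Rightarrow> complex) \<Rightarrow> bool" where
  "gnorm_le 0 C g \<longleftrightarrow> g \<in> GG I \<and> (AE t in lebesgue_on I. norm (g t) \<le> C)"
| "gnorm_le (Suc k) C g \<longleftrightarrow> g \<in> GG I \<and> (AE t in lebesgue_on I. norm (g t) \<le> C) \<and>
     (\<exists>h. has_gder I g h \<and> gnorm_le k C h)"

lemma gnorm_le_GG: "gnorm_le k C g \<Longrightarrow> g \<in> GG I" by (cases k) auto
lemma gnorm_le_bound: "gnorm_le k C g \<Longrightarrow> AE t in lebesgue_on I. norm (g t) \<le> C" by (cases k) auto

lemma gnorm_le_ae_eq:
  assumes "gnorm_le k C g" "ae_eq I g h" shows "gnorm_le k C h"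
proof -
  have "AE t in lebesgue_on I. norm (h t) \<le> C"
    using gnorm_le_bound[OF assms(1)] assms(2)[unfolded ae_eq_def] by eventually_elim simp
  with assms show ?thesis
    using GG_ae_eq[OF _ assms(2)] has_gder_ae_eq[OF _ assms(2) ae_eq_refl] by (cases k) auto
qed

lemma gnorm_le_mono: "gnorm_le k C g \<Longrightarrow> C \<le> D \<Longrightarrow> gnorm_le k D g"
proof (induction k arbitrary: g)
  case (Suc k)
  have "AE t in lebesgue_on I. norm (g t) \<le> D"
    using gnorm_le_bound[OF Suc.prems(1)] by eventually_elim (use Suc.prems in simp)
  with Suc show ?case by auto
next
  case 0
  have "AE t in lebesgue_on I. norm (g t) \<le> D"
    using gnorm_le_bound[OF 0(1)] by eventually_elim (use 0 in simp)
  with 0 show ?case by simp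
qed

text \<open>The witness in \<open>gnorm_le\<close> can be exchanged for the choice made by
  \<open>gder\<close>, since both are derivatives of the same function and so agree almost
  everywhere.\<close>

lemma gnorm_le_Suc_gder: "gnorm_le (Suc k) C g \<longleftrightarrow> g \<in> GG I \<and> (AE t in lebesgue_on I. norm (g t) \<le> C) \<and>
     has_gder I g (gder I g) \<and> gnorm_le k C (gder I g)"
  using gnorm_le_ae_eq gder_ae_eq has_gder_gder ae_eq_sym by (metis gnorm_le.simps(2))

lemma gnorm_le_le: "gnorm_le k C g \<Longrightarrow> j \<le> k \<Longrightarrow> gnorm_le j C g"
proof (induction j arbitrary: g k)
  case 0 then show ?case by (simp add: gnorm_le_GG gnorm_le_bound)
next
  case (Suc j)
  then obtain k' where "k = Suc k'" "j \<le> k'" by (cases k) auto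
  with Suc show ?case by (metis gnorm_le.simps(2))
qed

lemma gnorm_le_nonneg: "gnorm_le k C g \<Longrightarrow> 0 \<le> C"
proof -
  assume "gnorm_le k C g"
  then have "AE t in lebesgue. t \<in> I \<longrightarrow> norm (g t) \<le> C"
    using gnorm_le_bound[of k C g] by (simp only: AE_I)
  then have "AE t in lebesgue. t \<in> I \<longrightarrow> 0 \<le> C"
    by eventually_elim (use norm_ge_zero order_trans in blast)
  then show ?thesis using AE_open_const open_I ne_I by blast
qed

lemma gnorm_le_add: "gnorm_le k C f \<Longrightarrow> gnorm_le k D g \<Longrightarrow> gnorm_le k (C + D) (\<lambda>t. f t + g t)"
proof (induction k arbitrary: f g)
  case 0
  have "AE t in lebesgue_on I. norm (f t + g t) \<le> C + D"
    using 0[THEN gnorm_le_bound] by eventually_elim (rule norm_triangle_le, simp)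
  with 0 show ?case by (simp add: GG_add)
next
  case (Suc k)
  have "AE t in lebesgue_on I. norm (f t + g t) \<le> C + D"
    using Suc.prems[THEN gnorm_le_bound] by eventually_elim (rule norm_triangle_le, simp)
  moreover obtain f' g' where "has_gder I f f'" "gnorm_le k C f'" "has_gder I g g'" "gnorm_le k D g'"
    using Suc.prems by auto
  ultimately show ?case using Suc.prems[THEN gnorm_le_GG] Suc.IH has_gder_add GG_add
    unfolding gnorm_le.simps by blast
qed

text \<open>The Leibniz rule turns one product into two at each differentiation, hence a factor 2
  per order. \<open>C\<close> and \<open>D\<close> bound all derivatives up to the given order, so
  both summands fall under the same induction hypothesis.\<close>

lemma gnorm_le_mult: "gnorm_le k C f \<Longrightarrow> gnorm_le k D g \<Longrightarrow> gnorm_le k (2 ^ k * C * D) (\<lambda>t. f t * g t)"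
proof (induction k arbitrary: f g)
  case 0
  have "AE t in lebesgue_on I. norm (f t * g t) \<le> C * D"
    using 0[THEN gnorm_le_bound] by eventually_elim (simp add: norm_mult mult_mono' )
  with 0 show ?case by (simp add: GG_mult)
next
  case (Suc k)
  have CD: "0 \<le> C * D" using Suc.prems[THEN gnorm_le_nonneg] by simp
  have "1 * (C * D) \<le> 2 ^ Suc k * (C * D)" by (rule mult_right_mono[OF one_le_power CD]) simp
  then have CD2: "C * D \<le> 2 ^ Suc k * C * D" by (simp add: mult.assoc)
  have "AE t in lebesgue_on I. norm (f t * g t) \<le> 2 ^ Suc k * C * D"
    using Suc.prems[THEN gnorm_le_bound]
  proof eventually_elim
    case (elim t)
    then have "norm (f t * g t) \<le> C * D" by (simp add: norm_mult mult_mono')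
    with CD2 show ?case by linarith
  qed
  moreover obtain f' g' where d: "has_gder I f f'" "gnorm_le k C f'" "has_gder I g g'" "gnorm_le k D g'"
    using Suc.prems by auto
  have "gnorm_le k C f" "gnorm_le k D g" using Suc.prems by (meson gnorm_le_le le_SucI order_refl)+
  then have "gnorm_le k (2 ^ k * C * D + 2 ^ k * C * D) (\<lambda>t. f' t * g t + f t * g' t)"
    using d Suc.IH gnorm_le_add by blast
  moreover have "2 ^ k * C * D + 2 ^ k * C * D = 2 ^ Suc k * C * D" by simp
  ultimately show ?case
    using GG_mult[OF Suc.prems[THEN gnorm_le_GG]] has_gder_mult[OF gnorm_le_GG[OF Suc.prems(1)] d(1) gnorm_le_GG[OF Suc.prems(2)] d(3)]
    unfolding gnorm_le.simps by auto
qed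

lemma gnorm_le_const: "norm c \<le> C \<Longrightarrow> gnorm_le k C (\<lambda>_. c)"
proof (induction k arbitrary: c)
  case (Suc k)
  have "0 \<le> C" using Suc.prems norm_ge_zero order_trans by blast
  then have "gnorm_le k C (\<lambda>_. 0)" by (intro Suc.IH) simp
  with Suc.prems show ?case using has_gder_const GG_const by auto
qed (auto simp: GG_const)

lemma gnorm_le_cmult: "gnorm_le k C f \<Longrightarrow> gnorm_le k (norm c * C) (\<lambda>t. c * f t)"
proof (induction k arbitrary: f)
  case 0
  have "AE t in lebesgue_on I. norm (c * f t) \<le> norm c * C"
    using 0[THEN gnorm_le_bound] by eventually_elim (simp add: norm_mult mult_left_mono)
  with 0 show ?case by (simp add: GG_cmult)
next
  case (Suc k)
  have "AE t in lebesgue_on I. norm (c * f t) \<le> norm c * C"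
    using Suc.prems[THEN gnorm_le_bound] by eventually_elim (simp add: norm_mult mult_left_mono)
  moreover obtain f' where "has_gder I f f'" "gnorm_le k C f'" using Suc.prems by auto
  ultimately show ?case using Suc.prems[THEN gnorm_le_GG] Suc.IH has_gder_cmult GG_cmult
    unfolding gnorm_le.simps by blast
qed

lemma gnorm_le_sum: "finite S \<Longrightarrow> (\<And>i. i \<in> S \<Longrightarrow> gnorm_le k (C i) (f i)) \<Longrightarrow> gnorm_le k (\<Sum>i\<in>S. C i) (\<lambda>t. \<Sum>i\<in>S. f i t)"
  by (induction S rule: finite_induct) (auto intro: gnorm_le_const gnorm_le_add)

text \<open>From left to right the given chain \<open>d\<close> supplies the witnesses. From right
  to left the witnesses of finite order may depend on the order, so the chain is rebuilt from the
  iterates of \<open>gder\<close>, which do not.\<close>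

lemma Ginf_iff: "g \<in> Ginf I \<longleftrightarrow> (\<forall>k. \<exists>C. gnorm_le k C g)"
proof
  assume "g \<in> Ginf I"
  then obtain d where g: "g \<in> GG I" "d 0 = g" "\<And>k. has_gder I (d k) (d (Suc k))"
    unfolding Ginf_def by blast
  have GGd: "d k \<in> GG I" for k using g has_gder_GG by (cases k) auto
  have "\<exists>C. gnorm_le k C (d j)" for k j
  proof (induction k arbitrary: j)
    case 0 then show ?case using GG_bound[OF GGd] GGd by auto
  next
    case (Suc k)
    obtain C where C: "gnorm_le k C (d (Suc j))" using Suc by blast
    obtain D where D: "AE t in lebesgue_on I. norm (d j t) \<le> D" using GG_bound[OF GGd] by blast
    have "AE t in lebesgue_on I. norm (d j t) \<le> max C D" using D by eventually_elim simp
    moreover have "gnorm_le k (max C D) (d (Suc j))" using C by (rule gnorm_le_mono) simp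
    ultimately have "gnorm_le (Suc k) (max C D) (d j)" using g(3) GGd by auto
    then show ?case by blast
  qed
  with g(2) show "\<forall>k. \<exists>C. gnorm_le k C g" by blast
next
  assume *: "\<forall>k. \<exists>C. gnorm_le k C g"
  have 1: "\<forall>k. \<exists>C. gnorm_le k C ((gder I ^^ j) g)" for j
  proof (induction j)
    case (Suc j) then show ?case using gnorm_le_Suc_gder by (metis comp_apply funpow.simps(2))
  qed (use * in simp)
  have 2: "has_gder I ((gder I ^^ j) g) ((gder I ^^ Suc j) g)" for j
  proof -
    obtain C where "gnorm_le (Suc 0) C ((gder I ^^ j) g)" using 1[of j] by blast
    then show ?thesis unfolding gnorm_le_Suc_gder by simp
  qed
  show "g \<in> Ginf I" unfolding Ginf_def
    using * gnorm_le_GG 2 by (intro CollectI conjI exI[of _ "\<lambda>j. (gder I ^^ j) g"]) auto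
qed

lemma gnorm_le_iff_gder: "g \<in> Ginf I \<Longrightarrow> gnorm_le k C g \<longleftrightarrow> (\<forall>i\<le>k. AE t in lebesgue_on I. norm ((gder I ^^ i) g t) \<le> C)"
proof (induction k arbitrary: g)
  case 0
  then show ?case by (auto simp: Ginf_def)
next
  case (Suc k)
  have g: "g \<in> GG I" "has_gder I g (gder I g)" "gder I g \<in> Ginf I"
  proof -
    show "g \<in> GG I" using Suc.prems by (simp add: Ginf_def)
    show "has_gder I g (gder I g)" using Suc.prems Ginf_iff gnorm_le_Suc_gder by blast
    show "gder I g \<in> Ginf I" using Suc.prems unfolding Ginf_iff using gnorm_le_Suc_gder by metis
  qed
  have "(\<forall>i\<le>Suc k. P i) \<longleftrightarrow> P 0 \<and> (\<forall>i\<le>k. P (Suc i))" for P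
    by (metis Suc_le_mono le0 not0_implies_Suc)
  from this[of "\<lambda>i. AE t in lebesgue_on I. norm ((gder I ^^ i) g t) \<le> C"]
  show ?case unfolding gnorm_le_Suc_gder using g Suc.IH[OF g(3)] by (simp add: funpow_swap1)
qed

text \<open>\<open>real_of_ereal\<close> sends both infinities to 0, so the essential supremum must
  first be shown finite: from above by essential boundedness, from below because \<open>I\<close> is
  not null.\<close>

lemma Linf_norm_le:
  assumes g: "g \<in> GG I" and C: "0 \<le> C"
  shows "Linf_norm I g \<le> C \<longleftrightarrow> (AE t in lebesgue_on I. norm (g t) \<le> C)"
proof -
  let ?e = "esssup (lebesgue_on I) (\<lambda>t. ereal (norm (g t)))"
  have m: "(\<lambda>t. ereal (norm (g t))) \<in> borel_measurable (lebesgue_on I)"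
    using GG_meas[OF g] by measurable
  have ae: "AE t in lebesgue_on I. ereal (norm (g t)) \<le> ?e" by (rule esssup_AE)
  obtain D where D: "AE t in lebesgue_on I. norm (g t) \<le> D" using GG_bound[OF g] by blast
  then have "?e \<le> ereal D" by (intro esssup_I m) simp
  moreover have "0 \<le> ?e"
  proof (rule ccontr)
    assume neg: "\<not> 0 \<le> ?e"
    have "AE t in lebesgue. t \<in> I \<longrightarrow> False"
      using ae[unfolded AE_I]
    proof eventually_elim
      case (elim t)
      show ?case
      proof
        assume "t \<in> I"
        with elim have "ereal (norm (g t)) \<le> ?e" by blast
        moreover have "0 \<le> ereal (norm (g t))" by simp
        ultimately show False using neg by (meson order_trans)
      qed
    qed
    then show False using AE_open_const open_I ne_I by blast
  qed
  ultimately obtain r where r: "?e = ereal r" by (cases ?e) auto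
  show ?thesis
  proof
    assume "Linf_norm I g \<le> C"
    then have "r \<le> C" by (simp add: Linf_norm_def r)
    with ae r show "AE t in lebesgue_on I. norm (g t) \<le> C" by (elim AE_mp) (auto intro!: AE_I2)
  next
    assume "AE t in lebesgue_on I. norm (g t) \<le> C"
    then have "?e \<le> ereal C" by (intro esssup_I m) simp
    then show "Linf_norm I g \<le> C" by (simp add: Linf_norm_def r)
  qed
qed

lemma Ginf_GG: "g \<in> Ginf I \<Longrightarrow> g \<in> GG I"
  by (simp add: Ginf_def)

lemma gder_Ginf: "g \<in> Ginf I \<Longrightarrow> gder I g \<in> Ginf I"
  unfolding Ginf_iff using gnorm_le_Suc_gder by metis

lemma Ginf_gder: "g \<in> Ginf I \<Longrightarrow> has_gder I g (gder I g)"
  using Ginf_iff gnorm_le_Suc_gder by blast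

lemma gder_pow_Ginf: "g \<in> Ginf I \<Longrightarrow> (gder I ^^ i) g \<in> Ginf I"
  by (induction i) (auto intro: gder_Ginf)

lemma Ginf_norm_le:
  assumes "g \<in> Ginf I" "0 \<le> C"
  shows "Ginf_norm I k g \<le> C \<longleftrightarrow> gnorm_le k C g"
  unfolding gnorm_le_iff_gder[OF assms(1)] Ginf_norm_def
  using assms Linf_norm_le[OF Ginf_GG[OF gder_pow_Ginf]] by (subst Max_le_iff) auto

lemma Ginf_add: "f \<in> Ginf I \<Longrightarrow> g \<in> Ginf I \<Longrightarrow> (\<lambda>t. f t + g t) \<in> Ginf I"
  unfolding Ginf_iff using gnorm_le_add by metis
lemma Ginf_mult: "f \<in> Ginf I \<Longrightarrow> g \<in> Ginf I \<Longrightarrow> (\<lambda>t. f t * g t) \<in> Ginf I"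
  unfolding Ginf_iff using gnorm_le_mult by metis
lemma Ginf_const: "(\<lambda>_. c) \<in> Ginf I"
  unfolding Ginf_iff using gnorm_le_const by blast
lemma Ginf_cmult: "f \<in> Ginf I \<Longrightarrow> (\<lambda>t. c * f t) \<in> Ginf I"
  by (rule Ginf_mult[OF Ginf_const])
lemma Ginf_ae_eq: "f \<in> Ginf I \<Longrightarrow> ae_eq I f g \<Longrightarrow> g \<in> Ginf I"
  unfolding Ginf_iff using gnorm_le_ae_eq by metis

lemma Ginf_chain:
  assumes "d 0 \<in> GG I" "\<And>k. has_gder I (d k) (d (Suc k))"
  shows "d 0 \<in> Ginf I"
  unfolding Ginf_def using assms by blast

text \<open>\<open>gder\<close> picks an arbitrary representative, so an explicit chain of
  derivatives can match its iterates only almost everywhere.\<close>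

lemma gder_chain:
  assumes "\<And>k. has_gder I (d k) (d (Suc k))"
  shows "ae_eq I ((gder I ^^ k) (d 0)) (d k)"
proof (induction k)
  case (Suc k)
  have "has_gder I ((gder I ^^ k) (d 0)) (d (Suc k))"
    using has_gder_ae_eq[OF assms ae_eq_sym[OF Suc] ae_eq_refl] .
  then show ?case using gder_ae_eq by simp
qed simp

end

section \<open>Ordinary one-sided limits and piecewise smooth functions\<close>

lemma vector_derivative_quot:
  fixes f :: "real \<Rightarrow> complex"
  assumes "(f has_vector_derivative D) (at t within S)"
  shows "((\<lambda>s. (f s - f t) / of_real (s - t)) \<longlongrightarrow> D) (at t within S)"
proof -
  have "((\<lambda>s. norm ((f s - f t) - (s - t) *\<^sub>R D) / norm (s - t)) \<longlongrightarrow> 0) (at t within S)"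
    using assms unfolding has_vector_derivative_def has_derivative_iff_norm by blast
  moreover have "norm ((f s - f t) - (s - t) *\<^sub>R D) / norm (s - t) = norm ((f s - f t) / of_real (s - t) - D)"
    if "s \<noteq> t" for s
  proof -
    have "(f s - f t) / of_real (s - t) - D = ((f s - f t) - (s - t) *\<^sub>R D) / of_real (s - t)"
      using that by (simp add: diff_divide_distrib scaleR_conv_of_real)
    then show ?thesis by (simp only: norm_divide norm_of_real real_norm_def)
  qed
  then have "eventually (\<lambda>s. norm ((f s - f t) - (s - t) *\<^sub>R D) / norm (s - t) =
      norm ((f s - f t) / of_real (s - t) - D)) (at t within S)"
    unfolding eventually_at_filter by simp
  ultimately have "((\<lambda>s. norm ((f s - f t) / of_real (s - t) - D)) \<longlongrightarrow> 0) (at t within S)"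
    using tendsto_cong by fast
  from tendsto_norm_zero_cancel[OF this] show ?thesis by (rule iffD2[OF Lim_null])
qed

lemma side_at_le: "side_at b t \<le> at t"
  by (auto simp: side_at_def intro: at_le)

lemma side_at_cong: "d > 0 \<Longrightarrow> (\<And>s. s \<in> side_nbh b t d \<Longrightarrow> f s = g s) \<Longrightarrow>
    (f \<longlongrightarrow> l) (side_at b t) \<longleftrightarrow> (g \<longlongrightarrow> l) (side_at b t)"
  by (rule tendsto_cong) (auto simp: eventually_side_at)

text \<open>A smooth function together with all its derivatives, named explicitly so that no choice
  of derivatives intervenes.\<close>

definition smooth_chain :: "(nat \<Rightarrow> real \<Rightarrow> complex) \<Rightarrow> bool" where
  "smooth_chain H \<longleftrightarrow> (\<forall>k s. (H k has_vector_derivative H (Suc k) s) (at s))"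

text \<open>Half-open, so that indicators of adjacent intervals add up without overlap at the common
  knot and the function is right-continuous like \<open>rep\<close>.\<close>

definition ind :: "real \<Rightarrow> real \<Rightarrow> real \<Rightarrow> complex" where
  "ind p q t = (if p \<le> t \<and> t < q then 1 else 0)"

lemma ind_measurable [measurable]: "ind p q \<in> borel_measurable borel"
  unfolding ind_def by measurable

lemma smooth_chain_measurable: "smooth_chain H \<Longrightarrow> H k \<in> borel_measurable borel"
  unfolding smooth_chain_def
  by (intro borel_measurable_continuous_onI continuous_at_imp_continuous_on)
     (metis has_vector_derivative_continuous)

context ival begin

text \<open>The right-continuous representative, for which essential one-sided limits are ordinary ones.\<close>

definition rep :: "(real \<Rightarrow> complex) \<Rightarrow> real \<Rightarrow> complex" where
  "rep g t = (if t \<in> I then ess_lim True g t else 0)"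

lemma rep_in: "t \<in> I \<Longrightarrow> rep g t = ess_lim True g t"
  by (simp add: rep_def)

lemma rep_ae: "g \<in> GG I \<Longrightarrow> ae_eq I g (rep g)"
proof -
  assume "g \<in> GG I"
  then have "AE t in lebesgue. t \<in> I \<longrightarrow> g t = ess_lim True g t"
    using ae_ess_lim[of g True, unfolded AE_I] by blast
  then show ?thesis unfolding ae_eq_def AE_I by eventually_elim (simp add: rep_def)
qed

lemma rep_ess_lim: "g \<in> GG I \<Longrightarrow> t \<in> I \<Longrightarrow> ess_lim b (rep g) t = ess_lim b g t"
  using ae_eq_ess_lim[OF rep_ae] by simp

lemma rep_lim:
  assumes g: "g \<in> GG I" and t: "t \<in> I"
  shows "(rep g \<longlongrightarrow> ess_lim b g t) (side_at b t)"
proof (rule tendstoI)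
  fix e :: real assume e: "e > 0"
  obtain d where d: "d > 0" "side_nbh b t d \<subseteq> I" "\<forall>s\<in>side_nbh b t d. \<forall>b'. norm (ess_lim b' g s - ess_lim b g t) \<le> e / 2"
    using ess_lim_near[OF g t, of "e/2" b] e by force
  have "dist (rep g s) (ess_lim b g t) < e" if "s \<in> side_nbh b t d" for s
  proof -
    have "norm (ess_lim True g s - ess_lim b g t) \<le> e / 2" using d(3) that by blast
    moreover have "rep g s = ess_lim True g s" using d(2) that rep_in by blast
    ultimately show ?thesis using e by (simp add: dist_norm)
  qed
  then show "eventually (\<lambda>s. dist (rep g s) (ess_lim b g t) < e) (side_at b t)"
    unfolding eventually_side_at using d(1) by blast
qed

lemma rep_right: "g \<in> GG I \<Longrightarrow> t \<in> I \<Longrightarrow> (rep g \<longlongrightarrow> rep g t) (at_right t)"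
  using rep_lim[of g t True] by (simp add: rep_in side_at_def)

lemma ess_lim_norm_le:
  assumes g: "g \<in> GG I" and t: "t \<in> I" and C: "AE t in lebesgue_on I. norm (g t) \<le> C"
  shows "norm (ess_lim b g t) \<le> C"
proof -
  have "norm (ess_lim b g t - 0) \<le> C"
    using ess_lim_bound[OF g t, of 0 C b] eventually_ess_AE[OF C t, of b] by simp
  then show ?thesis by simp
qed

lemma rep_norm_le:
  assumes "g \<in> GG I" "AE t in lebesgue_on I. norm (g t) \<le> C" "0 \<le> C"
  shows "norm (rep g t) \<le> C"
  using ess_lim_norm_le[OF assms(1) _ assms(2)] assms(3) by (simp add: rep_def)

lemma rep_GG: "g \<in> GG I \<Longrightarrow> rep g \<in> GG I"
  using GG_ae_eq rep_ae by blast

lemma rep_measurable: "g \<in> GG I \<Longrightarrow> rep g \<in> borel_measurable lebesgue"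
proof -
  assume g: "g \<in> GG I"
  have "(\<lambda>t. indicator I t *\<^sub>R rep g t) \<in> borel_measurable lebesgue"
    using GG_meas[OF rep_GG[OF g]] by (simp add: borel_measurable_restrict_space_iff)
  moreover have "(\<lambda>t. indicator I t *\<^sub>R rep g t) = rep g"
    by (auto simp: rep_def indicator_def)
  ultimately show ?thesis by simp
qed

text \<open>The quotient estimate is known at almost every point near t. Right-continuity of
  \<open>rep\<close> makes the quotient at s a limit from the right of quotients at such points, so
  the estimate holds at every s.\<close>

lemma has_gder_ordinary:
  assumes g: "g \<in> GG I" and gh: "has_gder I g h" and t: "t \<in> I"
  shows "((\<lambda>s. (rep g s - ess_lim b g t) / of_real (s - t)) \<longlongrightarrow> ess_lim b h t) (side_at b t)"
proof (rule tendstoI)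
  fix e :: real assume e: "e > 0"
  have 1: "has_gder I (rep g) h"
    using has_gder_ae_eq[OF gh rep_ae[OF g] ae_eq_refl] .
  let ?q = "\<lambda>s. (rep g s - ess_lim b g t) / of_real (s - t)"
  have "(?q \<longlongrightarrow> ess_lim b h t) (ess b t)"
    using has_gder_quot[OF 1 t, of b] by (simp add: rep_ess_lim[OF g t])
  then have "eventually (\<lambda>s. dist (?q s) (ess_lim b h t) < e / 2) (ess b t)"
    using e by (intro tendstoD) auto
  then obtain d1 where d1: "d1 > 0" "AE s in lebesgue. s \<in> side_nbh b t d1 \<longrightarrow> dist (?q s) (ess_lim b h t) < e / 2"
    unfolding eventually_ess by blast
  obtain d2 where d2: "d2 > 0" "\<forall>d\<le>d2. side_nbh b t d \<subseteq> I" using side_nbh_in_I[OF t, of b] by blast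
  define d where "d = min d1 d2"
  have dI: "side_nbh b t d \<subseteq> I" and dd: "side_nbh b t d \<subseteq> side_nbh b t d1" and d0: "d > 0"
    using d1 d2 side_nbh_mono[of d d1 b t] by (auto simp: d_def)
  have "dist (?q s) (ess_lim b h t) < e" if s: "s \<in> side_nbh b t d" for s
  proof -
    have ae: "AE r in lebesgue. r \<in> side_nbh b t d \<longrightarrow> norm (?q r - ess_lim b h t) \<le> e / 2"
      using d1(2) by eventually_elim (use dd in \<open>auto simp: dist_norm\<close>)
    have "(?q \<longlongrightarrow> ?q s) (side_at True s)"
    proof -
      have "(rep g \<longlongrightarrow> rep g s) (at_right s)" using rep_right[OF g] dI s by blast
      moreover have "of_real (s - t) \<noteq> (0::complex)" using side_nbh_not_self[OF s] by simp
      ultimately show ?thesis unfolding side_at_def by (auto intro!: tendsto_intros)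
    qed
    then have "(?q \<longlongrightarrow> ?q s) (ess True s)" using tendsto_mono ess_le by blast
    then have "((\<lambda>r. norm (?q r - ess_lim b h t)) \<longlongrightarrow> norm (?q s - ess_lim b h t)) (ess True s)"
      by (rule tendsto_norm[OF tendsto_diff[OF _ tendsto_const]])
    then have "norm (?q s - ess_lim b h t) \<le> e / 2"
      by (rule tendsto_upperbound) (use eventually_ess_open[OF ae open_side_nbh s] in auto)
    then show ?thesis using e by (simp add: dist_norm)
  qed
  then show "eventually (\<lambda>s. dist (?q s) (ess_lim b h t) < e) (side_at b t)"
    unfolding eventually_side_at using d0 by blast
qed

text \<open>Explicit piecewise functions enter \<open>Ginf I\<close> through this lemma. On each
  side of each point one smooth chain \<open>H\<close> on one neighbourhood describes every
  \<open>F k\<close>, so one-sided limits and derivatives are read off from \<open>H\<close> at t,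
  whatever \<open>F\<close> does at t itself.\<close>

lemma piecewise_smooth:
  assumes meas: "\<And>k. F k \<in> borel_measurable (lebesgue_on I)"
    and bnd: "\<And>k. \<exists>B. \<forall>t\<in>I. norm (F k t) \<le> B"
    and loc: "\<And>t b. t \<in> I \<Longrightarrow> \<exists>H d. d > 0 \<and> smooth_chain H \<and> (\<forall>k. \<forall>s\<in>side_nbh b t d. F k s = H k s)"
  shows "F k \<in> GG I" "has_gder I (F k) (F (Suc k))"
proof -
  have lim: "(F k \<longlongrightarrow> H k t) (side_at b t)" 
    if H: "d > 0" "smooth_chain H" "\<forall>k. \<forall>s\<in>side_nbh b t d. F k s = H k s" for b t d H k
  proof -
    have "continuous (at t) (H k)"
      using H(2) unfolding smooth_chain_def using has_vector_derivative_continuous by blast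
    then have "(H k \<longlongrightarrow> H k t) (side_at b t)"
      unfolding continuous_within using tendsto_mono[OF side_at_le] by blast
    then show ?thesis using side_at_cong[OF H(1), of b t "F k" "H k"] H(3) by blast
  qed
  have GG: "F k \<in> GG I" for k
  proof -
    obtain B where B: "\<forall>t\<in>I. norm (F k t) \<le> B" using bnd by blast
    have "AE t in lebesgue_on I. norm (F k t) \<le> B"
      using AE_space by eventually_elim (use B in simp)
    then show ?thesis
    proof (rule GG_I[OF meas])
      fix t b assume "t \<in> I"
      then obtain H d where "d > 0" "smooth_chain H" "\<forall>k. \<forall>s\<in>side_nbh b t d. F k s = H k s"
        using loc by blast
      from lim[OF this] show "\<exists>l. (F k \<longlongrightarrow> l) (ess b t)"
        using tendsto_mono[OF ess_le] by blast
    qed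
  qed
  then show "F k \<in> GG I" .
  show "has_gder I (F k) (F (Suc k))"
    unfolding has_gder_iff
  proof (intro conjI ballI allI GG)
    fix t b assume "t \<in> I"
    then obtain H d where H: "d > 0" "smooth_chain H" "\<forall>k. \<forall>s\<in>side_nbh b t d. F k s = H k s"
      using loc by blast
    have 1: "ess_lim b (F k) t = H k t" for k using ess_lim_side[OF lim[OF H]] .
    have "((\<lambda>s. (H k s - H k t) / of_real (s - t)) \<longlongrightarrow> H (Suc k) t) (at t)"
      using vector_derivative_quot H(2) unfolding smooth_chain_def by blast
    then have "((\<lambda>s. (H k s - H k t) / of_real (s - t)) \<longlongrightarrow> H (Suc k) t) (side_at b t)"
      by (rule tendsto_mono[OF side_at_le])
    then have "((\<lambda>s. (F k s - H k t) / of_real (s - t)) \<longlongrightarrow> H (Suc k) t) (side_at b t)"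
      by (subst side_at_cong[OF H(1), of b t _ "\<lambda>s. (H k s - H k t) / of_real (s - t)"]) (use H(3) in auto)
    then show "((\<lambda>s. (F k s - ess_lim b (F k) t) / of_real (s - t)) \<longlongrightarrow> ess_lim b (F (Suc k)) t) (ess b t)"
      unfolding 1 by (rule tendsto_mono[OF ess_le])
  qed
qed

lemma smooth_chain_0: "smooth_chain (\<lambda>k. if k = 0 then (\<lambda>_. c) else (\<lambda>_. 0))"
  unfolding smooth_chain_def by (auto intro: derivative_eq_intros)

lemma borel_I: "f \<in> borel_measurable borel \<Longrightarrow> f \<in> borel_measurable (lebesgue_on I)" 
  for f :: "real \<Rightarrow> complex"
  by (rule measurable_restrict_space1) (simp add: measurable_completion)

text \<open>A right neighbourhood of t sees the condition as it stands at t, a left one as it stands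
  just before t, which turns \<le> into <.\<close>

lemma side_local_const: "\<exists>d>0. \<forall>s\<in>side_nbh b t d. (p \<le> s \<longleftrightarrow> (if b then p \<le> t else p < t))"
proof -
  let ?d = "if t = p then 1 else \<bar>t - p\<bar>"
  have "\<forall>s\<in>side_nbh b t ?d. (p \<le> s \<longleftrightarrow> (if b then p \<le> t else p < t))"
    by (auto simp: side_nbh_def abs_if split: if_splits)
  then show ?thesis by (intro exI[of _ ?d]) auto
qed

lemma ind_local: "\<exists>d>0. \<exists>c. \<forall>s\<in>side_nbh b t d. ind p q s = c"
proof -
  obtain d1 where d1: "d1 > 0" "\<forall>s\<in>side_nbh b t d1. (p \<le> s \<longleftrightarrow> (if b then p \<le> t else p < t))"
    using side_local_const by blast
  obtain d2 where d2: "d2 > 0" "\<forall>s\<in>side_nbh b t d2. (q \<le> s \<longleftrightarrow> (if b then q \<le> t else q < t))"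
    using side_local_const by blast
  have "ind p q s = (if (if b then p \<le> t else p < t) \<and> \<not> (if b then q \<le> t else q < t) then 1 else 0)"
    if "s \<in> side_nbh b t (min d1 d2)" for s
  proof -
    have "s \<in> side_nbh b t d1" "s \<in> side_nbh b t d2"
      using that side_nbh_mono[of "min d1 d2" d1 b t] side_nbh_mono[of "min d1 d2" d2 b t] by auto
    then have "p \<le> s \<longleftrightarrow> (if b then p \<le> t else p < t)" "q \<le> s \<longleftrightarrow> (if b then q \<le> t else q < t)"
      using d1 d2 by blast+
    then show ?thesis unfolding ind_def not_le[symmetric] by presburger
  qed
  then show ?thesis using d1(1) d2(1) by (intro exI[of _ "min d1 d2"]) auto
qed

text \<open>One-sided derivatives do not see jumps, so the indicator has derivative 0 everywhere.
  Hence cutting by \<open>ind\<close> commutes with differentiation, which the constructions below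
  use throughout.\<close>

lemma ind_chain: "ind p q \<in> GG I" "has_gder I (ind p q) (\<lambda>_. 0)"
proof -
  define F :: "nat \<Rightarrow> real \<Rightarrow> complex" where "F k = (if k = 0 then ind p q else (\<lambda>_. 0))" for k
  have "F k \<in> borel_measurable (lebesgue_on I)" for k
    by (auto simp: F_def intro: borel_I)
  moreover have "\<exists>B. \<forall>t\<in>I. norm (F k t) \<le> B" for k
    by (intro exI[of _ 1]) (auto simp: F_def ind_def)
  moreover have "\<exists>H d. d > 0 \<and> smooth_chain H \<and> (\<forall>k. \<forall>s\<in>side_nbh b t d. F k s = H k s)" for b t
  proof -
    obtain d c where "d > 0" "\<forall>s\<in>side_nbh b t d. ind p q s = c" using ind_local[of b t p q] by blast
    then show ?thesis
      by (intro exI[of _ "\<lambda>k. if k = 0 then (\<lambda>_. c) else (\<lambda>_. 0)"] exI[of _ d])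
         (auto simp: F_def smooth_chain_0)
  qed
  ultimately have "F 0 \<in> GG I" "has_gder I (F 0) (F (Suc 0))"
    using piecewise_smooth[of F] by blast+
  then show "ind p q \<in> GG I" "has_gder I (ind p q) (\<lambda>_. 0)" by (auto simp: F_def)
qed

lemma has_gder_ind:
  assumes "g \<in> GG I" "has_gder I g h"
  shows "has_gder I (\<lambda>t. ind p q t * g t) (\<lambda>t. ind p q t * h t)"
  using has_gder_mult[OF ind_chain assms, of p q] by simp

lemma ind_smooth_chain:
  assumes H: "smooth_chain H"
  shows "(\<lambda>t. ind p q t * H k t) \<in> GG I" "has_gder I (\<lambda>t. ind p q t * H k t) (\<lambda>t. ind p q t * H (Suc k) t)"
proof -
  define F where "F k t = ind p q t * H k t" for k t
  have m: "H k \<in> borel_measurable borel" for k by (rule smooth_chain_measurable[OF H])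
  have "F k \<in> borel_measurable (lebesgue_on I)" for k
    unfolding F_def using m by (intro borel_I) measurable
  moreover have "\<exists>B. \<forall>t\<in>I. norm (F k t) \<le> B" for k
  proof -
    have "continuous_on {p..q} (H k)"
      using H unfolding smooth_chain_def
      by (intro continuous_at_imp_continuous_on) (metis has_vector_derivative_continuous)
    then have "bounded (H k ` {p..q})" using compact_continuous_image compact_imp_bounded compact_Icc by blast
    then obtain B where B: "\<forall>t\<in>{p..q}. norm (H k t) \<le> B" unfolding bounded_iff by auto
    then have "norm (F k t) \<le> max B 0" for t by (auto simp: F_def ind_def le_max_iff_disj)
    then show ?thesis by blast
  qed
  moreover have "\<exists>H d. d > 0 \<and> smooth_chain H \<and> (\<forall>k. \<forall>s\<in>side_nbh b t d. F k s = H k s)" for b t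
  proof -
    obtain d c where dc: "d > 0" "\<forall>s\<in>side_nbh b t d. ind p q s = c" using ind_local[of b t p q] by blast
    have "smooth_chain (\<lambda>k t. c * H k t)"
      using H unfolding smooth_chain_def by (auto intro: derivative_eq_intros)
    then show ?thesis
      using dc by (intro exI[of _ "\<lambda>k t. c * H k t"] exI[of _ d]) (auto simp: F_def)
  qed
  ultimately show "(\<lambda>t. ind p q t * H k t) \<in> GG I"
      "has_gder I (\<lambda>t. ind p q t * H k t) (\<lambda>t. ind p q t * H (Suc k) t)"
    using piecewise_smooth[of F k] unfolding F_def by auto
qed

lemma ind_smooth_Ginf: "smooth_chain H \<Longrightarrow> (\<lambda>t. ind p q t * H 0 t) \<in> Ginf I"
  using Ginf_chain[of "\<lambda>k t. ind p q t * H k t"] ind_smooth_chain by blast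

lemma ind_Ginf: "ind p q \<in> Ginf I"
  using ind_smooth_Ginf[OF smooth_chain_0[of 1], of p q] by simp

subsection \<open>Test functions and distributions through seminorm bounds\<close>

lemma Icc_I: "c \<in> I \<Longrightarrow> d \<in> I \<Longrightarrow> {c..d} \<subseteq> I"
  using int_I unfolding is_interval_1 by (meson atLeastAtMost_iff subsetI)

lemma admissible_Icc: "{c..d} \<subseteq> I \<Longrightarrow> admissible I {c..d}"
  unfolding admissible_def by auto

text \<open>The complement of \<open>{c..d}\<close> is open, so vanishing almost everywhere there
  amounts to vanishing of all one-sided limits there. The limits at c and d themselves are left
  open.\<close>

lemma test_on_Icc: "{c..d} \<subseteq> I \<Longrightarrow> \<phi> \<in> test_on I {c..d} \<longleftrightarrow> \<phi> \<in> Ginf I \<and> (\<forall>t\<in>I. t < c \<or> d < t \<longrightarrow> (\<forall>b. ess_lim b \<phi> t = 0))"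
proof
  assume \<phi>: "\<phi> \<in> test_on I {c..d}"
  then have G: "\<phi> \<in> GG I" by (auto simp: test_on_def Ginf_GG)
  have "ess_lim b \<phi> t = 0" if t: "t \<in> I" "t < c \<or> d < t" for t b
  proof -
    have ae: "AE s in lebesgue. s \<in> I - {c..d} \<longrightarrow> \<phi> s = 0"
      using \<phi> unfolding test_on_def AE_I by auto
    have "eventually (\<lambda>s. \<phi> s = 0) (ess b t)"
      by (rule eventually_ess_open[OF ae]) (use t open_I in auto)
    then have "ess_lim b \<phi> t = ess_lim b (\<lambda>_. 0) t" by (rule ess_lim_cong)
    then show ?thesis by simp
  qed
  with \<phi> show "\<phi> \<in> Ginf I \<and> (\<forall>t\<in>I. t < c \<or> d < t \<longrightarrow> (\<forall>b. ess_lim b \<phi> t = 0))"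
    by (auto simp: test_on_def)
next
  assume \<phi>: "\<phi> \<in> Ginf I \<and> (\<forall>t\<in>I. t < c \<or> d < t \<longrightarrow> (\<forall>b. ess_lim b \<phi> t = 0))"
  have "AE t in lebesgue_on I. \<phi> t = ess_lim True \<phi> t" using ae_ess_lim Ginf_GG \<phi> by blast
  then have "AE t in lebesgue_on I. t \<notin> {c..d} \<longrightarrow> \<phi> t = 0"
    using AE_space by eventually_elim (use \<phi> in auto)
  with \<phi> show "\<phi> \<in> test_on I {c..d}" by (simp add: test_on_def)
qed

lemma supp_iff: "supp I \<phi> = I \<inter> closure {t \<in> I. \<exists>b. ess_lim b \<phi> t \<noteq> 0}"
  unfolding supp_def rlim_ess_lim llim_ess_lim by (simp add: ex_bool_eq disj_commute)

lemma test_onI: "{c..d} \<subseteq> I \<Longrightarrow> \<phi> \<in> test_on I {c..d} \<Longrightarrow> \<phi> \<in> test I"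
proof -
  assume cd: "{c..d} \<subseteq> I" and \<phi>: "\<phi> \<in> test_on I {c..d}"
  have "{t \<in> I. \<exists>b. ess_lim b \<phi> t \<noteq> 0} \<subseteq> {c..d}"
  proof
    fix t assume "t \<in> {t \<in> I. \<exists>b. ess_lim b \<phi> t \<noteq> 0}"
    then have "\<not> (t < c \<or> d < t)" using \<phi> unfolding test_on_Icc[OF cd] by blast
    then show "t \<in> {c..d}" by auto
  qed
  then have cl: "closure {t \<in> I. \<exists>b. ess_lim b \<phi> t \<noteq> 0} \<subseteq> {c..d}" by (rule closure_minimal) simp
  then have "supp I \<phi> = closure {t \<in> I. \<exists>b. ess_lim b \<phi> t \<noteq> 0}" using cd unfolding supp_iff by blast
  moreover have "compact (closure {t \<in> I. \<exists>b. ess_lim b \<phi> t \<noteq> 0})"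
    using bounded_subset[OF bounded_closed_interval cl] by (simp add: compact_eq_bounded_closed)
  ultimately show ?thesis using \<phi> by (simp add: test_def test_on_def)
qed

lemma compact_in_Icc:
  assumes "compact K" "K \<subseteq> I"
  shows "\<exists>c d. c \<le> d \<and> {c..d} \<subseteq> I \<and> K \<subseteq> {c..d}"
proof (cases "K = {}")
  case True
  obtain x where "x \<in> I" using ne_I by blast
  with True show ?thesis by (intro exI[of _ x]) auto
next
  case False
  obtain c d where c: "c \<in> K" "\<forall>t\<in>K. c \<le> t" and d: "d \<in> K" "\<forall>t\<in>K. t \<le> d"
    using compact_attains_inf[OF assms(1) False] compact_attains_sup[OF assms(1) False] by blast
  then show ?thesis using assms(2) Icc_I[of c d] by (intro exI[of _ c] exI[of _ d]) auto
qed

lemma testE: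
  assumes "\<phi> \<in> test I"
  obtains c d where "c \<le> d" "{c..d} \<subseteq> I" "\<phi> \<in> test_on I {c..d}" "supp I \<phi> \<subseteq> {c..d}"
proof -
  have K: "compact (supp I \<phi>)" "supp I \<phi> \<subseteq> I" using assms by (auto simp: test_def supp_def)
  obtain c d where cd: "c \<le> d" "{c..d} \<subseteq> I" "supp I \<phi> \<subseteq> {c..d}" using compact_in_Icc[OF K] by blast
  have "ess_lim b \<phi> t = 0" if "t \<in> I" "t < c \<or> d < t" for t b
  proof (rule ccontr)
    assume "ess_lim b \<phi> t \<noteq> 0"
    then have "t \<in> {t \<in> I. \<exists>b. ess_lim b \<phi> t \<noteq> 0}" using that(1) by blast
    then have "t \<in> supp I \<phi>" using that(1) closure_subset[of "{t \<in> I. \<exists>b. ess_lim b \<phi> t \<noteq> 0}"]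
      unfolding supp_iff by (meson IntI subsetD)
    then show False using cd(3) that by auto
  qed
  then have "\<phi> \<in> test_on I {c..d}"
    using assms unfolding test_on_Icc[OF cd(2)] by (auto simp: test_def)
  then show ?thesis using that cd by blast
qed

lemma test_Ginf: "\<phi> \<in> test I \<Longrightarrow> \<phi> \<in> Ginf I" by (simp add: test_def)

lemma test_on_mono: "\<phi> \<in> test_on I J \<Longrightarrow> J \<subseteq> K \<Longrightarrow> \<phi> \<in> test_on I K"
  unfolding test_on_def AE_I by (auto elim: AE_mp)

lemma admissible_in_Icc:
  assumes "admissible I J"
  shows "\<exists>c d. c \<le> d \<and> {c..d} \<subseteq> I \<and> J \<subseteq> {c..d}"
proof -
  have "compact (closure J)" "closure J \<subseteq> I"
    using assms by (auto simp: admissible_def compact_closure)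
  then obtain c d where "c \<le> d" "{c..d} \<subseteq> I" "closure J \<subseteq> {c..d}" using compact_in_Icc by blast
  then show ?thesis using closure_subset by blast
qed

lemma test_on_admissible: "admissible I J \<Longrightarrow> \<phi> \<in> test_on I J \<Longrightarrow> \<phi> \<in> test I"
  using admissible_in_Icc test_on_mono test_onI by metis

lemma test_on_lin:
  assumes "\<phi> \<in> test_on I J" "\<psi> \<in> test_on I J"
  shows "(\<lambda>t. \<alpha> * \<phi> t + \<beta> * \<psi> t) \<in> test_on I J"
proof -
  have 1: "AE t in lebesgue_on I. t \<notin> J \<longrightarrow> \<phi> t = 0" and 2: "AE t in lebesgue_on I. t \<notin> J \<longrightarrow> \<psi> t = 0"
    using assms by (auto simp: test_on_def)
  have "AE t in lebesgue_on I. t \<notin> J \<longrightarrow> \<alpha> * \<phi> t + \<beta> * \<psi> t = 0"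
    using 1 2 by eventually_elim simp
  then show ?thesis using assms by (simp add: test_on_def Ginf_add Ginf_cmult)
qed

lemma test_on_mult:
  assumes "g \<in> Ginf I" "\<phi> \<in> test_on I J"
  shows "(\<lambda>t. g t * \<phi> t) \<in> test_on I J"
proof -
  have 1: "AE t in lebesgue_on I. t \<notin> J \<longrightarrow> \<phi> t = 0" 
    using assms by (auto simp: test_on_def)
  have "AE t in lebesgue_on I. t \<notin> J \<longrightarrow> g t * \<phi> t = 0"
    using 1 by eventually_elim simp
  then show ?thesis using assms by (simp add: test_on_def Ginf_mult)
qed

lemma test_on_gder:
  assumes cd: "{c..d} \<subseteq> I" and \<phi>: "\<phi> \<in> test_on I {c..d}"
  shows "gder I \<phi> \<in> test_on I {c..d}"
  unfolding test_on_Icc[OF cd]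
proof (intro conjI ballI impI allI)
  have G: "\<phi> \<in> Ginf I" using \<phi> by (simp add: test_on_def)
  then show "gder I \<phi> \<in> Ginf I" by (rule gder_Ginf)
  fix t b assume t: "t \<in> I" "t < c \<or> d < t"
  have ae: "AE s in lebesgue. s \<in> I - {c..d} \<longrightarrow> \<phi> s = 0"
    using \<phi> unfolding test_on_def AE_I by auto
  have 0: "ess_lim b \<phi> t = 0" using \<phi> t unfolding test_on_Icc[OF cd] by blast
  have "eventually (\<lambda>s. \<phi> s = 0) (ess b t)"
    by (rule eventually_ess_open[OF ae]) (use t open_I in auto)
  then have "eventually (\<lambda>s. (\<phi> s - ess_lim b \<phi> t) / of_real (s - t) = 0) (ess b t)"
    by eventually_elim (simp add: 0)
  from tendsto_cong[OF this] have "((\<lambda>_. 0) \<longlongrightarrow> ess_lim b (gder I \<phi>) t) (ess b t)"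
    using has_gder_quot[OF Ginf_gder[OF G] t(1)] by blast
  then show "ess_lim b (gder I \<phi>) t = 0"
    using tendsto_unique[OF ess_neq_bot tendsto_const] by metis
qed

lemma test_common:
  assumes "\<phi> \<in> test I" "\<psi> \<in> test I"
  obtains c d where "c \<le> d" "{c..d} \<subseteq> I" "\<phi> \<in> test_on I {c..d}" "\<psi> \<in> test_on I {c..d}"
proof -
  obtain c d where 1: "c \<le> d" "{c..d} \<subseteq> I" "\<phi> \<in> test_on I {c..d}" using testE[OF assms(1)] .
  obtain c' d' where 2: "c' \<le> d'" "{c'..d'} \<subseteq> I" "\<psi> \<in> test_on I {c'..d'}" using testE[OF assms(2)] .
  have "min c c' \<in> I" "max d d' \<in> I" using 1(1,2) 2(1,2) by (auto simp: min_def max_def)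
  then have "{min c c'..max d d'} \<subseteq> I" by (rule Icc_I)
  moreover have "\<phi> \<in> test_on I {min c c'..max d d'}" using test_on_mono[OF 1(3)] by auto
  moreover have "\<psi> \<in> test_on I {min c c'..max d d'}" using test_on_mono[OF 2(3)] by auto
  moreover have "min c c' \<le> max d d'" using 1(1) by linarith
  ultimately show ?thesis using that by blast
qed

lemma test_lin: "\<phi> \<in> test I \<Longrightarrow> \<psi> \<in> test I \<Longrightarrow> (\<lambda>t. \<alpha> * \<phi> t + \<beta> * \<psi> t) \<in> test I"
  using test_common[of \<phi> \<psi>] test_onI test_on_lin[of \<phi> _ \<psi> \<alpha> \<beta>] by (metis (no_types, lifting))
lemma test_mult: "g \<in> Ginf I \<Longrightarrow> \<phi> \<in> test I \<Longrightarrow> (\<lambda>t. g t * \<phi> t) \<in> test I"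
  using testE test_onI test_on_mult by metis
lemma test_gder: "\<phi> \<in> test I \<Longrightarrow> gder I \<phi> \<in> test I"
  using testE test_onI test_on_gder by metis
lemma test_add: "\<phi> \<in> test I \<Longrightarrow> \<psi> \<in> test I \<Longrightarrow> (\<lambda>t. \<phi> t + \<psi> t) \<in> test I"
  using test_lin[of \<phi> \<psi> 1 1] by simp
lemma test_cmult: "\<phi> \<in> test I \<Longrightarrow> (\<lambda>t. c * \<phi> t) \<in> test I"
  using test_lin[of \<phi> \<phi> c 0] by simp
lemma test_zero: "(\<lambda>_. 0) \<in> test I"
  unfolding test_def by (simp add: Ginf_const supp_iff)
lemma test_sum: "(\<And>i. i \<in> S \<Longrightarrow> f i \<in> test I) \<Longrightarrow> (\<lambda>t. \<Sum>i\<in>S. f i t) \<in> test I"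
  by (induction S rule: infinite_finite_induct) (auto intro: test_zero test_add)
lemma test_ae_eq: "\<phi> \<in> test I \<Longrightarrow> ae_eq I \<phi> \<psi> \<Longrightarrow> \<psi> \<in> test I"
proof -
  assume \<phi>: "\<phi> \<in> test I" and e: "ae_eq I \<phi> \<psi>"
  obtain c d where cd: "{c..d} \<subseteq> I" "\<phi> \<in> test_on I {c..d}" using testE[OF \<phi>] by metis
  have "\<psi> \<in> test_on I {c..d}"
    using cd(2) Ginf_ae_eq[OF _ e] ae_eq_ess_lim[OF e] unfolding test_on_Icc[OF cd(1)] by metis
  then show ?thesis using test_onI cd by blast
qed

text \<open>The usual criterion of finite order on compact sets. Compact intervals suffice because
  every admissible \<open>J\<close> lies in one; any bound M in the sense of \<open>gnorm_le\<close>
  stands in for the norm.\<close>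

definition seminorm_bounded :: "((real \<Rightarrow> complex) \<Rightarrow> complex) \<Rightarrow> bool" where
  "seminorm_bounded f \<longleftrightarrow> (\<forall>c d. c \<le> d \<and> {c..d} \<subseteq> I \<longrightarrow>
     (\<exists>k C. C \<ge> 0 \<and> (\<forall>\<phi>\<in>test_on I {c..d}. \<forall>M. gnorm_le k M \<phi> \<longrightarrow> norm (f \<phi>) \<le> C * M)))"

lemma test_nbhds_test: "test I \<in> test_nbhds I"
  unfolding test_nbhds_def abs_convex_def
proof (safe)
  fix J assume "admissible I J"
  then show "\<exists>k \<epsilon>. 0 < \<epsilon> \<and> {\<phi> \<in> test_on I J. Ginf_norm I k \<phi> < \<epsilon>} \<subseteq> test I"
    using test_on_admissible zero_less_one by blast
qed (rule test_lin)

lemma topspace_test [simp]: "topspace (test_topology I) = test I"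
proof -
  have "openin (test_topology I) (test I)"
    unfolding openin_test_topology using test_nbhds_test test_add by blast
  moreover have "topspace (test_topology I) \<subseteq> test I"
    using openin_topspace openin_test_topology by metis
  ultimately show ?thesis using openin_subset by blast
qed

lemma continuous_imp_bounded:
  assumes lin: "\<And>\<phi> \<psi> \<alpha> \<beta>. \<phi> \<in> test I \<Longrightarrow> \<psi> \<in> test I \<Longrightarrow> f (\<lambda>t. \<alpha> * \<phi> t + \<beta> * \<psi> t) = \<alpha> * f \<phi> + \<beta> * f \<psi>"
    and cont: "continuous_map (test_topology I) euclidean f"
  shows "seminorm_bounded f"
  unfolding seminorm_bounded_def
proof (intro allI impI)
  fix c d :: real assume cd: "c \<le> d \<and> {c..d} \<subseteq> I"
  have f0: "f (\<lambda>_. 0) = 0" using lin[OF test_zero test_zero, of 0 0] by simp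
  have "openin euclidean (ball (0::complex) 1)" by simp
  then have "openin (test_topology I) {\<phi> \<in> topspace (test_topology I). f \<phi> \<in> ball 0 1}"
    using cont unfolding continuous_map_def by blast
  then have "openin (test_topology I) {\<phi> \<in> test I. f \<phi> \<in> ball 0 1}" by simp
  then obtain U where U: "U \<in> test_nbhds I" "\<forall>u\<in>U. norm (f u) < 1"
    using test_zero f0 unfolding openin_test_topology by force
  then obtain k \<epsilon> where k: "\<epsilon> > 0" "{\<phi> \<in> test_on I {c..d}. Ginf_norm I k \<phi> < \<epsilon>} \<subseteq> U"
    using admissible_Icc cd unfolding test_nbhds_def by blast
  have *: "norm (f \<phi>) \<le> 2 / \<epsilon> * M" if \<phi>: "\<phi> \<in> test_on I {c..d}" and M: "gnorm_le k M \<phi>" "M > 0" for \<phi> M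
  proof -
    \<comment> \<open>Scales the bound M of order k down to \<epsilon>/2, strictly inside the ball
      contained in \<open>U\<close>; undoing the scaling yields the constant 2/\<epsilon>.\<close>
    define s where "s = \<epsilon> / (2 * M)"
    have s: "s > 0" using k M by (simp add: s_def)
    let ?u = "\<lambda>t. of_real s * \<phi> t"
    have \<phi>t: "\<phi> \<in> test I" using test_onI \<phi> cd by blast
    have u: "?u \<in> test_on I {c..d}" using test_on_lin[OF \<phi> \<phi>, of "of_real s" 0] by simp
    have "gnorm_le k (norm (of_real s :: complex) * M) ?u" using gnorm_le_cmult[OF M(1)] .
    moreover have "norm (of_real s :: complex) * M = \<epsilon> / 2"
      using s M by (simp only: norm_of_real abs_of_pos) (simp add: s_def)
    ultimately have "gnorm_le k (\<epsilon> / 2) ?u" by (simp only:)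
    then have "Ginf_norm I k ?u \<le> \<epsilon> / 2"
      using Ginf_norm_le[of ?u "\<epsilon>/2" k] u k(1) by (simp add: test_on_def)
    then have "?u \<in> U" using u k by auto
    then have "norm (f ?u) < 1" using U by blast
    moreover have "f ?u = of_real s * f \<phi>" using lin[OF \<phi>t \<phi>t, of "of_real s" 0] by simp
    ultimately have "s * norm (f \<phi>) < 1" using s by (simp add: norm_mult)
    then show ?thesis using s k M by (simp add: s_def field_simps)
  qed
  \<comment> \<open>M may be 0, where no scaling factor exists; a positive excess is added and sent
    to 0.\<close>
  have "norm (f \<phi>) \<le> 2 / \<epsilon> * M" if \<phi>: "\<phi> \<in> test_on I {c..d}" and M: "gnorm_le k M \<phi>" for \<phi> M
  proof (rule field_le_epsilon)
    fix e :: real assume e: "e > 0"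
    have "norm (f \<phi>) \<le> 2 / \<epsilon> * (M + e * \<epsilon> / 2)"
      by (rule *[OF \<phi>]) (use e k gnorm_le_mono[OF M, of "M + e * \<epsilon> / 2"] gnorm_le_nonneg[OF M] in \<open>auto simp: add_nonneg_pos\<close>)
    also have "\<dots> = 2 / \<epsilon> * M + e" using k by (simp add: field_simps)
    finally show "norm (f \<phi>) \<le> 2 / \<epsilon> * M + e" .
  qed
  moreover have "2 / \<epsilon> \<ge> 0" using k by simp
  ultimately show "\<exists>k C. 0 \<le> C \<and> (\<forall>\<phi>\<in>test_on I {c..d}. \<forall>M. gnorm_le k M \<phi> \<longrightarrow> norm (f \<phi>) \<le> C * M)"
    by blast
qed

text \<open>The sets where |f| < e are themselves basic neighbourhoods of 0: absolutely convex by
  linearity, and large enough in each step by the seminorm bound. Other points are reached by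
  translation.\<close>

lemma bounded_imp_continuous:
  assumes lin: "\<And>\<phi> \<psi> \<alpha> \<beta>. \<phi> \<in> test I \<Longrightarrow> \<psi> \<in> test I \<Longrightarrow> f (\<lambda>t. \<alpha> * \<phi> t + \<beta> * \<psi> t) = \<alpha> * f \<phi> + \<beta> * f \<psi>"
    and bnd: "seminorm_bounded f"
  shows "continuous_map (test_topology I) euclidean f"
proof -
  define N where "N e = {\<phi> \<in> test I. norm (f \<phi>) < e}" for e :: real
  have N: "N e \<in> test_nbhds I" if e: "e > 0" for e
    unfolding test_nbhds_def
  proof (intro CollectI conjI allI impI)
    show "N e \<subseteq> test I" by (auto simp: N_def)
    show "abs_convex (N e)" unfolding abs_convex_def
    proof (intro ballI allI impI)
      fix u v and \<alpha> \<beta> :: complex assume u: "u \<in> N e" and v: "v \<in> N e" and ab: "norm \<alpha> + norm \<beta> \<le> 1"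
      define m where "m = max (norm (f u)) (norm (f v))"
      have m: "m < e" "0 \<le> m" using u v by (auto simp: N_def m_def le_max_iff_disj)
      have "norm (\<alpha> * f u + \<beta> * f v) \<le> norm \<alpha> * norm (f u) + norm \<beta> * norm (f v)"
        by (rule norm_triangle_le) (simp add: norm_mult)
      also have "\<dots> \<le> norm \<alpha> * m + norm \<beta> * m"
        by (intro add_mono mult_left_mono) (auto simp: m_def)
      also have "\<dots> = (norm \<alpha> + norm \<beta>) * m" by (simp add: algebra_simps)
      also have "\<dots> \<le> 1 * m" using ab m by (intro mult_right_mono) auto
      finally have "norm (\<alpha> * f u + \<beta> * f v) < e" using m by simp
      then show "(\<lambda>t. \<alpha> * u t + \<beta> * v t) \<in> N e" using u v lin test_lin by (simp add: N_def)
    qed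
    fix J assume J: "admissible I J"
    then obtain c d where cd: "c \<le> d" "{c..d} \<subseteq> I" "J \<subseteq> {c..d}" using admissible_in_Icc by blast
    then obtain k C where C: "C \<ge> 0" "\<forall>\<phi>\<in>test_on I {c..d}. \<forall>M. gnorm_le k M \<phi> \<longrightarrow> norm (f \<phi>) \<le> C * M"
      using bnd unfolding seminorm_bounded_def by blast
    \<comment> \<open>The added 1 covers C = 0 and makes the final inequality strict.\<close>
    define \<epsilon> where "\<epsilon> = e / (C + 1)"
    have eps: "\<epsilon> > 0" using e C by (simp add: \<epsilon>_def)
    have "\<phi> \<in> N e" if \<phi>: "\<phi> \<in> test_on I J" "Ginf_norm I k \<phi> < \<epsilon>" for \<phi>
    proof -
      have p: "\<phi> \<in> test_on I {c..d}" using test_on_mono \<phi> cd by blast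
      then have "gnorm_le k \<epsilon> \<phi>" using Ginf_norm_le[of \<phi> \<epsilon> k] \<phi>(2) eps by (simp add: test_on_def)
      then have "norm (f \<phi>) \<le> C * \<epsilon>" using C p by blast
      also have "\<dots> < (C + 1) * \<epsilon>" using eps by simp
      also have "\<dots> = e" using C by (simp add: \<epsilon>_def)
      finally show ?thesis using test_onI p cd by (simp add: N_def)
    qed
    then show "\<exists>k \<epsilon>. 0 < \<epsilon> \<and> {\<phi> \<in> test_on I J. Ginf_norm I k \<phi> < \<epsilon>} \<subseteq> N e" using eps by blast
  qed
  show ?thesis unfolding continuous_map_def
  proof (intro conjI allI impI)
    fix V :: "complex set" assume "openin euclidean V"
    then have V: "open V" by simp
    show "openin (test_topology I) {x \<in> topspace (test_topology I). f x \<in> V}"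
      unfolding openin_test_topology topspace_test
    proof (intro conjI ballI)
      fix \<phi> assume \<phi>: "\<phi> \<in> {x \<in> test I. f x \<in> V}"
      then obtain e where e: "e > 0" "ball (f \<phi>) e \<subseteq> V" using V open_contains_ball by blast
      have "(\<lambda>t. \<phi> t + u t) \<in> {x \<in> test I. f x \<in> V}" if u: "u \<in> N e" for u
      proof -
        have "f (\<lambda>t. \<phi> t + u t) = f \<phi> + f u" using lin[of \<phi> u 1 1] \<phi> u by (simp add: N_def)
        then have "f (\<lambda>t. \<phi> t + u t) \<in> ball (f \<phi>) e" using u by (simp add: N_def dist_norm)
        then show ?thesis using e \<phi> u test_add by (auto simp: N_def)
      qed
      then show "\<exists>U\<in>test_nbhds I. \<forall>u\<in>U. (\<lambda>t. \<phi> t + u t) \<in> {x \<in> test I. f x \<in> V}" using N[OF e(1)] by blast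
    qed auto
  qed auto
qed

text \<open>Replaces topology by seminorm estimates; apart from the weak* statement at the end,
  continuity is handled in this form from here on.\<close>

lemma dist_iff: "f \<in> dist_space I \<longleftrightarrow> f \<in> extensional (test I) \<and>
     (\<forall>\<phi>\<in>test I. \<forall>\<psi>\<in>test I. ae_eq I \<phi> \<psi> \<longrightarrow> f \<phi> = f \<psi>) \<and>
     (\<forall>\<phi>\<in>test I. \<forall>\<psi>\<in>test I. \<forall>\<alpha> \<beta>. f (\<lambda>t. \<alpha> * \<phi> t + \<beta> * \<psi> t) = \<alpha> * f \<phi> + \<beta> * f \<psi>) \<and>
     seminorm_bounded f"
  unfolding dist_space_def using continuous_imp_bounded[of f] bounded_imp_continuous[of f] by blast

lemma dist_ext: "f \<in> dist_space I \<Longrightarrow> f \<in> extensional (test I)" by (simp add: dist_iff)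
lemma dist_ae: "f \<in> dist_space I \<Longrightarrow> \<phi> \<in> test I \<Longrightarrow> ae_eq I \<phi> \<psi> \<Longrightarrow> f \<phi> = f \<psi>"
  using test_ae_eq[of \<phi> \<psi>] unfolding dist_iff by blast
lemma dist_lin: "f \<in> dist_space I \<Longrightarrow> \<phi> \<in> test I \<Longrightarrow> \<psi> \<in> test I \<Longrightarrow>
   f (\<lambda>t. \<alpha> * \<phi> t + \<beta> * \<psi> t) = \<alpha> * f \<phi> + \<beta> * f \<psi>" unfolding dist_iff by blast
lemma dist_add: "f \<in> dist_space I \<Longrightarrow> \<phi> \<in> test I \<Longrightarrow> \<psi> \<in> test I \<Longrightarrow> f (\<lambda>t. \<phi> t + \<psi> t) = f \<phi> + f \<psi>"
  using dist_lin[of f \<phi> \<psi> 1 1] by simp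
lemma dist_diff: "f \<in> dist_space I \<Longrightarrow> \<phi> \<in> test I \<Longrightarrow> \<psi> \<in> test I \<Longrightarrow> f (\<lambda>t. \<phi> t - \<psi> t) = f \<phi> - f \<psi>"
  using dist_lin[of f \<phi> \<psi> 1 "-1"] by simp
lemma dist_cmult: "f \<in> dist_space I \<Longrightarrow> \<phi> \<in> test I \<Longrightarrow> f (\<lambda>t. c * \<phi> t) = c * f \<phi>"
  using dist_lin[of f \<phi> \<phi> c 0] by simp
lemma dist_zero: "f \<in> dist_space I \<Longrightarrow> f (\<lambda>_. 0) = 0"
  using dist_cmult[OF _ test_zero, of f 0] by simp
lemma dist_sum: "f \<in> dist_space I \<Longrightarrow> (\<And>i. i \<in> S \<Longrightarrow> g i \<in> test I) \<Longrightarrow> f (\<lambda>t. \<Sum>i\<in>S. g i t) = (\<Sum>i\<in>S. f (g i))"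
proof (induction S rule: infinite_finite_induct)
  case (insert x F)
  then have "f (\<lambda>t. g x t + (\<Sum>i\<in>F. g i t)) = f (g x) + f (\<lambda>t. \<Sum>i\<in>F. g i t)"
    by (intro dist_add test_sum) auto
  with insert show ?case by simp
qed (auto simp: dist_zero)
lemma dist_bound: "f \<in> dist_space I \<Longrightarrow> c \<le> d \<Longrightarrow> {c..d} \<subseteq> I \<Longrightarrow>
   \<exists>k C. C \<ge> 0 \<and> (\<forall>\<phi>\<in>test_on I {c..d}. \<forall>M. gnorm_le k M \<phi> \<longrightarrow> norm (f \<phi>) \<le> C * M)"
  unfolding dist_iff seminorm_bounded_def by blast

end

subsection \<open>Integrals of regulated functions\<close>

context ival begin

lemma rep_integrable: "g \<in> GG I \<Longrightarrow> rep g integrable_on {x..y}"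
proof -
  assume g: "g \<in> GG I"
  obtain C where C: "C \<ge> 0" "AE t in lebesgue_on I. norm (g t) \<le> C" using GG_bound[OF g] by blast
  have b: "norm (rep g t) \<le> C" for t by (rule rep_norm_le[OF g C(2,1)])
  have m: "rep g \<in> borel_measurable (lebesgue_on {x..y})"
    by (rule measurable_restrict_space1) (rule rep_measurable[OF g])
  show "rep g integrable_on {x..y}"
    by (rule measurable_bounded_by_integrable_imp_integrable[OF m, of "\<lambda>_. C"]) (auto simp: b)
qed

text \<open>The estimate is assumed on the open interval only, since it comes from one-sided limits;
  two endpoints do not affect the integral.\<close>

lemma integral_minus_const_bound:
  fixes f :: "real \<Rightarrow> complex"
  assumes "x \<le> y" "f integrable_on {x..y}" "\<And>s. x < s \<Longrightarrow> s < y \<Longrightarrow> norm (f s - D) \<le> e" "0 \<le> e"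
  shows "norm (integral {x..y} f - of_real (y - x) * D) \<le> e * (y - x)"
proof -
  have "((\<lambda>s. f s - D) has_integral (integral {x..y} f - measure lborel {x..y} *\<^sub>R D)) {x..y}"
    by (intro has_integral_diff integrable_integral assms has_integral_const_real)
  then have "((\<lambda>s. f s - D) has_integral (integral {x..y} f - of_real (y - x) * D)) (cbox x y)"
    using assms(1) by (simp add: scaleR_conv_of_real)
  then have "norm (integral {x..y} f - of_real (y - x) * D) \<le> e * measure lborel (cbox x y)"
    by (rule has_integral_bound_spike_finite[where S="{x,y}", rotated 2]) (use assms in auto)
  then show ?thesis using assms(1) by simp
qed

lemma gder_one_sided_bound:
  assumes g: "g \<in> GG I" and gh: "has_gder I g h" and j: "ess_lim b g t = rep g t" and t: "t \<in> I" and e: "e > 0"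
  shows "\<exists>d>0. \<forall>s\<in>side_nbh b t d. norm (rep g s - rep g t - of_real (s - t) * ess_lim b h t) \<le> e * \<bar>s - t\<bar> \<and>
           norm (rep h s - ess_lim b h t) \<le> e"
proof -
  obtain d1 where d1: "d1 > 0" "\<forall>s\<in>side_nbh b t d1. dist ((rep g s - ess_lim b g t) / of_real (s - t)) (ess_lim b h t) < e"
    using tendstoD[OF has_gder_ordinary[OF g gh t] e] unfolding eventually_side_at by blast
  obtain d2 where d2: "d2 > 0" "\<forall>s\<in>side_nbh b t d2. dist (rep h s) (ess_lim b h t) < e"
    using tendstoD[OF rep_lim[OF has_gder_GG[OF gh] t] e] unfolding eventually_side_at by blast
  have "norm (rep g s - rep g t - of_real (s - t) * ess_lim b h t) \<le> e * \<bar>s - t\<bar> \<and>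
           norm (rep h s - ess_lim b h t) \<le> e" if s: "s \<in> side_nbh b t (min d1 d2)" for s
  proof -
    have s1: "s \<in> side_nbh b t d1" and s2: "s \<in> side_nbh b t d2"
      using s side_nbh_mono[of "min d1 d2" d1 b t] side_nbh_mono[of "min d1 d2" d2 b t] by auto
    have st: "s - t \<noteq> 0" using side_nbh_not_self[OF s] by simp
    have "rep g s - rep g t - of_real (s - t) * ess_lim b h t =
        of_real (s - t) * ((rep g s - ess_lim b g t) / of_real (s - t) - ess_lim b h t)"
    proof -
      have "of_real (s - t) \<noteq> (0::complex)" using st by (simp del: of_real_diff)
      then show ?thesis unfolding j right_diff_distrib by (simp del: of_real_diff)
    qed
    then have "norm (rep g s - rep g t - of_real (s - t) * ess_lim b h t) =
        \<bar>s - t\<bar> * norm ((rep g s - ess_lim b g t) / of_real (s - t) - ess_lim b h t)"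
      by (simp only: norm_mult norm_of_real)
    also have "\<dots> \<le> \<bar>s - t\<bar> * e"
      using d1(2) s1 by (intro mult_left_mono) (auto simp: dist_norm less_imp_le)
    finally show ?thesis using d2(2) s2 by (auto simp: dist_norm mult.commute less_imp_le)
  qed
  then show ?thesis using d1 d2 by (intro exI[of _ "min d1 d2"]) auto
qed

text \<open>\<open>h\<close> may jump, so \<open>rep g\<close> need not have two-sided derivatives.
  The defect, increment of \<open>g\<close> minus integral of \<open>h\<close>, is additive over
  adjacent intervals. On either side of t both parts equal the one-sided limit of \<open>h\<close>
  times the length, up to a small multiple of the length, so bisection (\<open>Bolzano\<close>)
  bounds the defect by e times the length. Absence of jumps of \<open>g\<close> lets the two sides
  be joined at t.\<close>

lemma gder_FTC:
  assumes g: "g \<in> GG I" and gh: "has_gder I g h" and cont: "\<And>t. t \<in> I \<Longrightarrow> ess_lim True g t = ess_lim False g t"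
    and xy: "x \<le> y" "{x..y} \<subseteq> I"
  shows "integral {x..y} (rep h) = rep g y - rep g x"
proof -
  let ?P = "\<lambda>e u v. u \<ge> x \<and> v \<le> y \<longrightarrow> norm (rep g v - rep g u - integral {u..v} (rep h)) \<le> e * (v - u)"
  have int: "rep h integrable_on {u..v}" for u v by (rule rep_integrable[OF has_gder_GG[OF gh]])
  have *: "?P e x y" if e: "e > 0" for e
  proof (rule Bolzano[where P="?P e", OF xy(1)])
    fix u v w assume 1: "?P e u v" "?P e v w" "u \<le> v" "v \<le> w"
    show "?P e u w"
    proof
      assume c: "u \<ge> x \<and> w \<le> y"
      have "integral {u..v} (rep h) + integral {v..w} (rep h) = integral {u..w} (rep h)"
        by (rule Henstock_Kurzweil_Integration.integral_combine[OF 1(3,4) int])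
      then have "rep g w - rep g u - integral {u..w} (rep h) =
          (rep g v - rep g u - integral {u..v} (rep h)) + (rep g w - rep g v - integral {v..w} (rep h))"
        by (simp add: algebra_simps)
      also have "norm \<dots> \<le> e * (v - u) + e * (w - v)"
        by (rule norm_triangle_mono) (use 1 c in auto)
      finally show "norm (rep g w - rep g u - integral {u..w} (rep h)) \<le> e * (w - u)"
        by (simp add: algebra_simps)
    qed
  next
    fix t assume t: "x \<le> t" "t \<le> y"
    then have tI: "t \<in> I" using xy by auto
    have j: "ess_lim b g t = rep g t" for b using cont[OF tI] rep_in[OF tI] by (cases b) auto
    obtain d1 where d1: "d1 > 0" "\<And>s. s \<in> side_nbh True t d1 \<Longrightarrow> norm (rep g s - rep g t - of_real (s - t) * ess_lim True h t) \<le> e/2 * \<bar>s - t\<bar>"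
        "\<And>s. s \<in> side_nbh True t d1 \<Longrightarrow> norm (rep h s - ess_lim True h t) \<le> e/2"
      using gder_one_sided_bound[OF g gh j tI, of "e/2"] e by (metis half_gt_zero)
    obtain d2 where d2: "d2 > 0" "\<And>s. s \<in> side_nbh False t d2 \<Longrightarrow> norm (rep g s - rep g t - of_real (s - t) * ess_lim False h t) \<le> e/2 * \<bar>s - t\<bar>"
        "\<And>s. s \<in> side_nbh False t d2 \<Longrightarrow> norm (rep h s - ess_lim False h t) \<le> e/2"
      using gder_one_sided_bound[OF g gh j tI, of "e/2"] e by (metis half_gt_zero)
    have R: "norm (rep g v - rep g t - integral {t..v} (rep h)) \<le> e * (v - t)" if v: "t \<le> v" "v < t + d1" for v
    proof (cases "v = t")
      case False
      then have vn: "v \<in> side_nbh True t d1" using v by (auto simp: side_nbh_def)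
      have "norm (integral {t..v} (rep h) - of_real (v - t) * ess_lim True h t) \<le> e/2 * (v - t)"
        by (rule integral_minus_const_bound[OF v(1) int]) (use v d1 e in \<open>auto simp: side_nbh_def\<close>)
      moreover have "norm (rep g v - rep g t - of_real (v - t) * ess_lim True h t) \<le> e/2 * (v - t)"
        using d1(2)[OF vn] v by simp
      ultimately have "norm ((rep g v - rep g t - of_real (v - t) * ess_lim True h t) -
          (integral {t..v} (rep h) - of_real (v - t) * ess_lim True h t)) \<le> e/2 * (v - t) + e/2 * (v - t)"
        by (meson add_mono norm_triangle_ineq4 order_trans)
      then show ?thesis by (simp add: algebra_simps)
    qed auto
    have L: "norm (rep g t - rep g u - integral {u..t} (rep h)) \<le> e * (t - u)" if u: "u \<le> t" "t - d2 < u" for u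
    proof (cases "u = t")
      case False
      then have un: "u \<in> side_nbh False t d2" using u by (auto simp: side_nbh_def)
      have 1: "norm (integral {u..t} (rep h) - of_real (t - u) * ess_lim False h t) \<le> e/2 * (t - u)"
        by (rule integral_minus_const_bound[OF u(1) int]) (use u d2 e in \<open>auto simp: side_nbh_def\<close>)
      have "norm (rep g u - rep g t - of_real (u - t) * ess_lim False h t) \<le> e/2 * (t - u)"
        using d2(2)[OF un] u by simp
      from norm_triangle_mono[OF this 1] have "norm ((rep g u - rep g t - of_real (u - t) * ess_lim False h t) +
          (integral {u..t} (rep h) - of_real (t - u) * ess_lim False h t)) \<le> e/2 * (t - u) + e/2 * (t - u)" .
      moreover have "(rep g u - rep g t - of_real (u - t) * ess_lim False h t) +
          (integral {u..t} (rep h) - of_real (t - u) * ess_lim False h t) = - (rep g t - rep g u - integral {u..t} (rep h))"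
        by (simp add: algebra_simps)
      ultimately have "norm (rep g t - rep g u - integral {u..t} (rep h)) \<le> e/2 * (t - u) + e/2 * (t - u)"
        by (simp only: norm_minus_cancel)
      then show ?thesis by (simp add: algebra_simps)
    qed auto
    show "\<exists>d>0. \<forall>u v. u \<le> t \<and> t \<le> v \<and> v - u < d \<longrightarrow> ?P e u v"
    proof (intro exI[of _ "min d1 d2"] conjI allI impI)
      fix u v assume uv: "u \<le> t \<and> t \<le> v \<and> v - u < min d1 d2" "x \<le> u \<and> v \<le> y"
      have "integral {u..t} (rep h) + integral {t..v} (rep h) = integral {u..v} (rep h)"
        by (rule Henstock_Kurzweil_Integration.integral_combine[OF _ _ int]) (use uv in auto)
      then have "rep g v - rep g u - integral {u..v} (rep h) =
          (rep g t - rep g u - integral {u..t} (rep h)) + (rep g v - rep g t - integral {t..v} (rep h))"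
        by (simp add: algebra_simps)
      also have "norm \<dots> \<le> e * (t - u) + e * (v - t)"
        by (rule norm_triangle_mono) (rule L R; use uv in simp)+
      finally show "norm (rep g v - rep g u - integral {u..v} (rep h)) \<le> e * (v - u)"
        by (simp add: algebra_simps)
    qed (use d1 d2 in auto)
  qed
  have "norm (rep g y - rep g x - integral {x..y} (rep h)) \<le> 0"
  proof (rule field_le_epsilon)
    fix e :: real assume e: "e > 0"
    define e' where "e' = e / (y - x + 1)"
    have e': "e' > 0" using e xy by (simp add: e'_def)
    have "norm (rep g y - rep g x - integral {x..y} (rep h)) \<le> e' * (y - x)" using *[OF e'] by simp
    also have "\<dots> \<le> e' * (y - x + 1)" using e' by simp
    also have "\<dots> = e" using xy by (simp add: e'_def)
    finally show "norm (rep g y - rep g x - integral {x..y} (rep h)) \<le> 0 + e" by simp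
  qed
  then show ?thesis by simp
qed

end

subsection \<open>Linear integral equations\<close>

lemma norm_vec_le_sum: "norm (v :: complex^'n) \<le> (\<Sum>i\<in>UNIV. norm (v $ i))"
  unfolding norm_vec_def by (rule L2_set_le_sum) simp

text \<open>The coefficients are merely bounded and measurable on the whole line, which is what
  \<open>rep\<close> of a regulated function provides; d is the point where the terminal value 0 is
  prescribed.\<close>

locale linsys =
  fixes c :: "'n::finite \<Rightarrow> 'n \<Rightarrow> real \<Rightarrow> complex" and M d :: real
  assumes c_meas: "\<And>i j. c i j \<in> borel_measurable lebesgue"
    and c_bound: "\<And>i j t. norm (c i j t) \<le> M"
begin

lemma M0: "0 \<le> M" using c_bound norm_ge_zero order_trans by blast

text \<open>In the supremum norm weighted by \<open>1 / wt\<close> the integral operator is a contraction.\<close>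

definition "lam = 2 * real CARD('n) * real CARD('n) * M + 1"

definition "wt s = exp (lam * (d - s))"

lemma lam_pos: "lam > 0" using M0 by (simp add: lam_def add_nonneg_pos)
lemma wt_pos [simp]: "wt s > 0" by (simp add: wt_def)
lemma wt_ge1: "s \<le> d \<Longrightarrow> 1 \<le> wt s" using lam_pos by (simp add: wt_def)
lemma wt_anti: "s \<le> t \<Longrightarrow> wt t \<le> wt s" using lam_pos by (simp add: wt_def)
lemma wt_cont [continuous_intros]: "continuous_on S wt" unfolding wt_def by (intro continuous_intros)

lemma wt_integral:
  assumes "t \<le> d"
  shows "((\<lambda>s. Q * wt s) has_integral (Q * (wt t - 1) / lam)) {t..d}"
proof -
  have "((\<lambda>s. Q * wt s) has_integral ((- Q * wt d / lam) - (- Q * wt t / lam))) {t..d}"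
  proof (rule fundamental_theorem_of_calculus[OF assms])
    fix s assume "s \<in> {t..d}"
    have "((\<lambda>s. - Q * wt s / lam) has_real_derivative Q * wt s) (at s within {t..d})"
      unfolding wt_def using lam_pos by (auto intro!: derivative_eq_intros simp: field_simps)
    then show "((\<lambda>s. - Q * wt s / lam) has_vector_derivative Q * wt s) (at s within {t..d})"
      by (simp add: has_real_derivative_iff_has_vector_derivative)
  qed
  moreover have "wt d = 1" by (simp add: wt_def)
  moreover have "(- Q * wt d / lam) - (- Q * wt t / lam) = Q * (wt t - 1) / lam"
    using calculation(2) by (simp add: field_simps diff_divide_distrib)
  ultimately show ?thesis by (simp only:)
qed

text \<open>Integration against the weight gains the factor 1/\<open>lam\<close>; the exponential
  weight exists for this gain, both in the contraction and in the a priori bound.\<close>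

lemma weighted_integral_bound:
  fixes g :: "real \<Rightarrow> complex"
  assumes g: "g integrable_on {t..d}" and b: "\<And>s. t \<le> s \<Longrightarrow> s \<le> d \<Longrightarrow> norm (g s) \<le> Q * wt s" and Q: "0 \<le> Q"
  shows "norm (integral {t..d} g) \<le> Q / lam * wt t"
proof (cases "t \<le> d")
  case True
  have "norm (integral {t..d} g) \<le> integral {t..d} (\<lambda>s. Q * wt s)"
    by (rule integral_norm_bound_integral[OF g]) (use wt_integral[OF True] b in \<open>auto simp: integrable_on_def\<close>)
  also have "\<dots> = Q * (wt t - 1) / lam" using wt_integral[OF True] by (rule integral_unique)
  also have "\<dots> \<le> Q / lam * wt t" using Q lam_pos by (simp add: field_simps)
  finally show ?thesis .
next
  case False then show ?thesis using Q lam_pos by (simp add: less_imp_le)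
qed

lemma rhs_integrable:
  assumes \<psi>m: "\<And>i. \<psi> i \<in> borel_measurable lebesgue" and \<psi>b: "\<And>i t. norm (\<psi> i t) \<le> N"
    and \<phi>: "\<And>j. continuous_on {t..d} (\<phi> j)"
  shows "(\<lambda>s. (\<Sum>j\<in>UNIV. c i j s * \<phi> j s) + \<psi> i s) integrable_on {t..d}"
proof -
  have "\<exists>B. \<forall>s\<in>{t..d}. norm (\<phi> j s) \<le> B" for j
    using compact_imp_bounded[OF compact_continuous_image[OF \<phi> compact_Icc]] unfolding bounded_iff by blast
  then obtain B where B: "\<And>j s. s \<in> {t..d} \<Longrightarrow> norm (\<phi> j s) \<le> B j" by metis
  have m\<phi>: "\<phi> j \<in> borel_measurable (lebesgue_on {t..d})" for j
    by (rule continuous_imp_measurable_on_sets_lebesgue[OF \<phi>]) simp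
  have mc: "c i j \<in> borel_measurable (lebesgue_on {t..d})" "\<psi> i \<in> borel_measurable (lebesgue_on {t..d})" for i j
    using c_meas \<psi>m by (auto intro: measurable_restrict_space1)
  have "(\<lambda>s. (\<Sum>j\<in>UNIV. c i j s * \<phi> j s) + \<psi> i s) \<in> borel_measurable (lebesgue_on {t..d})"
    using m\<phi> mc by measurable
  then show ?thesis
  proof (rule measurable_bounded_by_integrable_imp_integrable[where g="\<lambda>_. (\<Sum>j\<in>UNIV. M * B j) + N"])
    fix s assume s: "s \<in> {t..d}"
    show "norm ((\<Sum>j\<in>UNIV. c i j s * \<phi> j s) + \<psi> i s) \<le> (\<Sum>j\<in>UNIV. M * B j) + N"
      by (intro norm_triangle_mono \<psi>b sum_norm_le) (use c_bound B s M0 in \<open>auto simp: norm_mult intro!: mult_mono\<close>)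
  qed auto
qed

lemma rhs_bound:
  assumes \<psi>b: "\<And>i t. norm (\<psi> i t) \<le> N" and N: "0 \<le> N"
    and \<phi>: "\<And>j. norm (\<phi> j s) \<le> B * wt s" and s: "s \<le> d"
  shows "norm ((\<Sum>j\<in>UNIV. c i j s * \<phi> j s) + \<psi> i s) \<le> (real CARD('n) * M * B + N) * wt s"
proof -
  have "norm ((\<Sum>j\<in>UNIV. c i j s * \<phi> j s) + \<psi> i s) \<le> (\<Sum>j\<in>(UNIV::'n set). M * (B * wt s)) + N"
    by (intro norm_triangle_mono \<psi>b sum_norm_le) (use c_bound \<phi> M0 in \<open>auto simp: norm_mult intro!: mult_mono\<close>)
  also have "\<dots> \<le> (\<Sum>j\<in>(UNIV::'n set). M * (B * wt s)) + N * wt s"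
    using wt_ge1[OF s] N by (intro add_left_mono) (simp add: mult_le_cancel_left1)
  finally show ?thesis by (simp add: algebra_simps)
qed

text \<open>Integral form of - \<phi>' = c \<phi> + \<psi> with \<phi>(d) = 0; with discontinuous
  coefficients \<phi> need not be differentiable at every point.\<close>

definition solves :: "('n \<Rightarrow> real \<Rightarrow> complex) \<Rightarrow> real \<Rightarrow> ('n \<Rightarrow> real \<Rightarrow> complex) \<Rightarrow> bool" where
  "solves \<psi> t1 \<phi> \<longleftrightarrow> (\<forall>i. continuous_on {t1..d} (\<phi> i)) \<and>
     (\<forall>i. \<forall>t\<in>{t1..d}. \<phi> i t = integral {t..d} (\<lambda>s. (\<Sum>j\<in>UNIV. c i j s * \<phi> j s) + \<psi> i s))"

text \<open>With W the weighted supremum of \<phi>, one application of the equation gives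
  \<open>lam\<close> W \<le> n M W + N, and \<open>lam\<close> \<ge> 2 n M absorbs the first term. W
  is finite by continuity on a compact interval. Linearity in N later yields continuity in \<psi>,
  and N = 0 yields uniqueness.\<close>

lemma solves_bound:
  assumes \<psi>m: "\<And>i. \<psi> i \<in> borel_measurable lebesgue" and \<psi>b: "\<And>i t. norm (\<psi> i t) \<le> N"
    and \<phi>: "solves \<psi> t1 \<phi>" and t: "t \<in> {t1..d}"
  shows "norm (\<phi> i t) \<le> 2 / lam * wt t1 * N"
proof -
  have N: "0 \<le> N" using \<psi>b norm_ge_zero order_trans by blast
  have cont: "continuous_on {t1..d} (\<phi> i)" for i using \<phi> by (simp add: solves_def)
  have "\<exists>B. \<forall>t\<in>{t1..d}. norm (\<phi> i t) / wt t \<le> B" for i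
  proof -
    have "continuous_on {t1..d} (\<lambda>t. norm (\<phi> i t) / wt t)"
      by (intro continuous_intros cont) (simp add: less_imp_neq[symmetric])
    then have "compact ((\<lambda>t. norm (\<phi> i t) / wt t) ` {t1..d})" by (rule compact_continuous_image) simp
    from bounded_imp_bdd_above[OF compact_imp_bounded[OF this]] show ?thesis
      unfolding bdd_above_def by blast
  qed
  then obtain B where B: "\<And>i t. t \<in> {t1..d} \<Longrightarrow> norm (\<phi> i t) / wt t \<le> B i" by metis
  define S where "S = {norm (\<phi> i t) / wt t | i t. t \<in> {t1..d}}"
  have Sne: "S \<noteq> {}" using t by (auto simp: S_def)
  have bdd: "bdd_above S"
  proof (rule bdd_aboveI[of _ "Max (range B)"])
    fix x assume "x \<in> S"
    then obtain i t where x: "x = norm (\<phi> i t) / wt t" "t \<in> {t1..d}" by (auto simp: S_def)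
    have "B i \<le> Max (range B)" by (rule Max_ge) auto
    with B[OF x(2), of i] x(1) show "x \<le> Max (range B)" by linarith
  qed
  define W where "W = Sup S"
  have W: "norm (\<phi> i t) \<le> W * wt t" if "t \<in> {t1..d}" for i t
  proof -
    have "norm (\<phi> i t) / wt t \<le> W" unfolding W_def by (rule cSup_upper[OF _ bdd]) (use that in \<open>auto simp: S_def\<close>)
    then show ?thesis by (simp add: pos_divide_le_eq)
  qed
  have W0: "0 \<le> W" using order_trans[OF norm_ge_zero W[OF t, of i]] wt_pos[of t] zero_le_mult_iff[of W "wt t"] by auto
  have step: "norm (\<phi> i t) \<le> (real CARD('n) * M * W + N) / lam * wt t" if t: "t \<in> {t1..d}" for i t
  proof -
    have "\<phi> i t = integral {t..d} (\<lambda>s. (\<Sum>j\<in>UNIV. c i j s * \<phi> j s) + \<psi> i s)"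
      using \<phi> t by (simp add: solves_def)
    moreover have "norm (integral {t..d} (\<lambda>s. (\<Sum>j\<in>UNIV. c i j s * \<phi> j s) + \<psi> i s)) \<le> (real CARD('n) * M * W + N) / lam * wt t"
    proof (rule weighted_integral_bound)
      show "(\<lambda>s. (\<Sum>j\<in>UNIV. c i j s * \<phi> j s) + \<psi> i s) integrable_on {t..d}"
        by (rule rhs_integrable[OF \<psi>m \<psi>b]) (rule continuous_on_subset[OF cont], use t in auto)
      fix s assume s: "t \<le> s" "s \<le> d"
      show "norm ((\<Sum>j\<in>UNIV. c i j s * \<phi> j s) + \<psi> i s) \<le> (real CARD('n) * M * W + N) * wt s"
      proof (rule rhs_bound[OF \<psi>b N _ s(2)])
        show "norm (\<phi> j s) \<le> W * wt s" for j by (rule W) (use s t in auto)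
      qed
    qed (use M0 W0 N in simp)
    ultimately show ?thesis by simp
  qed
  have "W \<le> (real CARD('n) * M * W + N) / lam"
    unfolding W_def
  proof (rule cSup_least[OF Sne])
    fix x assume "x \<in> S"
    then obtain i t where x: "x = norm (\<phi> i t) / wt t" "t \<in> {t1..d}" by (auto simp: S_def)
    show "x \<le> (real CARD('n) * M * Sup S + N) / lam"
      using step[OF x(2), of i] unfolding x(1) W_def by (subst pos_divide_le_eq) auto
  qed
  then have "lam * W \<le> real CARD('n) * M * W + N" using lam_pos by (simp add: field_simps)
  \<comment> \<open>\<open>lam\<close> contains the square of the dimension; n \<ge> 1 compares n
    with that square.\<close>
  moreover have "2 * (real CARD('n) * M * W) \<le> lam * W"
  proof -
    have "1 * (real CARD('n) * M * W) \<le> real CARD('n) * (real CARD('n) * M * W)"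
      by (rule mult_right_mono) (use M0 W0 in \<open>auto simp: Suc_leI\<close>)
    then have "2 * (real CARD('n) * M * W) \<le> (2 * real CARD('n) * real CARD('n) * M) * W" by (simp add: algebra_simps)
    also have "\<dots> \<le> lam * W" using W0 by (intro mult_right_mono) (simp_all add: lam_def)
    finally show ?thesis .
  qed
  ultimately have "lam * W \<le> 2 * N" by linarith
  then have "W \<le> 2 / lam * N" using lam_pos by (simp add: field_simps)
  then have "W * wt t \<le> (2 / lam * N) * wt t1"
    using t W0 wt_anti[of t1 t] N lam_pos by (intro mult_mono) (auto simp: less_imp_le)
  with W[OF t, of i] show ?thesis by (simp add: algebra_simps)
qed

lemma tail_integral_continuous:
  fixes g :: "real \<Rightarrow> complex"
  assumes g: "\<And>x. g integrable_on {x..d}"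
  shows "continuous_on UNIV (\<lambda>t. integral {t..d} g)"
proof (rule continuous_at_imp_continuous_on, rule ballI)
  fix t :: real
  define x where "x = min t d - 1"
  have 1: "continuous_on {x..d} (\<lambda>t. integral {t..d} g)" by (rule indefinite_integral_continuous_1'[OF g])
  \<comment> \<open>Beyond d the interval \<open>{t..d}\<close> is empty, so the integral is 0 by
    convention and the two pieces meet at d.\<close>
  have 2: "continuous_on {d..} (\<lambda>t. integral {t..d} g)"
  proof (rule continuous_on_eq[OF continuous_on_const[of _ 0]])
    fix s assume "s \<in> {d..}"
    then show "0 = integral {s..d} g" by (cases "s = d") auto
  qed
  have "continuous_on ({x..d} \<union> {d..}) (\<lambda>t. integral {t..d} g)"
    by (rule continuous_on_closed_Un[OF _ _ 1 2]) auto
  moreover have "{x..d} \<union> {d..} = {x..}" by (auto simp: x_def)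
  ultimately have "continuous_on {x<..} (\<lambda>t. integral {t..d} g)" by (auto elim: continuous_on_subset)
  then show "isCont (\<lambda>t. integral {t..d} g) t"
    by (rule continuous_on_interior) (simp add: x_def interior_open)
qed

text \<open>Dividing the unknown by \<open>wt\<close> turns the weighted norm into the plain
  supremum norm, so that Banach's theorem applies to bounded continuous functions on the whole line.
  \<phi> itself may grow like \<open>wt\<close> towards the left.\<close>

lemma solves_exists:
  assumes \<psi>m: "\<And>i. \<psi> i \<in> borel_measurable lebesgue" and \<psi>b: "\<And>i t. norm (\<psi> i t) \<le> N"
  obtains \<phi> where "\<And>i. continuous_on UNIV (\<phi> i)" "\<And>i t. d \<le> t \<Longrightarrow> \<phi> i t = 0" "\<And>t1. solves \<psi> t1 \<phi>"
proof -
  have N: "0 \<le> N" using \<psi>b norm_ge_zero order_trans by blast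
  define rhs where "rhs u i s = (\<Sum>j\<in>UNIV. c i j s * (of_real (wt s) * u s $ j)) + \<psi> i s"
    for u :: "real \<Rightarrow> complex^'n" and i s
  define T where "T u = (\<lambda>t. \<chi> i. integral {t..d} (rhs u i) / of_real (wt t))" for u
  have int: "rhs u i integrable_on {t..d}" if "continuous_on UNIV u" for u i t
    unfolding rhs_def
    by (rule rhs_integrable[OF \<psi>m \<psi>b]) (intro continuous_intros continuous_on_subset[OF that]; simp)
  have Tn: "norm (T u t $ i - T v t $ i) \<le> real CARD('n) * M * B / lam"
    if u: "continuous_on UNIV u" and v: "continuous_on UNIV v" and B: "\<And>s. norm (u s - v s) \<le> B" for u v B t i
  proof -
    have B0: "0 \<le> B" using B norm_ge_zero order_trans by blast
    have "norm (integral {t..d} (\<lambda>s. rhs u i s - rhs v i s)) \<le> (real CARD('n) * M * B) / lam * wt t"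
    proof (rule weighted_integral_bound)
      show "(\<lambda>s. rhs u i s - rhs v i s) integrable_on {t..d}"
        by (rule Henstock_Kurzweil_Integration.integrable_diff[OF int[OF u] int[OF v]])
      fix s assume s: "t \<le> s" "s \<le> d"
      have "rhs u i s - rhs v i s = (\<Sum>j\<in>UNIV. c i j s * (of_real (wt s) * (u s - v s) $ j)) + 0"
        by (simp add: rhs_def sum_subtractf[symmetric] algebra_simps)
      also have "norm \<dots> \<le> (real CARD('n) * M * B + 0) * wt s"
      proof (rule rhs_bound[where \<psi>="\<lambda>_ _. 0"])
        fix j show "norm (of_real (wt s) * (u s - v s) $ j) \<le> B * wt s"
          using order_trans[OF Finite_Cartesian_Product.norm_nth_le B, of s j] wt_pos[of s]
            mult_right_mono[of "norm ((u s - v s) $ j)" B "wt s"]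
          by (simp add: norm_mult mult.commute abs_of_pos)
      qed (use s in auto)
      finally show "norm (rhs u i s - rhs v i s) \<le> (real CARD('n) * M * B) * wt s" by simp
    qed (use M0 B0 in simp)
    moreover have "T u t $ i - T v t $ i = integral {t..d} (\<lambda>s. rhs u i s - rhs v i s) / of_real (wt t)"
      by (simp add: T_def Henstock_Kurzweil_Integration.integral_diff[OF int[OF u] int[OF v]] diff_divide_distrib)
    ultimately show ?thesis by (simp add: norm_divide pos_divide_le_eq abs_of_pos)
  qed
  have T0: "norm (T (\<lambda>_. 0) t $ i) \<le> N / lam" for t i
  proof -
    have "norm (integral {t..d} (rhs (\<lambda>_. 0) i)) \<le> N / lam * wt t"
    proof (rule weighted_integral_bound[OF int])
      fix s assume s: "t \<le> s" "s \<le> d"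
      have "norm (rhs (\<lambda>_. 0) i s) \<le> N" by (simp add: rhs_def \<psi>b)
      also have "\<dots> \<le> N * wt s" using wt_ge1[OF s(2)] N by (simp add: mult_le_cancel_left1)
      finally show "norm (rhs (\<lambda>_. 0) i s) \<le> N * wt s" .
    qed (use N in auto)
    then show ?thesis by (simp add: T_def norm_divide pos_divide_le_eq abs_of_pos)
  qed
  \<comment> \<open>Boundedness comes from writing T u as T 0 plus a difference, bounded by
    \<open>T0\<close> and by \<open>Tn\<close> with v = 0.\<close>
  have Tb: "T u \<in> bcontfun" if u: "u \<in> bcontfun" for u
  proof -
    have uc: "continuous_on UNIV u" and ub: "bounded (range u)" using u by (auto simp: bcontfun_def)
    obtain B where B: "\<And>s. norm (u s) \<le> B" using ub unfolding bounded_iff by auto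
    have "continuous_on UNIV (T u)"
      unfolding T_def
      by (intro continuous_on_vec_lambda continuous_intros tail_integral_continuous int uc) (simp add: less_imp_neq[symmetric])
    moreover have "norm (T u t) \<le> (\<Sum>i\<in>(UNIV::'n set). N / lam + real CARD('n) * M * B / lam)" for t
    proof (rule order_trans[OF norm_vec_le_sum], rule sum_mono)
      fix i
      have "norm (T (\<lambda>_. 0) t $ i + (T u t $ i - T (\<lambda>_. 0) t $ i)) \<le> N / lam + real CARD('n) * M * B / lam"
        by (rule norm_triangle_mono[OF T0 Tn]) (use uc B in auto)
      then show "norm (T u t $ i) \<le> N / lam + real CARD('n) * M * B / lam" by simp
    qed
    ultimately show ?thesis by (intro bcontfun_normI) auto
  qed
  define TT where "TT u = Bcontfun (T (apply_bcontfun u))" for u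
  have TT: "apply_bcontfun (TT u) = T (apply_bcontfun u)" for u
    unfolding TT_def by (rule Bcontfun_inverse) (rule Tb, rule apply_bcontfun)
  have "\<exists>!u. TT u = u"
  proof (rule banach_fix_type[where c="1/2"], goal_cases)
    case 3
    show ?case
    proof (intro allI dist_bound)
      fix u v :: "(real, complex^'n) bcontfun" and t
      have cont: "continuous_on UNIV (apply_bcontfun w)" for w :: "(real, complex^'n) bcontfun"
        using apply_bcontfun[of w] by (simp add: bcontfun_def)
      have "norm (T (apply_bcontfun u) t - T (apply_bcontfun v) t) \<le> (\<Sum>i\<in>(UNIV::'n set). real CARD('n) * M * dist u v / lam)"
      proof (rule order_trans[OF norm_vec_le_sum], rule sum_mono)
        fix i show "norm ((T (apply_bcontfun u) t - T (apply_bcontfun v) t) $ i) \<le> real CARD('n) * M * dist u v / lam"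
          unfolding vector_minus_component
          by (rule Tn[OF cont cont]) (simp add: dist_norm[symmetric] dist_bounded)
      qed
      also have "\<dots> \<le> 1/2 * dist u v"
      proof -
        \<comment> \<open>One factor n comes from the sum over the coefficients, the other from
          bounding the vector norm by the sum of its components. The 2 in \<open>lam\<close> leaves
          the contraction constant 1/2, and its + 1 keeps \<open>lam\<close> positive when M =
          0.\<close>
        have "2 * (real CARD('n) * real CARD('n) * M) * dist u v \<le> lam * dist u v"
          by (rule mult_right_mono) (simp_all add: lam_def)
        then show ?thesis using lam_pos by (simp add: field_simps)
      qed
      finally show "dist (TT u t) (TT v t) \<le> 1/2 * dist u v" by (simp add: TT dist_norm)
    qed
  qed auto
  then obtain u where "TT u = u" by blast
  then have u: "apply_bcontfun u = T (apply_bcontfun u)" using TT by metis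
  have uc: "continuous_on UNIV (apply_bcontfun u)" using apply_bcontfun by (auto simp: bcontfun_def)
  define \<phi> where "\<phi> j s = of_real (wt s) * u s $ j" for j s
  have \<phi>c: "continuous_on S (\<phi> j)" for j S
    unfolding \<phi>_def by (intro continuous_intros continuous_on_subset[OF uc]) auto
  have \<phi>e: "\<phi> i t = integral {t..d} (\<lambda>s. (\<Sum>j\<in>UNIV. c i j s * \<phi> j s) + \<psi> i s)" for i t
  proof -
    have "u t $ i = integral {t..d} (rhs u i) / of_real (wt t)"
      by (subst u) (simp add: T_def)
    then have "\<phi> i t = integral {t..d} (rhs u i)"
      using wt_pos[of t] by (simp add: \<phi>_def less_imp_neq[symmetric])
    then show ?thesis unfolding rhs_def \<phi>_def .
  qed
  show ?thesis
  proof (rule that[of \<phi>])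
    fix i t assume "d \<le> t"
    then show "\<phi> i t = 0"
      by (subst \<phi>e) (cases "t = d"; simp)
  next
    show "solves \<psi> t1 \<phi>" for t1 unfolding solves_def by (intro conjI allI ballI \<phi>c \<phi>e)
  qed (rule \<phi>c)
qed

end

subsection \<open>Cut-off monomials with a jump in a single derivative\<close>

text \<open>The class \<open>FFk I k\<close> admits jumps in the \<open>k\<close>-th derivative only and requires bounded derivatives
  on all of \<open>I\<close>. The function \<open>(t - s)^l (1\<^bsub>t \<ge> s\<^esub> - \<sigma>(t))\<close>, with the logistic function \<open>\<sigma>\<close>, is of this kind for
  \<open>k = l\<close>, and in differences of two of them the smooth parts cancel.\<close>

definition sigmoid :: "real \<Rightarrow> real" where "sigmoid t = 1 / (1 + exp (- t))"

lemma sigmoid_deriv: "(sigmoid has_real_derivative sigmoid t * (1 - sigmoid t)) (at t)"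
proof -
  have p: "1 + exp (- t) > 0" by (simp add: add_pos_pos)
  show ?thesis unfolding sigmoid_def
    using p by (auto intro!: derivative_eq_intros simp: field_simps power2_eq_square)
qed

lemma sigmoid_01: "0 < sigmoid t" "sigmoid t < 1" "sigmoid t \<le> exp t"
proof -
  have p: "1 + exp (- t) > 0" by (simp add: add_pos_pos)
  then show "0 < sigmoid t" "sigmoid t < 1" by (simp_all add: sigmoid_def)
  have "1 \<le> exp t * (1 + exp (- t))" by (simp add: algebra_simps exp_minus field_simps)
  then show "sigmoid t \<le> exp t" using p by (simp add: sigmoid_def field_simps)
qed

text \<open>Reflection turns the decay of 1 - \<open>sigmoid\<close> at +infinity into the decay of
  \<open>sigmoid\<close> at -infinity, so that estimates on left half-lines serve both
  branches.\<close>

lemma sigmoid_minus: "sigmoid (- t) = 1 - sigmoid t"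
proof -
  have "1 + exp t > 0" "1 + exp (- t) > 0" by (simp_all add: add_pos_pos)
  then show ?thesis by (simp add: sigmoid_def exp_minus field_simps)
qed

text \<open>Rescaled form of (1 + x/n)^n \<le> exp x. The case n = 0 relies on 0^0 = 1.\<close>

lemma power_le_exp: "0 \<le> (x::real) \<Longrightarrow> x ^ n \<le> real n ^ n * exp x"
proof (cases "n = 0")
  case False
  assume x: "0 \<le> x"
  have "(x / real n) ^ n \<le> (1 + x / real n) ^ n" using x by (intro power_mono) auto
  also have "\<dots> \<le> exp x" by (rule exp_ge_one_plus_x_over_n_power_n) (use x False in auto)
  finally show ?thesis using False by (simp add: power_divide field_simps)
qed simp

text \<open>\<open>k\<close> derivatives, each bounded on every half-line \<open>{..s}\<close>.\<close>

fun left_smooth :: "nat \<Rightarrow> (real \<Rightarrow> real) \<Rightarrow> bool" where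
  "left_smooth 0 f \<longleftrightarrow> (\<forall>s. \<exists>B. \<forall>t\<le>s. \<bar>f t\<bar> \<le> B)"
| "left_smooth (Suc k) f \<longleftrightarrow> (\<forall>s. \<exists>B. \<forall>t\<le>s. \<bar>f t\<bar> \<le> B) \<and>
     (\<exists>f'. (\<forall>t. (f has_real_derivative f' t) (at t)) \<and> left_smooth k f')"

lemma left_smooth_bound: "left_smooth k f \<Longrightarrow> \<exists>B. \<forall>t\<le>s. \<bar>f t\<bar> \<le> B" by (cases k) auto

lemma left_smooth_add: "left_smooth k f \<Longrightarrow> left_smooth k g \<Longrightarrow> left_smooth k (\<lambda>t. f t + g t)"
proof (induction k arbitrary: f g)
  case 0
  have "\<exists>B. \<forall>t\<le>s. \<bar>f t + g t\<bar> \<le> B" for s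
  proof -
    obtain B C where "\<forall>t\<le>s. \<bar>f t\<bar> \<le> B" "\<forall>t\<le>s. \<bar>g t\<bar> \<le> C" using 0 by (metis left_smooth.simps(1))
    then have "\<forall>t\<le>s. \<bar>f t + g t\<bar> \<le> B + C" by (metis abs_triangle_ineq add_mono order_trans)
    then show ?thesis by blast
  qed
  then show ?case by simp
next
  case (Suc k)
  have "\<exists>B. \<forall>t\<le>s. \<bar>f t + g t\<bar> \<le> B" for s
  proof -
    obtain B where B: "\<forall>t\<le>s. \<bar>f t\<bar> \<le> B" using left_smooth_bound[OF Suc.prems(1), of s] ..
    obtain C where C: "\<forall>t\<le>s. \<bar>g t\<bar> \<le> C" using left_smooth_bound[OF Suc.prems(2), of s] ..
    from B C have "\<forall>t\<le>s. \<bar>f t + g t\<bar> \<le> B + C" by (metis abs_triangle_ineq add_mono order_trans)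
    then show ?thesis by blast
  qed
  moreover obtain f' g' where "\<forall>t. (f has_real_derivative f' t) (at t)" "left_smooth k f'"
     "\<forall>t. (g has_real_derivative g' t) (at t)" "left_smooth k g'" using Suc.prems by auto
  then have "(\<forall>t. ((\<lambda>t. f t + g t) has_real_derivative f' t + g' t) (at t)) \<and> left_smooth k (\<lambda>t. f' t + g' t)"
    using Suc.IH by (auto intro: DERIV_add)
  then have "\<exists>h. (\<forall>t. ((\<lambda>t. f t + g t) has_real_derivative h t) (at t)) \<and> left_smooth k h"
    by (rule exI[of _ "\<lambda>t. f' t + g' t"])
  ultimately show ?case unfolding left_smooth.simps by (intro conjI allI)
qed

lemma left_smooth_cmult: "left_smooth k f \<Longrightarrow> left_smooth k (\<lambda>t. c * f t)"
proof (induction k arbitrary: f)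
  case 0
  have "\<exists>B. \<forall>t\<le>s. \<bar>c * f t\<bar> \<le> B" for s
  proof -
    obtain B where "\<forall>t\<le>s. \<bar>f t\<bar> \<le> B" using 0 by (metis left_smooth.simps(1))
    then have "\<forall>t\<le>s. \<bar>c * f t\<bar> \<le> \<bar>c\<bar> * B" by (simp add: abs_mult mult_left_mono)
    then show ?thesis by blast
  qed
  then show ?case by simp
next
  case (Suc k)
  have "\<exists>B. \<forall>t\<le>s. \<bar>c * f t\<bar> \<le> B" for s
  proof -
    obtain B where "\<forall>t\<le>s. \<bar>f t\<bar> \<le> B" using left_smooth_bound[OF Suc.prems, of s] ..
    then have "\<forall>t\<le>s. \<bar>c * f t\<bar> \<le> \<bar>c\<bar> * B" by (simp add: abs_mult mult_left_mono)
    then show ?thesis by blast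
  qed
  moreover obtain f' where "\<forall>t. (f has_real_derivative f' t) (at t)" "left_smooth k f'" using Suc.prems by auto
  then have "(\<forall>t. ((\<lambda>t. c * f t) has_real_derivative c * f' t) (at t)) \<and> left_smooth k (\<lambda>t. c * f' t)"
    using Suc.IH by (auto intro: DERIV_cmult)
  then have "\<exists>h. (\<forall>t. ((\<lambda>t. c * f t) has_real_derivative h t) (at t)) \<and> left_smooth k h"
    by (rule exI[of _ "\<lambda>t. c * f' t"])
  ultimately show ?case unfolding left_smooth.simps by (intro conjI allI)
qed

lemma left_smooth_zero: "left_smooth k (\<lambda>_. 0)"
  by (induction k) (auto intro!: exI[of _ "\<lambda>_. 0"] exI[of _ 0])

lemma left_smooth_sum: "(\<And>i. i \<in> S \<Longrightarrow> left_smooth k (f i)) \<Longrightarrow> left_smooth k (\<lambda>t. \<Sum>i\<in>S. f i t)"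
  by (induction S rule: infinite_finite_induct) (auto intro: left_smooth_zero left_smooth_add)

text \<open>Left of 0 the factor \<open>sigmoid\<close> decays like exp and beats the monomial:
  \<open>power_le_exp\<close> with x = |t| leaves the constant l^l. On the rest of the half-line |t|
  \<le> |s|.\<close>

lemma sigmoid_power_bound: "\<exists>B. \<forall>t\<le>s. \<bar>t ^ l * sigmoid t ^ Suc m\<bar> \<le> B"
proof (intro exI allI impI)
  fix t assume t: "t \<le> s"
  have "sigmoid t ^ m \<le> 1" using sigmoid_01 by (intro power_le_one) (auto simp: less_imp_le)
  then have "sigmoid t ^ Suc m \<le> sigmoid t" using sigmoid_01(1)[of t] by (simp add: mult_left_le)
  then have 1: "\<bar>t ^ l * sigmoid t ^ Suc m\<bar> \<le> \<bar>t\<bar> ^ l * sigmoid t"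
    using sigmoid_01(1)[of t] by (simp only: abs_mult power_abs) (intro mult_left_mono; simp add: abs_of_pos)
  have "\<bar>t\<bar> ^ l * sigmoid t \<le> real l ^ l + \<bar>s\<bar> ^ l"
  proof (cases "t \<le> 0")
    case True
    have "\<bar>t\<bar> ^ l * sigmoid t \<le> (real l ^ l * exp \<bar>t\<bar>) * exp t"
      by (intro mult_mono power_le_exp) (use sigmoid_01[of t] in auto)
    also have "\<dots> = real l ^ l * exp (\<bar>t\<bar> + t)" by (simp only: exp_add mult.assoc)
    also have "\<dots> = real l ^ l" using True by simp
    finally show ?thesis by (simp add: add_increasing2)
  next
    case False
    have "\<bar>t\<bar> ^ l * sigmoid t \<le> \<bar>s\<bar> ^ l * 1"
      by (intro mult_mono power_mono) (use sigmoid_01[of t] False t in auto)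
    then show ?thesis by (simp add: add_increasing)
  qed
  with 1 show "\<bar>t ^ l * sigmoid t ^ Suc m\<bar> \<le> real l ^ l + \<bar>s\<bar> ^ l" by linarith
qed

text \<open>The derivative of \<open>sigmoid\<close> is \<open>sigmoid\<close> minus its square, so
  these products span a space closed under differentiation. The exponent \<open>Suc m\<close> keeps
  at least one factor \<open>sigmoid\<close>, which supplies the decay.\<close>

lemma left_smooth_sigmoid: "left_smooth k (\<lambda>t. t ^ l * sigmoid t ^ Suc m)"
proof (induction k arbitrary: l m)
  case 0 show ?case unfolding left_smooth.simps using sigmoid_power_bound by blast
next
  case (Suc k)
  let ?f' = "\<lambda>t. real l * (t ^ (l - 1) * sigmoid t ^ Suc m) +
     (real (Suc m) * (t ^ l * sigmoid t ^ Suc m) + (- real (Suc m)) * (t ^ l * sigmoid t ^ Suc (Suc m)))"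
  have "left_smooth k ?f'" by (intro left_smooth_add left_smooth_cmult Suc.IH)
  moreover have "((\<lambda>t. t ^ l * sigmoid t ^ Suc m) has_real_derivative ?f' t) (at t)" for t
    by (rule derivative_eq_intros sigmoid_deriv refl)+ (simp add: algebra_simps)
  ultimately have "\<exists>f'. (\<forall>t. ((\<lambda>t. t ^ l * sigmoid t ^ Suc m) has_real_derivative f' t) (at t)) \<and> left_smooth k f'"
    by (intro exI[of _ ?f']) simp
  then show ?case unfolding left_smooth.simps using sigmoid_power_bound[of _ l m] by simp
qed

lemma left_smooth_shifted: "left_smooth k (\<lambda>t. (t - s) ^ l * sigmoid t)"
proof -
  have "(t - s) ^ l * sigmoid t = (\<Sum>j\<le>l. (real (l choose j) * (- s) ^ (l - j)) * (t ^ j * sigmoid t ^ Suc 0))" for t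
  proof -
    have "(t + (- s)) ^ l = (\<Sum>j\<le>l. real (l choose j) * t ^ j * (- s) ^ (l - j))" by (rule binomial_ring)
    then have "(t - s) ^ l * sigmoid t = (\<Sum>j\<le>l. real (l choose j) * t ^ j * (- s) ^ (l - j)) * sigmoid t" by simp
    then show ?thesis by (simp only: sum_distrib_right sum_distrib_left mult_ac power_Suc power_0 mult_1_right mult_1_left)
  qed
  moreover have "left_smooth k (\<lambda>t. \<Sum>j\<le>l. (real (l choose j) * (- s) ^ (l - j)) * (t ^ j * sigmoid t ^ Suc 0))"
    by (intro left_smooth_sum left_smooth_cmult left_smooth_sigmoid)
  ultimately show ?thesis by (simp only:)
qed

text \<open>The derivatives hidden in \<open>left_smooth k\<close> may a priori vary with k;
  uniqueness identifies all of them with iterates of \<open>deriv\<close>.\<close>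

lemma left_smooth_chain:
  assumes "\<And>k. left_smooth k f"
  shows "\<exists>F. F 0 = f \<and> (\<forall>k t. (F k has_real_derivative F (Suc k) t) (at t)) \<and>
    (\<forall>k s. \<exists>B. \<forall>t\<le>s. \<bar>F k t\<bar> \<le> B)"
proof -
  define F where "F k = (deriv ^^ k) f" for k
  have SBd: "(\<forall>t. (g has_real_derivative deriv g t) (at t)) \<and> (\<forall>k. left_smooth k (deriv g))" if g: "\<forall>k. left_smooth k g" for g
  proof -
    have *: "(\<forall>t. (g has_real_derivative deriv g t) (at t)) \<and> left_smooth k (deriv g)" for k
    proof -
      obtain g' where g': "\<forall>t. (g has_real_derivative g' t) (at t)" "left_smooth k g'"
        using g[rule_format, of "Suc k"] by auto
      then have "g' t = deriv g t" for t using DERIV_imp_deriv[of g "g' t" t] by simp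
      then have "g' = deriv g" by (rule ext)
      with g' show ?thesis by simp
    qed
    then show ?thesis by blast
  qed
  have SBF: "\<forall>j. left_smooth j (F k)" for k
    by (induction k) (use assms SBd in \<open>auto simp: F_def\<close>)
  have "(F k has_real_derivative F (Suc k) t) (at t)" for k t
    using SBd[OF SBF] by (simp add: F_def)
  moreover have "F 0 = f" by (simp add: F_def)
  moreover have "\<exists>B. \<forall>t\<le>s. \<bar>F k t\<bar> \<le> B" for k s using left_smooth_bound[OF SBF[rule_format]] .
  ultimately show ?thesis by (intro exI[of _ F]) simp
qed

text \<open>Meant for the difference of the two branches of \<open>cutmon\<close>: only its l-th
  derivative can be nonzero at s, so only the l-th derivative of \<open>cutmon\<close> can
  jump.\<close>

lemma monomial_chain:
  fixes P :: "nat \<Rightarrow> real \<Rightarrow> real"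
  assumes "P 0 = (\<lambda>t. (t - s) ^ l)" "\<And>k t. (P k has_real_derivative P (Suc k) t) (at t)" "k \<noteq> l"
  shows "P k s = 0"
proof -
  have P: "P k = (\<lambda>t. if k \<le> l then fact l / fact (l - k) * (t - s) ^ (l - k) else 0)" for k
  proof (induction k)
    case 0 then show ?case using assms(1) by simp
  next
    case (Suc k)
    show ?case
    proof
      fix t
      have "(P k has_real_derivative (if Suc k \<le> l then fact l / fact (l - Suc k) * (t - s) ^ (l - Suc k) else 0)) (at t)"
      proof (cases "Suc k \<le> l")
        case True
        then obtain m where m: "l - k = Suc m" "l - Suc k = m" by (metis Suc_diff_le diff_Suc_Suc)
        have "((\<lambda>t. fact l / fact (Suc m) * (t - s) ^ Suc m) has_real_derivative fact l / fact m * (t - s) ^ m) (at t)"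
        proof -
          have f: "fact (Suc m) = real (Suc m) * fact m" by (rule fact_Suc)
          have "((\<lambda>t. fact l / fact (Suc m) * (t - s) ^ Suc m) has_real_derivative
              fact l / fact (Suc m) * (real (Suc m) * (1 - 0) * (t - s) ^ (Suc m - 1))) (at t)"
          proof (rule DERIV_cmult, rule DERIV_cong)
            show "((\<lambda>t. (t - s) ^ Suc m) has_real_derivative real (Suc m) * ((1 - 0) * (t - s) ^ (Suc m - Suc 0))) (at t)"
              by (rule DERIV_power[OF DERIV_diff[OF DERIV_ident DERIV_const]])
          qed simp
          then show ?thesis unfolding f by simp
        qed
        then show ?thesis using True m unfolding Suc.IH by simp
      next
        case False
        then show ?thesis unfolding Suc.IH by (cases "k = l") (auto intro!: derivative_eq_intros)
      qed
      then show "P (Suc k) t = (if Suc k \<le> l then fact l / fact (l - Suc k) * (t - s) ^ (l - Suc k) else 0)"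
        using assms(2) DERIV_unique by blast
    qed
  qed
  show ?thesis using assms(3) by (simp add: P)
qed

definition step :: "real \<Rightarrow> real \<Rightarrow> complex" where "step s t = (if s \<le> t then 1 else 0)"

definition cutmon :: "nat \<Rightarrow> real \<Rightarrow> real \<Rightarrow> complex" where
  "cutmon l s t = of_real ((t - s) ^ l) * (step s t - of_real (sigmoid t))"

text \<open>Left of s the function is -(t - s)^l times \<open>sigmoid\<close>; right of s it is (t -
  s)^l times the reflected \<open>sigmoid\<close>, a mirror image of the same kind. Both branches
  extend smoothly to the line and differ by (t - s)^l.\<close>

lemma cutmon_chains:
  "\<exists>L R :: nat \<Rightarrow> real \<Rightarrow> real.
    (\<forall>k t. (L k has_real_derivative L (Suc k) t) (at t)) \<and>
    (\<forall>k t. (R k has_real_derivative R (Suc k) t) (at t)) \<and>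
    (\<forall>k. \<exists>B. \<forall>t\<le>s. \<bar>L k t\<bar> \<le> B) \<and> (\<forall>k. \<exists>B. \<forall>t\<ge>s. \<bar>R k t\<bar> \<le> B) \<and>
    (\<forall>k. k \<noteq> l \<longrightarrow> L k s = R k s) \<and>
    cutmon l s = (\<lambda>t. of_real (if t < s then L 0 t else R 0 t))"
proof -
  obtain F where *: "F 0 = (\<lambda>t. (t - s) ^ l * sigmoid t) \<and> (\<forall>k t. (F k has_real_derivative F (Suc k) t) (at t)) \<and>
    (\<forall>k s. \<exists>B. \<forall>t\<le>s. \<bar>F k t\<bar> \<le> B)" using left_smooth_chain[OF left_smooth_shifted[of _ s l]] ..
  note F = *[THEN conjunct1] *[THEN conjunct2, THEN conjunct1, rule_format] *[THEN conjunct2, THEN conjunct2, rule_format]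
  obtain F' where *: "F' 0 = (\<lambda>t. (t - (- s)) ^ l * sigmoid t) \<and> (\<forall>k t. (F' k has_real_derivative F' (Suc k) t) (at t)) \<and>
    (\<forall>k s. \<exists>B. \<forall>t\<le>s. \<bar>F' k t\<bar> \<le> B)" using left_smooth_chain[OF left_smooth_shifted[of _ "- s" l]] ..
  note F' = *[THEN conjunct1] *[THEN conjunct2, THEN conjunct1, rule_format] *[THEN conjunct2, THEN conjunct2, rule_format]
  define L where "L k t = - F k t" for k t
  \<comment> \<open>The sign collects (-1)^l from reflecting the monomial and (-1)^k from the chain
    rule.\<close>
  define R where "R k t = (- 1) ^ (l + k) * F' k (- t)" for k t
  have L: "(L k has_real_derivative L (Suc k) t) (at t)" for k t
    unfolding L_def by (rule DERIV_minus F)+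
  have R: "(R k has_real_derivative R (Suc k) t) (at t)" for k t
  proof -
    have "((\<lambda>t. F' k (- t)) has_real_derivative F' (Suc k) (- t) * (- 1)) (at t)"
      by (rule DERIV_chain2[OF F'(2)]) (auto intro!: derivative_eq_intros)
    then have "((\<lambda>t. (- 1) ^ (l + k) * F' k (- t)) has_real_derivative (- 1) ^ (l + k) * (F' (Suc k) (- t) * (- 1))) (at t)"
      by (rule DERIV_cmult)
    moreover have "R k = (\<lambda>t. (- 1) ^ (l + k) * F' k (- t))" by (rule ext) (rule R_def)
    moreover have "R (Suc k) t = (- 1) ^ (l + k) * (F' (Suc k) (- t) * (- 1))" by (simp add: R_def)
    ultimately show ?thesis by (simp only:)
  qed
  have R0: "R 0 t = (t - s) ^ l * (1 - sigmoid t)" for t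
  proof -
    have "(- 1) ^ l * (s - t) ^ l = (t - s) ^ l" by (simp add: power_mult_distrib[symmetric])
    then show ?thesis by (simp add: R_def F'(1) sigmoid_minus mult.assoc[symmetric])
  qed
  show ?thesis
  proof (rule exI[of _ L], rule exI[of _ R], intro conjI allI impI L R)
    show "\<exists>B. \<forall>t\<le>s. \<bar>L k t\<bar> \<le> B" for k using F(3) by (simp add: L_def)
    show "\<exists>B. \<forall>t\<ge>s. \<bar>R k t\<bar> \<le> B" for k
    proof -
      obtain B where "\<forall>t\<le>- s. \<bar>F' k t\<bar> \<le> B" using F'(3) by blast
      then have "\<forall>t\<ge>s. \<bar>R k t\<bar> \<le> B" by (simp add: R_def abs_mult power_abs)
      then show ?thesis by blast
    qed
    show "L k s = R k s" if "k \<noteq> l" for k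
    proof -
      have "(\<lambda>t. R 0 t - L 0 t) = (\<lambda>t. (t - s) ^ l)"
        by (simp add: R0 L_def F(1) algebra_simps)
      then have "R k s - L k s = 0"
        using monomial_chain[of "\<lambda>k t. R k t - L k t" s l k] that DERIV_diff[OF R L] by simp
      then show ?thesis by simp
    qed
    show "cutmon l s = (\<lambda>t. of_real (if t < s then L 0 t else R 0 t))"
      by (auto simp: cutmon_def step_def R0 L_def F(1))
  qed
qed

context ival begin

lemma FFk_cutmon: "cutmon l s \<in> FFk I l"
proof -
  obtain L R :: "nat \<Rightarrow> real \<Rightarrow> real" where *:
    "\<forall>k t. (L k has_real_derivative L (Suc k) t) (at t)"
    "\<forall>k t. (R k has_real_derivative R (Suc k) t) (at t)"
    "\<forall>k. \<exists>B. \<forall>t\<le>s. \<bar>L k t\<bar> \<le> B" "\<forall>k. \<exists>B. \<forall>t\<ge>s. \<bar>R k t\<bar> \<le> B"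
    "\<forall>k. k \<noteq> l \<longrightarrow> L k s = R k s"
    "cutmon l s = (\<lambda>t. of_real (if t < s then L 0 t else R 0 t))"
    using cutmon_chains[of s l] by (elim exE conjE) (rule that)
  note LR = *(1-5)[rule_format] *(6)
  define H where "H k t = (of_real (if t < s then L k t else R k t) :: complex)" for k t
  have cL: "continuous_on S (L k)" and cR: "continuous_on S (R k)" for S k
    using LR(1,2) by (meson DERIV_continuous_on has_field_derivative_at_within)+
  have meas: "H k \<in> borel_measurable borel" for k
  proof -
    have [measurable]: "L k \<in> borel_measurable borel" "R k \<in> borel_measurable borel"
      using cL cR by (auto intro: borel_measurable_continuous_onI)
    show ?thesis unfolding H_def by measurable
  qed
  have bnd: "\<exists>B. \<forall>t. norm (H k t) \<le> B" for k
  proof -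
    obtain B C where "\<forall>t\<le>s. \<bar>L k t\<bar> \<le> B" "\<forall>t\<ge>s. \<bar>R k t\<bar> \<le> C" using LR(3,4) by metis
    then have "norm (H k t) \<le> max B C" for t unfolding H_def norm_of_real
      by (cases "t < s") (auto simp: le_max_iff_disj)
    then show ?thesis by blast
  qed
  have scL: "smooth_chain (\<lambda>k t. of_real (L k t))" and scR: "smooth_chain (\<lambda>k t. of_real (R k t))"
    unfolding smooth_chain_def using LR(1,2) has_vector_derivative_of_real by blast+
  have loc: "\<exists>H' d. d > 0 \<and> smooth_chain H' \<and> (\<forall>k. \<forall>r\<in>side_nbh b t d. H k r = H' k r)" for t b
  proof -
    obtain d where d: "d > 0" "\<forall>r\<in>side_nbh b t d. (s \<le> r \<longleftrightarrow> (if b then s \<le> t else s < t))"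
      using side_local_const by blast
    show ?thesis
    proof (cases "if b then s \<le> t else s < t")
      case True
      then have "\<forall>r\<in>side_nbh b t d. \<not> r < s" using d by auto
      then show ?thesis using d(1) scR by (intro exI[of _ "\<lambda>k t. of_real (R k t)"] exI[of _ d]) (auto simp: H_def)
    next
      case False
      then have "\<forall>r\<in>side_nbh b t d. r < s" using d by (auto simp: not_le)
      then show ?thesis using d(1) scL by (intro exI[of _ "\<lambda>k t. of_real (L k t)"] exI[of _ d]) (auto simp: H_def)
    qed
  qed
  have chain: "H k \<in> GG I" "has_gder I (H k) (H (Suc k))" for k
    by (rule piecewise_smooth; use borel_I[OF meas] bnd loc in blast)+
  have H0: "H 0 = cutmon l s" by (simp add: LR(6) H_def fun_eq_iff)
  have ae: "ae_eq I ((gder I ^^ i) (cutmon l s)) (H i)" for i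
    using gder_chain[of H, OF chain(2)] H0 by simp
  have cont: "continuous_on UNIV (H i)" if "i \<noteq> l" for i
  proof -
    have "continuous_on ({..s} \<union> {s..}) (\<lambda>t. if t \<le> s then L i t else R i t)"
      by (rule continuous_on_If) (use cL cR LR(5)[OF that] in auto)
    moreover have "{..s} \<union> {s..} = UNIV" by auto
    moreover have "H i = (\<lambda>t. of_real (if t \<le> s then L i t else R i t))"
      using LR(5)[OF that] by (auto simp: H_def)
    ultimately show ?thesis by (simp only:) (rule continuous_on_of_real)
  qed
  have "ae_bcontinuous I ((gder I ^^ i) (cutmon l s))" if "i \<noteq> l" for i
    unfolding ae_bcontinuous_def
  proof (intro exI[of _ "H i"] conjI ae)
    show "continuous_on I (H i)" using cont[OF that] continuous_on_subset by blast
    obtain B where "\<forall>t. norm (H i t) \<le> B" using bnd by blast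
    then show "bounded (H i ` I)" unfolding bounded_iff by blast
  qed
  moreover have "ae_pw_continuous I ((gder I ^^ l) (cutmon l s))"
    unfolding ae_pw_continuous_def
  proof (intro exI[of _ "H l"] conjI ae allI impI)
    have "isCont (H l) t" if "t \<noteq> s" for t
    proof (cases "t < s")
      case True
      have "continuous_on {..<s} (\<lambda>t. of_real (L l t) :: complex)" by (intro continuous_intros cL)
      then have "continuous_on {..<s} (H l)" by (rule continuous_on_eq) (simp add: H_def)
      then show ?thesis using True by (simp add: continuous_on_eq_continuous_at)
    next
      case False
      have "continuous_on {s<..} (\<lambda>t. of_real (R l t) :: complex)" by (intro continuous_intros cR)
      then have "continuous_on {s<..} (H l)" by (rule continuous_on_eq) (simp add: H_def)
      then show ?thesis using False that by (simp add: continuous_on_eq_continuous_at)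
    qed
    then show "finite {t \<in> K. \<not> isCont (H l) t}" for K
      by (metis (mono_tags, lifting) finite.simps finite_subset insertI1 mem_Collect_eq subsetI)
  qed
  moreover have "cutmon l s \<in> Ginf I" using Ginf_chain[of H] chain H0 by metis
  ultimately show ?thesis by (simp add: FFk_def)
qed

lemma FF_FFk: "g \<in> FFk I k \<Longrightarrow> g \<in> FF I"
  unfolding FF_def
  by (intro CollectI exI[of _ "Suc 0"] exI[of _ "\<lambda>_. 1"] exI[of _ "\<lambda>_. g"]) auto

lemma FF_zero: "(\<lambda>_. 0) \<in> FF I"
  unfolding FF_def
  by (intro CollectI exI[of _ 0] exI[of _ "\<lambda>_. 1"] exI[of _ "\<lambda>_ _. 0"]) auto

lemma FF_cmult: "g \<in> FF I \<Longrightarrow> (\<lambda>t. a * g t) \<in> FF I"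
proof -
  assume "g \<in> FF I"
  then obtain N c h where g: "g = (\<lambda>t. \<Sum>i<(N::nat). c i * h i t)" "\<forall>i<N. h i \<in> (\<Union>k. FFk I k)"
    unfolding FF_def by auto
  have "(\<lambda>t. a * g t) = (\<lambda>t. \<Sum>i<N. (a * c i) * h i t)" by (simp add: g(1) sum_distrib_left mult.assoc)
  with g(2) show ?thesis unfolding FF_def by (intro CollectI exI[of _ N] exI[of _ "\<lambda>i. a * c i"] exI[of _ h]) simp
qed

lemma FF_add: "g \<in> FF I \<Longrightarrow> g' \<in> FF I \<Longrightarrow> (\<lambda>t. g t + g' t) \<in> FF I"
proof -
  assume *: "g \<in> FF I" "g' \<in> FF I"
  obtain N c h where g: "g = (\<lambda>t. \<Sum>i<(N::nat). c i * h i t)" "\<forall>i<N. h i \<in> (\<Union>k. FFk I k)"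
    using *(1) unfolding FF_def by auto
  obtain N' c' h' where g': "g' = (\<lambda>t. \<Sum>i<(N'::nat). c' i * h' i t)" "\<forall>i<N'. h' i \<in> (\<Union>k. FFk I k)"
    using *(2) unfolding FF_def by auto
  define C where "C i = (if i < N then c i else c' (i - N))" for i
  define K where "K i = (if i < N then h i else h' (i - N))" for i
  have s: "(\<Sum>i<N + M. (C i * K i t)) = (\<Sum>i<N. c i * h i t) + (\<Sum>i<M. c' i * h' i t)" for M t
    by (induction M) (auto simp: C_def K_def)
  have "(\<lambda>t. g t + g' t) = (\<lambda>t. \<Sum>i<N + N'. C i * K i t)" by (simp add: g(1) g'(1) s)
  moreover have "\<forall>i<N + N'. K i \<in> (\<Union>k. FFk I k)"
  proof (intro allI impI)
    fix i assume i: "i < N + N'"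
    show "K i \<in> (\<Union>k. FFk I k)"
    proof (cases "i < N")
      case True then show ?thesis using g(2) by (simp only: K_def if_True)
    next
      case False
      then have "i - N < N'" using i by linarith
      then show ?thesis using g'(2) False by (simp only: K_def if_False)
    qed
  qed
  ultimately show ?thesis unfolding FF_def by blast
qed

lemma FF_sum: "(\<And>i. i \<in> S \<Longrightarrow> f i \<in> FF I) \<Longrightarrow> (\<lambda>t. \<Sum>i\<in>S. f i t) \<in> FF I"
  by (induction S rule: infinite_finite_induct) (auto intro: FF_zero FF_add)

text \<open>\<open>cutmon\<close> is centred at its own jump, whereas a polynomial cut at two places
  has a single centre; the binomial formula re-expands (t - x)^l around s.\<close>

lemma FF_shifted_cutmon: "(\<lambda>t. of_real (t - x) ^ l * (step s t - of_real (sigmoid t))) \<in> FF I"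
proof -
  have "of_real (t - x) ^ l * (step s t - of_real (sigmoid t)) =
      (\<Sum>j\<le>l. (of_nat (l choose j) * of_real (s - x) ^ (l - j)) * cutmon j s t)" for t
  proof -
    have "((t - s) + (s - x)) ^ l = (\<Sum>j\<le>l. real (l choose j) * (t - s) ^ j * (s - x) ^ (l - j))"
      by (rule binomial_ring)
    then have "(t - x) ^ l = (\<Sum>j\<le>l. real (l choose j) * (t - s) ^ j * (s - x) ^ (l - j))" by simp
    then have "of_real (t - x) ^ l = (\<Sum>j\<le>l. of_nat (l choose j) * of_real (t - s) ^ j * (of_real (s - x) ^ (l - j) :: complex))"
      by (simp only: of_real_power[symmetric]) simp
    then show ?thesis unfolding cutmon_def of_real_power
      by (simp only: sum_distrib_right sum_distrib_left mult_ac)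
  qed
  then show ?thesis using FF_sum[of "{..l}"] FF_cmult FF_FFk[OF FFk_cutmon] by simp
qed

lemma FF_poly_ind:
  assumes "q \<le> r"
  shows "(\<lambda>t. ind q r t * (\<Sum>l\<in>S. a l * of_real (t - x) ^ l)) \<in> FF I"
proof -
  let ?c = "\<lambda>s l t. of_real (t - x) ^ l * (step s t - of_real (sigmoid t))"
  have eq: "ind q r t = step q t - step r t" for t using assms by (auto simp: ind_def step_def)
  have "ind q r t * (\<Sum>l\<in>S. a l * of_real (t - x) ^ l) = (\<Sum>l\<in>S. a l * ?c q l t + (- a l) * ?c r l t)" for t
    unfolding sum_distrib_left eq by (intro sum.cong refl) (simp add: algebra_simps)
  moreover have "(\<lambda>t. \<Sum>l\<in>S. a l * ?c q l t + (- a l) * ?c r l t) \<in> FF I"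
    by (intro FF_sum FF_add FF_cmult FF_shifted_cutmon)
  ultimately show ?thesis by (simp only:)
qed

lemma ess_lim_isCont:
  assumes "isCont g t" shows "ess_lim b g t = g t"
proof (rule ess_lim_side)
  show "(g \<longlongrightarrow> g t) (side_at b t)"
    using assms tendsto_mono[OF side_at_le] unfolding continuous_within by blast
qed

text \<open>Among the generators only those in \<open>FFk I 0\<close> can jump themselves, finitely
  often on each compact set, and compact support confines the jumps. Finiteness matters because a
  sum over an infinite set would be 0 by default.\<close>

lemma finite_jumps_FF:
  assumes \<phi>: "\<phi> \<in> test I" "\<phi> \<in> FF I"
  shows "finite {t \<in> I. ess_lim True \<phi> t \<noteq> ess_lim False \<phi> t}"
proof -
  obtain N c g where g: "\<phi> = (\<lambda>t. \<Sum>i<(N::nat). c i * g i t)" "\<forall>i<N. g i \<in> (\<Union>k. FFk I k)"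
    using \<phi>(2) unfolding FF_def by auto
  obtain x y where xy: "{x..y} \<subseteq> I" "\<phi> \<in> test_on I {x..y}" using testE[OF \<phi>(1)] by metis
  have G: "g i \<in> GG I" if "i < N" for i using g(2) that Ginf_GG by (auto simp: FFk_def)
  have fin: "finite {t \<in> {x..y}. ess_lim True (g i) t \<noteq> ess_lim False (g i) t}" if i: "i < N" for i
  proof -
    obtain k where k: "g i \<in> FFk I k" using g(2) i by blast
    show ?thesis
    proof (cases "k = 0")
      case True
      then obtain p where p: "ae_eq I (g i) p" "finite {t \<in> {x..y}. \<not> isCont p t}"
      proof -
        have "ae_pw_continuous I (g i)" using k True by (simp add: FFk_def)
        then show ?thesis using that xy(1) compact_Icc[of x y] unfolding ae_pw_continuous_def by meson
      qed
      have "{t \<in> {x..y}. ess_lim True (g i) t \<noteq> ess_lim False (g i) t} \<subseteq> {t \<in> {x..y}. \<not> isCont p t}"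
      proof safe
        fix t assume t: "t \<in> {x..y}" "ess_lim True (g i) t \<noteq> ess_lim False (g i) t" "isCont p t"
        then have "t \<in> I" using xy by blast
        from ae_eq_ess_lim[OF p(1) this] t ess_lim_isCont show False by metis
      qed
      then show ?thesis using p(2) finite_subset by blast
    next
      case False
      then obtain p where p: "ae_eq I (g i) p" "continuous_on I p"
      proof -
        have "\<forall>j. j \<noteq> k \<longrightarrow> ae_bcontinuous I ((gder I ^^ j) (g i))" using k by (simp add: FFk_def)
        then have "ae_bcontinuous I ((gder I ^^ 0) (g i))" using False by metis
        then show ?thesis using that unfolding ae_bcontinuous_def by auto
      qed
      have "ess_lim True (g i) t = ess_lim False (g i) t" if "t \<in> {x..y}" for t
      proof -
        have t: "t \<in> I" using xy that by blast
        then have "isCont p t" using p(2) open_I by (simp add: continuous_on_eq_continuous_at)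
        with ae_eq_ess_lim[OF p(1) t] ess_lim_isCont show ?thesis by metis
      qed
      then have "{t \<in> {x..y}. ess_lim True (g i) t \<noteq> ess_lim False (g i) t} = {}" by blast
      then show ?thesis by (simp only: finite.emptyI)
    qed
  qed
  have "{t \<in> I. ess_lim True \<phi> t \<noteq> ess_lim False \<phi> t} \<subseteq> (\<Union>i<N. {t \<in> {x..y}. ess_lim True (g i) t \<noteq> ess_lim False (g i) t})"
  proof
    fix t assume t: "t \<in> {t \<in> I. ess_lim True \<phi> t \<noteq> ess_lim False \<phi> t}"
    then have tI: "t \<in> I" by simp
    have txy: "t \<in> {x..y}"
    proof (rule ccontr)
      assume "t \<notin> {x..y}"
      then have "t < x \<or> y < t" by auto
      then have "ess_lim True \<phi> t = 0 \<and> ess_lim False \<phi> t = 0" using xy(2) tI unfolding test_on_Icc[OF xy(1)] by blast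
      with t show False by simp
    qed
    have l: "ess_lim b \<phi> t = (\<Sum>i<N. c i * ess_lim b (g i) t)" for b
    proof -
      have "ess_lim b \<phi> t = (\<Sum>i<N. ess_lim b (\<lambda>t. c i * g i t) t)"
        unfolding g(1) by (rule ess_lim_sum) (use G GG_cmult tI in auto)
      also have "\<dots> = (\<Sum>i<N. c i * ess_lim b (g i) t)"
        by (intro sum.cong ess_lim_cmult) (use G tI in auto)
      finally show ?thesis .
    qed
    have "\<exists>i<N. ess_lim True (g i) t \<noteq> ess_lim False (g i) t"
    proof (rule ccontr)
      assume "\<not> ?thesis"
      then have "ess_lim True \<phi> t = ess_lim False \<phi> t" unfolding l by (intro sum.cong) auto
      with t show False by simp
    qed
    with txy show "t \<in> (\<Union>i<N. {t \<in> {x..y}. ess_lim True (g i) t \<noteq> ess_lim False (g i) t})" by blast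
  qed
  moreover have "finite (\<Union>i<N. {t \<in> {x..y}. ess_lim True (g i) t \<noteq> ess_lim False (g i) t})" using fin by blast
  ultimately show ?thesis by (rule finite_subset)
qed

end

subsection \<open>Density of piecewise polynomials among continuous test functions\<close>

text \<open>The \<open>i\<close>-th derivative of \<open>\<Sum>l\<le>K. a l * (t - x)^l\<close>.\<close>

definition taylor :: "(nat \<Rightarrow> complex) \<Rightarrow> real \<Rightarrow> nat \<Rightarrow> nat \<Rightarrow> real \<Rightarrow> complex" where
  "taylor a x K i t = (\<Sum>l\<in>{i..K}. a l * of_real (fact l / fact (l - i) * (t - x) ^ (l - i)))"

lemma taylor_smooth: "smooth_chain (taylor a x K)"
  unfolding smooth_chain_def
proof (intro allI)
  fix i t
  have trm: "((\<lambda>t. a l * of_real (fact l / fact (l - i) * (t - x) ^ (l - i))) has_vector_derivative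
      (if l = i then 0 else a l * of_real (fact l / fact (l - Suc i) * (t - x) ^ (l - Suc i)))) (at t)" if "i \<le> l" for l
  proof (cases "l = i")
    case False
    then obtain m where m: "l - i = Suc m" "l - Suc i = m"
      using \<open>i \<le> l\<close> by (metis Suc_diff_Suc le_neq_implies_less)
    have "((\<lambda>t. fact l / fact (Suc m) * (t - x) ^ Suc m) has_real_derivative
        fact l / fact (Suc m) * (real (Suc m) * (t - x) ^ m)) (at t)"
    proof (rule DERIV_cmult, rule DERIV_cong)
      show "((\<lambda>t. (t - x) ^ Suc m) has_real_derivative real (Suc m) * ((1 - 0) * (t - x) ^ (Suc m - Suc 0))) (at t)"
        by (rule DERIV_power[OF DERIV_diff[OF DERIV_ident DERIV_const]])
    qed simp
    moreover have "fact l / fact (Suc m) * (real (Suc m) * (t - x) ^ m) = fact l / fact m * (t - x) ^ m"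
      unfolding fact_Suc by simp
    ultimately have "((\<lambda>t. fact l / fact (Suc m) * (t - x) ^ Suc m) has_real_derivative fact l / fact m * (t - x) ^ m) (at t)"
      by (simp only:)
    from has_vector_derivative_mult_right[OF has_vector_derivative_of_real[OF this], of "a l"]
    show ?thesis using False unfolding m by (simp only: if_False)
  qed simp
  have "((\<lambda>t. \<Sum>l\<in>{i..K}. a l * of_real (fact l / fact (l - i) * (t - x) ^ (l - i))) has_vector_derivative
      (\<Sum>l\<in>{i..K}. if l = i then 0 else a l * of_real (fact l / fact (l - Suc i) * (t - x) ^ (l - Suc i)))) (at t)"
    by (rule has_vector_derivative_sum) (use trm in auto)
  moreover have "(\<Sum>l\<in>{i..K}. if l = i then 0 else a l * of_real (fact l / fact (l - Suc i) * (t - x) ^ (l - Suc i))) =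
     taylor a x K (Suc i) t"
    unfolding taylor_def by (rule sum.mono_neutral_cong_right) auto
  moreover have "taylor a x K i = (\<lambda>t. \<Sum>l\<in>{i..K}. a l * of_real (fact l / fact (l - i) * (t - x) ^ (l - i)))"
    by (rule ext) (rule taylor_def)
  ultimately show "(taylor a x K i has_vector_derivative taylor a x K (Suc i) t) (at t)" by (simp only:)
qed

lemma taylor_cont: "isCont (taylor a x K i) t"
  using taylor_smooth has_vector_derivative_continuous unfolding smooth_chain_def by blast

lemma taylor_at: "i \<le> K \<Longrightarrow> taylor a x K i x = a i * fact i"
proof -
  assume "i \<le> K"
  have "taylor a x K i x = (\<Sum>l\<in>{i}. a l * of_real (fact l / fact (l - i) * (x - x) ^ (l - i)))"
    unfolding taylor_def by (rule sum.mono_neutral_right) (use \<open>i \<le> K\<close> in \<open>auto simp: power_0_left\<close>)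
  then show ?thesis by simp
qed

text \<open>Altering the linear coefficient affects only the value and the first derivative, by
  amounts that \<beta> controls near x.\<close>

lemma taylor_upd:
  assumes "1 \<le> K"
  shows "taylor (a(1 := a 1 + \<beta>)) x K i t = taylor a x K i t + \<beta> * (if i = 0 then of_real (t - x) else if i = 1 then 1 else 0)"
proof -
  have "taylor (a(1 := a 1 + \<beta>)) x K i t =
      (\<Sum>l\<in>{i..K}. a l * of_real (fact l / fact (l - i) * (t - x) ^ (l - i)) +
        (if l = 1 then \<beta> * of_real (fact l / fact (l - i) * (t - x) ^ (l - i)) else 0))"
    unfolding taylor_def by (intro sum.cong) (auto simp: algebra_simps add_divide_distrib)
  also have "\<dots> = taylor a x K i t + (if 1 \<in> {i..K} then \<beta> * of_real (fact 1 / fact (1 - i) * (t - x) ^ (1 - i)) else 0)"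
    unfolding sum.distrib taylor_def by (simp add: sum.delta')
  also have "(if 1 \<in> {i..K} then \<beta> * of_real (fact 1 / fact (1 - i) * (t - x) ^ (1 - i)) else 0) =
      \<beta> * (if i = 0 then of_real (t - x) else if i = 1 then 1 else 0)"
    using assms by (cases "i = 0"; cases "i = 1") auto
  finally show ?thesis .
qed

section \<open>One-sided Taylor approximation and gluing\<close>

context ival begin

lemma taylor_FF: "q \<le> r \<Longrightarrow> (\<lambda>t. ind q r t * taylor a x K 0 t) \<in> FF I"
  using FF_poly_ind[of q r, where S="{0..K}" and a=a and x=x] by (simp add: taylor_def)

lemma ind_ess_lim:
  assumes "t \<noteq> p" "t \<noteq> q" shows "ess_lim b (ind p q) t = ind p q t"
proof -
  let ?d = "min \<bar>t - p\<bar> \<bar>t - q\<bar>"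
  have "ind p q s = ind p q t" if "s \<in> side_nbh b t ?d" for s
    using that by (auto simp: ind_def side_nbh_def split: if_splits)
  then have "eventually (\<lambda>s. ind p q s = ind p q t) (ess b t)"
    unfolding eventually_ess using assms by (intro exI[of _ ?d]) auto
  from ess_lim_cong[OF this] show ?thesis by simp
qed

text \<open>The indicator has equal one-sided limits away from p and q; at p and q the factor v
  kills its jump.\<close>

lemma jump_free_ind:
  assumes "t \<in> I" "t \<in> {p, q} \<Longrightarrow> v = 0"
  shows "ess_lim True (ind p q) t * v = ess_lim False (ind p q) t * v"
  using assms ind_ess_lim[of t p q] by (cases "t \<in> {p, q}") auto

definition jump_free :: "(real \<Rightarrow> complex) \<Rightarrow> bool" where
  "jump_free g \<longleftrightarrow> (\<forall>t\<in>I. ess_lim True g t = ess_lim False g t)"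

lemma jump_free_rep: "jump_free g \<Longrightarrow> t \<in> I \<Longrightarrow> ess_lim b g t = rep g t"
  unfolding jump_free_def by (cases b) (auto simp: rep_in)

lemma jump_free_lin:
  assumes "f \<in> GG I" "g \<in> GG I" "jump_free f" "jump_free g"
  shows "jump_free (\<lambda>t. \<alpha> * f t + \<beta> * g t)"
  using assms by (auto simp: jump_free_def ess_lim_add ess_lim_cmult GG_cmult)

lemma jump_free_ae_eq: "jump_free f \<Longrightarrow> ae_eq I f g \<Longrightarrow> jump_free g"
  unfolding jump_free_def using ae_eq_ess_lim by metis

lemma gder_pow_has_gder: "\<phi> \<in> Ginf I \<Longrightarrow> has_gder I ((gder I ^^ i) \<phi>) ((gder I ^^ Suc i) \<phi>)"
  using Ginf_gder[OF gder_pow_Ginf] by simp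

lemma gder_pow_GG: "\<phi> \<in> Ginf I \<Longrightarrow> (gder I ^^ i) \<phi> \<in> GG I"
  using Ginf_GG gder_pow_Ginf by blast

text \<open>One-sided Taylor polynomials at \<open>t0\<close> are not continuous across neighbouring knots. The linear term is
  therefore corrected so that the value at the other knot \<open>s\<close> is met; the correction is a difference quotient of
  the Taylor error and tends to \<open>0\<close> with \<open>s - t0\<close>.\<close>

lemma taylor_one_sided:
  assumes \<phi>: "\<phi> \<in> Ginf I" and jf: "jump_free \<phi>" and t0: "t0 \<in> I" and \<epsilon>: "\<epsilon> > 0"
  shows "\<exists>\<delta>>0. \<forall>s\<in>side_nbh b t0 \<delta>. s \<in> I \<and> (\<exists>a. taylor a t0 (Suc k) 0 t0 = rep \<phi> t0 \<and> taylor a t0 (Suc k) 0 s = rep \<phi> s \<and>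
     (\<forall>i\<le>k. norm (ess_lim b ((gder I ^^ i) \<phi>) t0 - taylor a t0 (Suc k) i t0) \<le> \<epsilon> \<and>
        (\<forall>t\<in>side_nbh b t0 \<delta>. norm (rep ((gder I ^^ i) \<phi>) t - taylor a t0 (Suc k) i t) \<le> \<epsilon>)))"
proof -
  define D where "D i = (gder I ^^ i) \<phi>" for i
  define \<alpha> where "\<alpha> l = ess_lim b (D l) t0 / fact l" for l
  \<comment> \<open>Degree \<open>Suc k\<close> rather than k, so that a linear coefficient is
    available even when k = 0.\<close>
  define T where "T = taylor \<alpha> t0 (Suc k)"
  define \<beta> where "\<beta> s = (rep \<phi> s - T 0 s) / of_real (s - t0)" for s
  have GD: "D i \<in> GG I" "has_gder I (D i) (D (Suc i))" for i
    using gder_pow_GG[OF \<phi>] gder_pow_has_gder[OF \<phi>] by (auto simp: D_def)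
  have D0: "D 0 = \<phi>" by (simp add: D_def)
  have T_at: "T i t0 = ess_lim b (D i) t0" if "i \<le> Suc k" for i
    using taylor_at[OF that] by (simp add: T_def \<alpha>_def)
  have Tc: "(T i \<longlongrightarrow> T i t0) (side_at b t0)" for i
    using taylor_cont tendsto_mono[OF side_at_le] unfolding T_def continuous_within by blast
  have e3: "\<epsilon>/3 > 0" using \<epsilon> by simp
  have e1: "eventually (\<lambda>t. dist (rep (D i) t) (ess_lim b (D i) t0) < \<epsilon>/3) (side_at b t0)" for i
    by (rule tendstoD[OF rep_lim[OF GD(1) t0] e3])
  have e2: "eventually (\<lambda>t. dist (T i t) (T i t0) < \<epsilon>/3) (side_at b t0)" for i
    by (rule tendstoD[OF Tc e3])
  have "((\<lambda>s. (T 0 s - T 0 t0) / of_real (s - t0)) \<longlongrightarrow> T 1 t0) (side_at b t0)"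
    using vector_derivative_quot[of "T 0" "T 1 t0" t0 UNIV] taylor_smooth[of \<alpha> t0 "Suc k"] tendsto_mono[OF side_at_le]
    unfolding smooth_chain_def T_def One_nat_def by blast
  moreover have "((\<lambda>s. (rep \<phi> s - ess_lim b \<phi> t0) / of_real (s - t0)) \<longlongrightarrow> ess_lim b (D 1) t0) (side_at b t0)"
    using has_gder_ordinary[OF GD(1) GD(2)[of 0] t0] by (simp add: D0)
  ultimately have "((\<lambda>s. (rep \<phi> s - ess_lim b \<phi> t0) / of_real (s - t0) - (T 0 s - T 0 t0) / of_real (s - t0)) \<longlongrightarrow>
      ess_lim b (D 1) t0 - T 1 t0) (side_at b t0)" by (rule tendsto_diff[rotated])
  moreover have "(rep \<phi> s - ess_lim b \<phi> t0) / of_real (s - t0) - (T 0 s - T 0 t0) / of_real (s - t0) = \<beta> s" for s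
    unfolding \<beta>_def T_at[of 0, simplified, unfolded D0] by (simp only: diff_divide_distrib[symmetric]) simp
  ultimately have "(\<beta> \<longlongrightarrow> 0) (side_at b t0)" using T_at[of 1] by simp
  then have e3': "eventually (\<lambda>s. dist (\<beta> s) 0 < \<epsilon>/3) (side_at b t0)" by (rule tendstoD[OF _ e3])
  \<comment> \<open>The bound 1 on the distance keeps the correction \<beta> (t - t0) at most
    |\<beta>|.\<close>
  have e4: "eventually (\<lambda>s. s \<in> I \<and> \<bar>s - t0\<bar> \<le> 1) (side_at b t0)"
  proof -
    obtain d where d: "d > 0" "\<forall>d'\<le>d. side_nbh b t0 d' \<subseteq> I" using side_nbh_in_I[OF t0, of b] by blast
    have "s \<in> I \<and> \<bar>s - t0\<bar> \<le> 1" if s: "s \<in> side_nbh b t0 (min d 1)" for s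
    proof -
      have "s \<in> I" using d s by (meson min.cobounded1 subsetD)
      moreover have "\<bar>s - t0\<bar> \<le> 1" using s by (auto simp: side_nbh_def split: if_splits)
      ultimately show ?thesis by blast
    qed
    then show ?thesis unfolding eventually_side_at using d(1) by (intro exI[of _ "min d 1"]) auto
  qed
  have "eventually (\<lambda>t. (\<forall>i\<in>{..k}. dist (rep (D i) t) (ess_lim b (D i) t0) < \<epsilon>/3) \<and>
      (\<forall>i\<in>{..k}. dist (T i t) (T i t0) < \<epsilon>/3) \<and> dist (\<beta> t) 0 < \<epsilon>/3 \<and> (t \<in> I \<and> \<bar>t - t0\<bar> \<le> 1)) (side_at b t0)"
    by (intro eventually_conj eventually_ball_finite e3' e4 ballI e1 e2) auto
  then obtain \<delta> where \<delta>: "\<delta> > 0" and near: "\<forall>t\<in>side_nbh b t0 \<delta>. (\<forall>i\<in>{..k}. dist (rep (D i) t) (ess_lim b (D i) t0) < \<epsilon>/3) \<and>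
      (\<forall>i\<in>{..k}. dist (T i t) (T i t0) < \<epsilon>/3) \<and> dist (\<beta> t) 0 < \<epsilon>/3 \<and> (t \<in> I \<and> \<bar>t - t0\<bar> \<le> 1)"
    unfolding eventually_side_at by blast
  show ?thesis
  proof (intro exI[of _ \<delta>] conjI \<delta> ballI)
    fix s assume s: "s \<in> side_nbh b t0 \<delta>"
    then show "s \<in> I" using near by blast
    let ?a = "\<alpha>(1 := \<alpha> 1 + \<beta> s)"
    have a: "taylor ?a t0 (Suc k) i t = T i t + \<beta> s * (if i = 0 then of_real (t - t0) else if i = 1 then 1 else 0)" for i t
      unfolding T_def by (rule taylor_upd) simp
    have small: "norm (\<beta> s * (if i = 0 then of_real (t - t0) else if i = 1 then 1 else 0)) \<le> \<epsilon>/3" if "\<bar>t - t0\<bar> \<le> 1" for i :: nat and t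
    proof -
      have b: "norm (\<beta> s) \<le> \<epsilon>/3" using near s by (auto simp: less_imp_le)
      have n: "norm (if i = 0 then of_real (t - t0) else if i = 1 then 1 else 0 :: complex) \<le> 1"
        using that by (auto simp del: of_real_diff)
      have "norm (\<beta> s * (if i = 0 then of_real (t - t0) else if i = 1 then 1 else 0)) \<le> \<epsilon>/3 * 1"
        unfolding norm_mult by (intro mult_mono b n) (use e3 in auto)
      then show ?thesis by simp
    qed
    show "\<exists>a. taylor a t0 (Suc k) 0 t0 = rep \<phi> t0 \<and> taylor a t0 (Suc k) 0 s = rep \<phi> s \<and>
     (\<forall>i\<le>k. norm (ess_lim b ((gder I ^^ i) \<phi>) t0 - taylor a t0 (Suc k) i t0) \<le> \<epsilon> \<and>
        (\<forall>t\<in>side_nbh b t0 \<delta>. norm (rep ((gder I ^^ i) \<phi>) t - taylor a t0 (Suc k) i t) \<le> \<epsilon>))"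
    proof (intro exI[of _ ?a] conjI allI impI ballI)
      show "taylor ?a t0 (Suc k) 0 t0 = rep \<phi> t0"
        using T_at[of 0] jump_free_rep[OF jf t0, of b] unfolding a D0 by simp
      have "of_real (s - t0) \<noteq> (0::complex)" using side_nbh_not_self[OF s] by (simp del: of_real_diff)
      then have "\<beta> s * of_real (s - t0) = rep \<phi> s - T 0 s" by (simp add: \<beta>_def del: of_real_diff)
      moreover have "taylor ?a t0 (Suc k) 0 s = T 0 s + \<beta> s * of_real (s - t0)" unfolding a by simp
      ultimately show "taylor ?a t0 (Suc k) 0 s = rep \<phi> s" by simp
    next
      fix i assume i: "i \<le> k"
      show "norm (ess_lim b ((gder I ^^ i) \<phi>) t0 - taylor ?a t0 (Suc k) i t0) \<le> \<epsilon>"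
      proof -
        have "ess_lim b ((gder I ^^ i) \<phi>) t0 - taylor ?a t0 (Suc k) i t0 = - (\<beta> s * (if i = 0 then of_real (t0 - t0) else if i = 1 then 1 else 0))"
          unfolding a using T_at[of i] i by (simp add: D_def)
        also have "norm \<dots> \<le> \<epsilon>/3" unfolding norm_minus_cancel by (rule small) simp
        finally show ?thesis using \<epsilon> by simp
      qed
      fix t assume t: "t \<in> side_nbh b t0 \<delta>"
      have nt: "dist (rep (D i) t) (ess_lim b (D i) t0) < \<epsilon>/3" "dist (T i t) (T i t0) < \<epsilon>/3" "\<bar>t - t0\<bar> \<le> 1"
        using near t i by auto
      have "rep (D i) t - taylor ?a t0 (Suc k) i t = (rep (D i) t - ess_lim b (D i) t0) + ((T i t0 - T i t) +
          - (\<beta> s * (if i = 0 then of_real (t - t0) else if i = 1 then 1 else 0)))"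
        unfolding a using T_at[of i] i by simp
      also have "norm \<dots> \<le> \<epsilon>/3 + (\<epsilon>/3 + \<epsilon>/3)"
        by (intro norm_triangle_mono) (use nt small[OF nt(3)] in \<open>auto simp: dist_norm norm_minus_commute less_imp_le\<close>)
      finally show "norm (rep ((gder I ^^ i) \<phi>) t - taylor ?a t0 (Suc k) i t) \<le> \<epsilon>" by (simp add: D_def)
    qed
  qed
qed

text \<open>The chain \<open>E\<close> names the derivatives of an approximant living on [p, q).
  Single pieces jump at their knots; by the last clause they do so exactly as \<phi> cut to [p, q)
  does, hence the jumps at inner knots cancel on gluing.\<close>

definition approx_on :: "(real \<Rightarrow> complex) \<Rightarrow> nat \<Rightarrow> real \<Rightarrow> real \<Rightarrow> real \<Rightarrow> (nat \<Rightarrow> real \<Rightarrow> complex) \<Rightarrow> bool" where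
  "approx_on \<phi> k \<epsilon> p q E \<longleftrightarrow> (\<forall>i. E i \<in> GG I \<and> has_gder I (E i) (E (Suc i))) \<and> E 0 \<in> FF I \<and>
     (\<forall>i t. t < p \<or> q \<le> t \<longrightarrow> E i t = 0) \<and>
     (\<forall>i\<le>k. \<forall>t\<in>I. norm (ind p q t * rep ((gder I ^^ i) \<phi>) t - E i t) \<le> \<epsilon>) \<and>
     jump_free (\<lambda>t. ind p q t * \<phi> t - E 0 t)"

lemma approx_on_trivial: "0 \<le> \<epsilon> \<Longrightarrow> approx_on \<phi> k \<epsilon> p p (\<lambda>_ _. 0)"
proof -
  have "ind p p = (\<lambda>_. 0)" by (auto simp: ind_def)
  then show "0 \<le> \<epsilon> \<Longrightarrow> ?thesis"
    unfolding approx_on_def by (auto simp: GG_const has_gder_const FF_zero jump_free_def)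
qed

text \<open>At each point at most one of the two pieces is active, so the error stays \<epsilon>
  instead of doubling; this permits arbitrarily many subdivisions.\<close>

lemma approx_on_join:
  assumes \<phi>: "\<phi> \<in> Ginf I" and pqr: "p \<le> q" "q \<le> r" and E: "approx_on \<phi> k \<epsilon> p q E" and E': "approx_on \<phi> k \<epsilon> q r E'"
  shows "approx_on \<phi> k \<epsilon> p r (\<lambda>i t. E i t + E' i t)"
  unfolding approx_on_def
proof (intro conjI allI impI ballI)
  have GE: "E i \<in> GG I" "E' i \<in> GG I" "has_gder I (E i) (E (Suc i))" "has_gder I (E' i) (E' (Suc i))" for i
    using E E' by (auto simp: approx_on_def)
  show "(\<lambda>t. E i t + E' i t) \<in> GG I" for i using GE GG_add by blast
  show "has_gder I (\<lambda>t. E i t + E' i t) (\<lambda>t. E (Suc i) t + E' (Suc i) t)" for i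
    using GE has_gder_add by blast
  show "(\<lambda>t. E 0 t + E' 0 t) \<in> FF I" using E E' FF_add by (simp add: approx_on_def)
  show "E i t + E' i t = 0" if "t < p \<or> r \<le> t" for i t
    using that E E' pqr by (auto simp: approx_on_def)
  show "norm (ind p r t * rep ((gder I ^^ i) \<phi>) t - (E i t + E' i t)) \<le> \<epsilon>" if i: "i \<le> k" and t: "t \<in> I" for i t
  proof (cases "t < q")
    case True
    then have "ind p r t = ind p q t" "E' i t = 0" using pqr E' by (auto simp: ind_def approx_on_def)
    then show ?thesis using E i t by (simp add: approx_on_def)
  next
    case False
    then have "ind p r t = ind q r t" "E i t = 0" using pqr E by (auto simp: ind_def approx_on_def)
    then show ?thesis using E' i t by (simp add: approx_on_def)
  qed
  have G\<phi>: "\<phi> \<in> GG I" using Ginf_GG[OF \<phi>] .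
  have GW: "(\<lambda>t. ind x y t * \<phi> t - e t) \<in> GG I" if "e \<in> GG I" for x y e
    using GG_add[OF GG_mult[OF ind_chain(1) G\<phi>] GG_cmult[OF that, of "-1"]] by simp
  have "jump_free (\<lambda>t. 1 * (ind p q t * \<phi> t - E 0 t) + 1 * (ind q r t * \<phi> t - E' 0 t))"
    by (rule jump_free_lin) (use E E' GW GE in \<open>auto simp: approx_on_def\<close>)
  moreover have "1 * (ind p q t * \<phi> t - E 0 t) + 1 * (ind q r t * \<phi> t - E' 0 t) = ind p r t * \<phi> t - (E 0 t + E' 0 t)" for t
    using pqr by (auto simp: ind_def)
  ultimately show "jump_free (\<lambda>t. ind p r t * \<phi> t - (E 0 t + E' 0 t))" by (simp only:)
qed

text \<open>The indicator jumps only at p and q, exactly where the polynomial meets \<phi>, so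
  indicator times difference has no jump.\<close>

lemma approx_on_taylor:
  assumes \<phi>: "\<phi> \<in> Ginf I" and jf: "jump_free \<phi>" and pq: "p \<le> q" "{p..q} \<subseteq> I"
    and T: "taylor a x K 0 p = rep \<phi> p" "taylor a x K 0 q = rep \<phi> q"
    and b: "\<And>i t. i \<le> k \<Longrightarrow> p \<le> t \<Longrightarrow> t < q \<Longrightarrow> norm (rep ((gder I ^^ i) \<phi>) t - taylor a x K i t) \<le> \<epsilon>" and \<epsilon>: "0 \<le> \<epsilon>"
  shows "approx_on \<phi> k \<epsilon> p q (\<lambda>i t. ind p q t * taylor a x K i t)"
  unfolding approx_on_def
proof (intro conjI allI impI ballI)
  show "(\<lambda>t. ind p q t * taylor a x K i t) \<in> GG I"
    "has_gder I (\<lambda>t. ind p q t * taylor a x K i t) (\<lambda>t. ind p q t * taylor a x K (Suc i) t)" for i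
    using ind_smooth_chain[OF taylor_smooth] by blast+
  show "(\<lambda>t. ind p q t * taylor a x K 0 t) \<in> FF I" by (rule taylor_FF[OF pq(1)])
  show "ind p q t * taylor a x K i t = 0" if "t < p \<or> q \<le> t" for i t
    using that by (auto simp: ind_def)
  show "norm (ind p q t * rep ((gder I ^^ i) \<phi>) t - ind p q t * taylor a x K i t) \<le> \<epsilon>" if "i \<le> k" for i t
    using b[OF that, of t] \<epsilon> by (auto simp: ind_def)
  have G\<phi>: "\<phi> \<in> GG I" using Ginf_GG[OF \<phi>] .
  show "jump_free (\<lambda>t. ind p q t * \<phi> t - ind p q t * taylor a x K 0 t)"
    unfolding jump_free_def
  proof
    fix t assume t: "t \<in> I"
    have eq: "ess_lim b' (\<lambda>t. ind p q t * \<phi> t - ind p q t * taylor a x K 0 t) t = ess_lim b' (ind p q) t * (rep \<phi> t - taylor a x K 0 t)" for b'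
    proof -
      have "(taylor a x K 0 \<longlongrightarrow> taylor a x K 0 t) (ess b' t)"
        using taylor_cont tendsto_mono[OF order_trans[OF ess_le side_at_le]] unfolding continuous_within by blast
      then have "((\<lambda>t. ind p q t * \<phi> t - ind p q t * taylor a x K 0 t) \<longlongrightarrow>
          ess_lim b' (ind p q) t * rep \<phi> t - ess_lim b' (ind p q) t * taylor a x K 0 t) (ess b' t)"
        using GG_lim[OF G\<phi> t, of b'] jump_free_rep[OF jf t, of b'] GG_lim[OF ind_chain(1) t]
        by (intro tendsto_diff tendsto_mult) auto
      from ess_lim_eq[OF this] show ?thesis by (simp add: algebra_simps)
    qed
    then show "ess_lim True (\<lambda>t. ind p q t * \<phi> t - ind p q t * taylor a x K 0 t) t =
        ess_lim False (\<lambda>t. ind p q t * \<phi> t - ind p q t * taylor a x K 0 t) t"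
    proof -
      have "rep \<phi> t - taylor a x K 0 t = 0" if "t \<in> {p, q}" using that T by auto
      from jump_free_ind[OF t this] show ?thesis unfolding eq .
    qed
  qed
qed

text \<open>Bisection again: \<open>taylor_one_sided\<close> handles short intervals with one end at
  t0, on either side, and \<open>approx_on_join\<close> glues them. The Taylor estimate may thus
  depend on the point.\<close>

lemma approx_exists:
  assumes \<phi>: "\<phi> \<in> Ginf I" and jf: "jump_free \<phi>" and cd: "c \<le> d" "{c..d} \<subseteq> I" and \<epsilon>: "\<epsilon> > 0"
  shows "\<exists>E. approx_on \<phi> k \<epsilon> c d E"
proof -
  let ?P = "\<lambda>u v. c \<le> u \<and> v \<le> d \<longrightarrow> (\<exists>E. approx_on \<phi> k \<epsilon> u v E)"
  have "?P c d"
  proof (rule Bolzano[where P="?P", OF cd(1)])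
    fix u v w assume *: "?P u v" "?P v w" "u \<le> v" "v \<le> w"
    show "?P u w"
    proof
      assume "c \<le> u \<and> w \<le> d"
      then obtain E E' where "approx_on \<phi> k \<epsilon> u v E" "approx_on \<phi> k \<epsilon> v w E'" using * by auto
      from approx_on_join[OF \<phi> *(3,4) this] show "\<exists>E. approx_on \<phi> k \<epsilon> u w E" by blast
    qed
  next
    fix t0 assume t0: "c \<le> t0" "t0 \<le> d"
    then have t0I: "t0 \<in> I" using cd by auto
    obtain d1 where d1: "d1 > 0" "\<forall>s\<in>side_nbh True t0 d1. s \<in> I \<and> (\<exists>a. taylor a t0 (Suc k) 0 t0 = rep \<phi> t0 \<and> taylor a t0 (Suc k) 0 s = rep \<phi> s \<and>
     (\<forall>i\<le>k. norm (ess_lim True ((gder I ^^ i) \<phi>) t0 - taylor a t0 (Suc k) i t0) \<le> \<epsilon> \<and>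
        (\<forall>t\<in>side_nbh True t0 d1. norm (rep ((gder I ^^ i) \<phi>) t - taylor a t0 (Suc k) i t) \<le> \<epsilon>)))"
      using taylor_one_sided[OF \<phi> jf t0I \<epsilon>, of True k] by blast
    obtain d2 where d2: "d2 > 0" "\<forall>s\<in>side_nbh False t0 d2. s \<in> I \<and> (\<exists>a. taylor a t0 (Suc k) 0 t0 = rep \<phi> t0 \<and> taylor a t0 (Suc k) 0 s = rep \<phi> s \<and>
     (\<forall>i\<le>k. norm (ess_lim False ((gder I ^^ i) \<phi>) t0 - taylor a t0 (Suc k) i t0) \<le> \<epsilon> \<and>
        (\<forall>t\<in>side_nbh False t0 d2. norm (rep ((gder I ^^ i) \<phi>) t - taylor a t0 (Suc k) i t) \<le> \<epsilon>)))"
      using taylor_one_sided[OF \<phi> jf t0I \<epsilon>, of False k] by blast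
    have R: "\<exists>E. approx_on \<phi> k \<epsilon> t0 v E" if v: "t0 \<le> v" "v < t0 + d1" for v
    proof (cases "v = t0")
      case True then show ?thesis using approx_on_trivial \<epsilon> less_imp_le by blast
    next
      case False
      then have vn: "v \<in> side_nbh True t0 d1" using v by (simp add: side_nbh_def)
      then obtain a where vI: "v \<in> I" and a: "taylor a t0 (Suc k) 0 t0 = rep \<phi> t0" "taylor a t0 (Suc k) 0 v = rep \<phi> v"
        "\<forall>i\<le>k. norm (ess_lim True ((gder I ^^ i) \<phi>) t0 - taylor a t0 (Suc k) i t0) \<le> \<epsilon> \<and>
        (\<forall>t\<in>side_nbh True t0 d1. norm (rep ((gder I ^^ i) \<phi>) t - taylor a t0 (Suc k) i t) \<le> \<epsilon>)"
        using d1(2) by blast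
      have "norm (rep ((gder I ^^ i) \<phi>) t - taylor a t0 (Suc k) i t) \<le> \<epsilon>" if i: "i \<le> k" and t: "t0 \<le> t" "t < v" for i t
      \<comment> \<open>The left knot belongs to the half-open interval, and \<open>rep\<close>
        takes the right limit there; the estimate at t0 itself in \<open>taylor_one_sided\<close>
        serves this point.\<close>
      proof (cases "t = t0")
        case True then show ?thesis using a(3) i rep_in[OF t0I] by simp
      next
        case False
        then have "t \<in> side_nbh True t0 d1" using t v by (simp add: side_nbh_def)
        then show ?thesis using a(3) i by blast
      qed
      from approx_on_taylor[OF \<phi> jf v(1) Icc_I[OF t0I vI] a(1,2) this] \<epsilon> show ?thesis by auto
    qed
    have L: "\<exists>E. approx_on \<phi> k \<epsilon> u t0 E" if u: "u \<le> t0" "t0 - d2 < u" for u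
    proof (cases "u = t0")
      case True then show ?thesis using approx_on_trivial \<epsilon> less_imp_le by blast
    next
      case False
      then have un: "u \<in> side_nbh False t0 d2" using u by (simp add: side_nbh_def)
      then obtain a where uI: "u \<in> I" and a: "taylor a t0 (Suc k) 0 t0 = rep \<phi> t0" "taylor a t0 (Suc k) 0 u = rep \<phi> u"
        "\<forall>i\<le>k. norm (ess_lim False ((gder I ^^ i) \<phi>) t0 - taylor a t0 (Suc k) i t0) \<le> \<epsilon> \<and>
        (\<forall>t\<in>side_nbh False t0 d2. norm (rep ((gder I ^^ i) \<phi>) t - taylor a t0 (Suc k) i t) \<le> \<epsilon>)"
        using d2(2) by blast
      have "norm (rep ((gder I ^^ i) \<phi>) t - taylor a t0 (Suc k) i t) \<le> \<epsilon>" if i: "i \<le> k" and t: "u \<le> t" "t < t0" for i t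
      proof -
        have "t \<in> side_nbh False t0 d2" using t u by (simp add: side_nbh_def)
        then show ?thesis using a(3) i by blast
      qed
      from approx_on_taylor[OF \<phi> jf u(1) Icc_I[OF uI t0I] a(2,1) this] \<epsilon> show ?thesis by auto
    qed
    show "\<exists>d'>0. \<forall>u v. u \<le> t0 \<and> t0 \<le> v \<and> v - u < d' \<longrightarrow> ?P u v"
    proof (intro exI[of _ "min d1 d2"] conjI allI impI)
      fix u v assume uv: "u \<le> t0 \<and> t0 \<le> v \<and> v - u < min d1 d2"
      obtain E where E: "approx_on \<phi> k \<epsilon> u t0 E" using L[of u] uv by auto
      obtain E' where E': "approx_on \<phi> k \<epsilon> t0 v E'" using R[of v] uv by auto
      from approx_on_join[OF \<phi> _ _ E E'] uv show "\<exists>E. approx_on \<phi> k \<epsilon> u v E" by blast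
    qed (use d1 d2 in auto)
  qed
  then show ?thesis by simp
qed

lemma gnorm_le_chain:
  assumes "\<And>i. W i \<in> GG I" "\<And>i. has_gder I (W i) (W (Suc i))" "\<And>i t. i \<le> k \<Longrightarrow> t \<in> I \<Longrightarrow> norm (W i t) \<le> C"
  shows "gnorm_le k C (W 0)"
proof -
  have "gnorm_le k C (W j)" if "\<forall>i\<le>k. \<forall>t\<in>I. norm (W (i + j) t) \<le> C" for j
    using that
  proof (induction k arbitrary: j)
    case 0
    have "AE t in lebesgue_on I. norm (W j t) \<le> C" using AE_space by eventually_elim (use 0 in simp)
    then show ?case using assms(1) by simp
  next
    case (Suc k)
    have j: "\<forall>t\<in>I. norm (W j t) \<le> C" using Suc.prems by (metis add_0 le0)
    have "AE t in lebesgue_on I. norm (W j t) \<le> C" using AE_space by eventually_elim (use j in simp)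
    moreover have "gnorm_le k C (W (Suc j))" by (rule Suc.IH) (use Suc.prems in \<open>metis Suc_le_mono add_Suc add_Suc_right\<close>)
    ultimately show ?case using assms(1,2) unfolding gnorm_le.simps by blast
  qed
  from this[of 0] show ?thesis using assms(3) by simp
qed

section \<open>Characterization of \<open>Delta\<close> by jump-free test functions\<close>

lemma jump_ess_lim: "jump \<phi> t = ess_lim True \<phi> t - ess_lim False \<phi> t"
  by (simp add: jump_def rlim_ess_lim llim_ess_lim)

lemma Delta_jump_free:
  assumes f: "f \<in> Delta I" and \<phi>: "\<phi> \<in> test I" and jf: "jump_free \<phi>"
  shows "f \<phi> = 0"
proof -
  have fd: "f \<in> dist_space I" using f by (simp add: Delta_def)
  obtain cc where cc: "\<forall>\<phi> \<in> test I \<inter> FF I. f \<phi> = (\<Sum>t | t \<in> I \<and> jump \<phi> t \<noteq> 0. cc t * jump \<phi> t)"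
    using f unfolding Delta_def by blast
  obtain c d where cd: "c \<le> d" "{c..d} \<subseteq> I" "\<phi> \<in> test_on I {c..d}" using testE[OF \<phi>] by metis
  have \<phi>G: "\<phi> \<in> Ginf I" using \<phi> test_Ginf by blast
  obtain k C where C: "C \<ge> 0" "\<forall>\<phi>\<in>test_on I {c..d}. \<forall>M. gnorm_le k M \<phi> \<longrightarrow> norm (f \<phi>) \<le> C * M"
    using dist_bound[OF fd cd(1,2)] by blast
  have *: "norm (f \<phi>) \<le> C * \<epsilon>" if \<epsilon>: "\<epsilon> > 0" for \<epsilon>
  proof -
    \<comment> \<open>The order k is the one from the continuity bound of \<open>f\<close> on
      \<open>{c..d}\<close>, so closeness in that single norm is enough.\<close>
    obtain E where E: "approx_on \<phi> k \<epsilon> c d E" using approx_exists[OF \<phi>G jf cd(1,2) \<epsilon>] by blast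
    have GE: "E i \<in> GG I" "has_gder I (E i) (E (Suc i))" for i using E by (auto simp: approx_on_def)
    define D where "D i = rep ((gder I ^^ i) \<phi>)" for i
    have GD: "D i \<in> GG I" "has_gder I (D i) (D (Suc i))" for i
    proof -
      show "D i \<in> GG I" using rep_GG[OF gder_pow_GG[OF \<phi>G]] by (simp add: D_def)
      show "has_gder I (D i) (D (Suc i))"
        unfolding D_def by (rule has_gder_ae_eq[OF gder_pow_has_gder[OF \<phi>G] rep_ae rep_ae]) (rule gder_pow_GG[OF \<phi>G])+
    qed
    define W where "W i t = ind c d t * D i t + (-1) * E i t" for i t
    have GW: "W i \<in> GG I" "has_gder I (W i) (W (Suc i))" for i
    proof -
      have "(\<lambda>t. ind c d t * D i t + (-1) * E i t) \<in> GG I"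
        by (intro GG_add GG_mult GG_const ind_chain GD GE)
      then show "W i \<in> GG I" by (simp add: W_def[abs_def])
      have "has_gder I (\<lambda>t. ind c d t * D i t + (-1) * E i t) (\<lambda>t. ind c d t * D (Suc i) t + (-1) * E (Suc i) t)"
        by (intro has_gder_add has_gder_ind has_gder_cmult GG_mult GG_cmult ind_chain GD GE)
      then show "has_gder I (W i) (W (Suc i))" by (simp add: W_def[abs_def])
    qed
    have "norm (W i t) \<le> \<epsilon>" if "i \<le> k" "t \<in> I" for i t
      using E that unfolding approx_on_def W_def D_def by simp
    from gnorm_le_chain[of W, OF GW this] have GBW: "gnorm_le k \<epsilon> (W 0)" .
    have WG: "W 0 \<in> Ginf I" using Ginf_chain GW by blast
    have EG: "E 0 \<in> Ginf I" using Ginf_chain GE by blast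
    have E_on: "E 0 \<in> test_on I {c..d}"
      unfolding test_on_def
    proof (intro CollectI conjI EG)
      show "AE t in lebesgue_on I. t \<notin> {c..d} \<longrightarrow> E 0 t = 0"
        by (rule AE_I2) (use E in \<open>auto simp: approx_on_def not_le\<close>)
    qed
    \<comment> \<open>\<open>ind c d\<close> is 0 at d, whereas \<phi> need not be; the point is
      null.\<close>
    have nd: "AE t in lebesgue_on I. t \<noteq> d"
    proof -
      have "{d} \<in> null_sets lebesgue" using negligible_sing negligible_iff_null_sets by blast
      then have "AE t in lebesgue. t \<noteq> d" using AE_not_in[of "{d}" lebesgue] by simp
      then show ?thesis unfolding AE_I by eventually_elim simp
    qed
    have "AE t in lebesgue_on I. \<phi> t = D 0 t" using rep_ae[OF Ginf_GG[OF \<phi>G]] by (simp add: ae_eq_def D_def)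
    moreover have "AE t in lebesgue_on I. t \<notin> {c..d} \<longrightarrow> \<phi> t = 0" using cd(3) by (simp add: test_on_def)
    ultimately have "AE t in lebesgue_on I. \<phi> t = W 0 t + E 0 t"
      using nd by eventually_elim (auto simp: W_def ind_def)
    then have ae: "ae_eq I \<phi> (\<lambda>t. W 0 t + E 0 t)" by (simp add: ae_eq_def)
    have W_on: "W 0 \<in> test_on I {c..d}"
    proof -
      have "AE t in lebesgue_on I. t \<notin> {c..d} \<longrightarrow> W 0 t = 0"
        by (rule AE_I2) (use E in \<open>auto simp: approx_on_def W_def ind_def not_le\<close>)
      then show ?thesis using WG by (simp add: test_on_def)
    qed
    have Et: "E 0 \<in> test I" and Wt: "W 0 \<in> test I" using test_onI[OF cd(2)] E_on W_on by blast+
    have jW: "jump_free (W 0)"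
    proof -
      have "AE t in lebesgue_on I. ind c d t * \<phi> t - E 0 t = W 0 t"
        using rep_ae[OF Ginf_GG[OF \<phi>G], unfolded ae_eq_def] by eventually_elim (simp add: W_def D_def)
      then show ?thesis using E jump_free_ae_eq unfolding approx_on_def ae_eq_def by blast
    qed
    have jE: "jump_free (E 0)"
    proof -
      have "jump_free (\<lambda>t. 1 * \<phi> t + (-1) * W 0 t)"
        by (rule jump_free_lin[OF Ginf_GG[OF \<phi>G] GW(1) jf jW])
      moreover have "ae_eq I (\<lambda>t. 1 * \<phi> t + (-1) * W 0 t) (E 0)"
        using ae unfolding ae_eq_def by eventually_elim simp
      ultimately show ?thesis by (rule jump_free_ae_eq)
    qed
    \<comment> \<open>With \<phi> and \<open>W 0\<close>, also \<open>E 0\<close> is jump-free;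
      lying in \<open>FF I\<close> it is covered by the formula for \<open>f\<close>, whose sum is
      empty.\<close>
    have "{t. t \<in> I \<and> jump (E 0) t \<noteq> 0} = {}" using jE by (auto simp: jump_free_def jump_ess_lim)
    moreover have "E 0 \<in> FF I" using E by (simp add: approx_on_def)
    ultimately have "f (E 0) = 0" using cc Et by simp
    then have "f \<phi> = f (W 0)" using dist_ae[OF fd \<phi> ae] dist_add[OF fd Wt Et] by simp
    then show ?thesis using C(2) W_on GBW by simp
  qed
  have "norm (f \<phi>) \<le> 0"
  proof (rule field_le_epsilon)
    fix e :: real assume e: "e > 0"
    have "norm (f \<phi>) \<le> C * (e / (C + 1))" using *[of "e / (C + 1)"] e C(1) by simp
    also have "\<dots> \<le> e" using e C(1) by (simp add: field_simps)
    finally show "norm (f \<phi>) \<le> 0 + e" by simp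
  qed
  then show ?thesis by simp
qed

text \<open>A sawtooth: it jumps from 0 to 1 at t and descends linearly to 0 at r, so that the cut
  at r makes no jump.\<close>

lemma unit_jump:
  assumes t: "t \<in> I"
  shows "\<exists>e\<in>test I. \<forall>s\<in>I. jump e s = (if s = t then 1 else 0)"
proof -
  obtain r where r: "r > t" "{t..r} \<subseteq> I"
  proof -
    obtain e where e: "e > 0" "ball t e \<subseteq> I" using t open_I open_contains_ball by blast
    then have "{t..t + e/2} \<subseteq> I" by (auto simp: dist_real_def subset_iff)
    with e show ?thesis using that[of "t + e/2"] by simp
  qed
  define a :: "nat \<Rightarrow> complex" where "a l = (if l = 0 then 1 else - 1 / of_real (r - t))" for l
  define T where "T = taylor a t 1"
  have T: "T 0 s = 1 - of_real ((s - t) / (r - t))" for s by (simp add: T_def taylor_def a_def)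
  have Tt: "T 0 t = 1" "T 0 r = 0" using r by (auto simp: T simp del: of_real_divide of_real_diff)
  define e where "e s = ind t r s * T 0 s" for s
  have eG: "e \<in> Ginf I" using ind_smooth_Ginf[OF taylor_smooth, of t r a t 1] by (simp add: e_def[abs_def] T_def)
  have "e \<in> test_on I {t..r}"
    unfolding test_on_def
  proof (intro CollectI conjI eG)
    show "AE s in lebesgue_on I. s \<notin> {t..r} \<longrightarrow> e s = 0"
      by (rule AE_I2) (auto simp: e_def ind_def)
  qed
  then have et: "e \<in> test I" by (rule test_onI[OF r(2)])
  have ess_lim: "ess_lim b e s = ess_lim b (ind t r) s * T 0 s" if s: "s \<in> I" for b s
  proof -
    have "(T 0 \<longlongrightarrow> T 0 s) (ess b s)"
      using taylor_cont tendsto_mono[OF order_trans[OF ess_le side_at_le]] unfolding T_def continuous_within by blast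
    then have "(e \<longlongrightarrow> ess_lim b (ind t r) s * T 0 s) (ess b s)"
      unfolding e_def[abs_def] by (intro tendsto_mult GG_lim ind_chain s)
    then show ?thesis by (rule ess_lim_eq)
  qed
  have i1: "ess_lim True (ind t r) t = 1" 
  proof -
    have "eventually (\<lambda>s. ind t r s = 1) (ess True t)"
      unfolding eventually_ess by (intro exI[of _ "r - t"] conjI AE_I2) (use r in \<open>auto simp: side_nbh_def ind_def\<close>)
    from ess_lim_cong[OF this] show ?thesis by simp
  qed
  have i0: "ess_lim False (ind t r) t = 0"
  proof -
    have "eventually (\<lambda>s. ind t r s = 0) (ess False t)"
      unfolding eventually_ess by (intro exI[of _ 1] conjI AE_I2) (auto simp: side_nbh_def ind_def)
    from ess_lim_cong[OF this] show ?thesis by simp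
  qed
  have "jump e s = (if s = t then 1 else 0)" if s: "s \<in> I" for s
  proof (cases "s = t")
    case True then show ?thesis using ess_lim[OF s] i1 i0 Tt by (simp add: jump_ess_lim)
  next
    case False
    then show ?thesis using ess_lim[OF s] jump_free_ind[OF s, of r r "T 0 s"] ind_ess_lim[of s t r] Tt(2)
      by (cases "s = r") (auto simp: jump_ess_lim)
  qed
  with et show ?thesis by blast
qed

text \<open>The coefficient at t is taken to be the value of \<open>f\<close> on a test function
  with a single unit jump at t. Subtracting the finitely many jumps of \<phi> by such functions
  leaves a jump-free remainder, which \<open>f\<close> annihilates.\<close>

lemma DeltaI:
  assumes fd: "f \<in> dist_space I" and z: "\<And>\<phi>. \<phi> \<in> test I \<Longrightarrow> jump_free \<phi> \<Longrightarrow> f \<phi> = 0"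
  shows "f \<in> Delta I"
proof -
  obtain e where e: "\<And>t. t \<in> I \<Longrightarrow> e t \<in> test I" "\<And>t s. t \<in> I \<Longrightarrow> s \<in> I \<Longrightarrow> jump (e t) s = (if s = t then 1 else 0)"
    using unit_jump by metis
  have "f \<phi> = (\<Sum>t | t \<in> I \<and> jump \<phi> t \<noteq> 0. f (e t) * jump \<phi> t)" if \<phi>: "\<phi> \<in> test I" "\<phi> \<in> FF I" for \<phi>
  proof -
    define J where "J = {t. t \<in> I \<and> jump \<phi> t \<noteq> 0}"
    have fin: "finite J" using finite_jumps_FF[OF \<phi>] by (simp add: J_def jump_ess_lim)
    have JI: "J \<subseteq> I" by (auto simp: J_def)
    define S where "S = (\<lambda>s. \<Sum>t\<in>J. jump \<phi> t * e t s)"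
    have St: "S \<in> test I" unfolding S_def by (intro test_sum test_cmult e) (use JI in blast)
    have GS: "S \<in> GG I" "\<phi> \<in> GG I" using St \<phi> test_Ginf Ginf_GG by blast+
    have Ge: "e t \<in> GG I" if "t \<in> J" for t using e(1) that JI test_Ginf Ginf_GG by blast
    have jS: "jump S s = jump \<phi> s" if s: "s \<in> I" for s
    proof -
      have l: "ess_lim b S s = (\<Sum>t\<in>J. jump \<phi> t * ess_lim b (e t) s)" for b
      proof -
        have "ess_lim b S s = (\<Sum>t\<in>J. ess_lim b (\<lambda>s. jump \<phi> t * e t s) s)"
          unfolding S_def by (rule ess_lim_sum) (use Ge GG_cmult s in auto)
        also have "\<dots> = (\<Sum>t\<in>J. jump \<phi> t * ess_lim b (e t) s)" by (intro sum.cong ess_lim_cmult Ge s refl)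
        finally show ?thesis .
      qed
      have "jump S s = (\<Sum>t\<in>J. jump \<phi> t * jump (e t) s)"
        unfolding jump_ess_lim[of S] l by (simp add: sum_subtractf[symmetric] jump_ess_lim[of "e _"] right_diff_distrib)
      also have "\<dots> = (\<Sum>t\<in>J. if s = t then jump \<phi> t else 0)"
        by (intro sum.cong) (use e(2) s JI in auto)
      also have "\<dots> = jump \<phi> s" using fin s by (simp add: sum.delta' J_def)
      finally show ?thesis .
    qed
    have "jump_free (\<lambda>t. \<phi> t - S t)"
      unfolding jump_free_def
    proof
      fix t assume t: "t \<in> I"
      have eq: "ess_lim b (\<lambda>t. \<phi> t - S t) t = ess_lim b \<phi> t - ess_lim b S t" for b
        by (intro ess_lim_eq tendsto_diff GG_lim GS t)
      then show "ess_lim True (\<lambda>t. \<phi> t - S t) t = ess_lim False (\<lambda>t. \<phi> t - S t) t"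
        using jS[OF t] unfolding eq by (simp add: jump_ess_lim algebra_simps)
    qed
    moreover have "(\<lambda>t. \<phi> t - S t) \<in> test I" using test_lin[OF \<phi>(1) St, of 1 "-1"] by simp
    ultimately have "f (\<lambda>t. \<phi> t - S t) = 0" by (rule z[rotated])
    then have "f \<phi> = f S" using dist_diff[OF fd \<phi>(1) St] by simp
    also have "\<dots> = (\<Sum>t\<in>J. f (\<lambda>s. jump \<phi> t * e t s))"
      unfolding S_def by (rule dist_sum[OF fd]) (use test_cmult e JI in blast)
    also have "\<dots> = (\<Sum>t\<in>J. f (e t) * jump \<phi> t)"
      by (intro sum.cong) (use dist_cmult[OF fd] e JI in \<open>auto simp: mult.commute\<close>)
    finally show ?thesis by (simp add: J_def)
  qed
  then show ?thesis
    unfolding Delta_def by (intro CollectI conjI fd exI[of _ "\<lambda>t. f (e t)"] ballI) auto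
qed

end

subsection \<open>The adjoint equation on test functions\<close>

context ival begin

lemma step_Ginf: "step p \<in> Ginf I"
proof -
  define F :: "nat \<Rightarrow> real \<Rightarrow> complex" where "F k = (if k = 0 then step p else (\<lambda>_. 0))" for k
  have "step p \<in> borel_measurable borel" unfolding step_def by measurable
  then have "F k \<in> borel_measurable (lebesgue_on I)" for k
    by (auto simp: F_def intro: borel_I)
  moreover have "\<exists>B. \<forall>t\<in>I. norm (F k t) \<le> B" for k
    by (intro exI[of _ 1]) (auto simp: F_def step_def)
  moreover have "\<exists>H d. d > 0 \<and> smooth_chain H \<and> (\<forall>k. \<forall>s\<in>side_nbh b t d. F k s = H k s)" for b t
  proof -
    obtain d where d: "d > 0" "\<forall>s\<in>side_nbh b t d. (p \<le> s \<longleftrightarrow> (if b then p \<le> t else p < t))"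
      using side_local_const by blast
    let ?c = "if (if b then p \<le> t else p < t) then 1 else 0"
    show ?thesis
      by (rule exI[of _ "\<lambda>k. if k = 0 then (\<lambda>_. ?c) else (\<lambda>_. 0)"], rule exI[of _ d])
         (use d in \<open>auto simp: F_def step_def smooth_chain_0\<close>)
  qed
  ultimately have "F k \<in> GG I" "has_gder I (F k) (F (Suc k))" for k
    using piecewise_smooth[of F k] by blast+
  then have "F 0 \<in> Ginf I" using Ginf_chain by blast
  then show ?thesis by (simp add: F_def)
qed

definition ramp :: "real \<Rightarrow> real \<Rightarrow> real \<Rightarrow> complex" where
  "ramp p q t = of_real (max 0 (min 1 ((t - p) / (q - p))))"

lemma ramp_isCont: "isCont (ramp p q) t"
  unfolding ramp_def divide_inverse by (intro continuous_intros)

lemma ramp_Ginf: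
  assumes "p < q" shows "ramp p q \<in> Ginf I"
proof -
  define a :: "nat \<Rightarrow> complex" where "a l = (if l = 0 then 0 else 1 / of_real (q - p))" for l
  have T: "taylor a p 1 0 t = of_real ((t - p) / (q - p))" for t by (simp add: taylor_def a_def)
  have "ramp p q t = ind p q t * taylor a p 1 0 t + step q t" for t
    using assms unfolding ramp_def T by (auto simp: ind_def step_def max_def min_def field_simps simp del: of_real_divide of_real_diff)
  moreover have "(\<lambda>t. ind p q t * taylor a p 1 0 t + step q t) \<in> Ginf I"
    by (intro Ginf_add ind_smooth_Ginf[OF taylor_smooth] step_Ginf)
  moreover from calculation(1) have "ramp p q = (\<lambda>t. ind p q t * taylor a p 1 0 t + step q t)" by (rule ext)
  ultimately show ?thesis by (simp only:)
qed

lemma gder_lin: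
  assumes "f \<in> Ginf I" "g \<in> Ginf I"
  shows "ae_eq I (gder I (\<lambda>t. \<alpha> * f t + \<beta> * g t)) (\<lambda>t. \<alpha> * gder I f t + \<beta> * gder I g t)"
  by (rule gder_ae_eq) (intro has_gder_add has_gder_cmult GG_cmult Ginf_GG Ginf_gder assms)

definition zero_after :: "real \<Rightarrow> (real \<Rightarrow> complex) \<Rightarrow> bool" where
  "zero_after s g \<longleftrightarrow> (\<forall>t\<in>I. s < t \<longrightarrow> (\<forall>b. ess_lim b g t = 0))"

text \<open>The support is a closure, so the strict gap between s and t0 is what places it inside t
  < t0.\<close>

lemma vanishes_zero_after:
  assumes f: "vanishes_before I t0 f" and \<phi>: "\<phi> \<in> test I" and z: "zero_after s \<phi>" "s < t0"
  shows "f \<phi> = 0"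
proof -
  have "{t \<in> I. \<exists>b. ess_lim b \<phi> t \<noteq> 0} \<subseteq> {..s}"
  proof
    fix t assume "t \<in> {t \<in> I. \<exists>b. ess_lim b \<phi> t \<noteq> 0}"
    then have "\<not> s < t" using z(1) unfolding zero_after_def by blast
    then show "t \<in> {..s}" by simp
  qed
  then have "closure {t \<in> I. \<exists>b. ess_lim b \<phi> t \<noteq> 0} \<subseteq> {..s}" by (rule closure_minimal) simp
  then have "supp I \<phi> \<subseteq> {t \<in> I. t < t0}" unfolding supp_iff using z(2) by auto
  then show ?thesis using f \<phi> unfolding vanishes_before_def by blast
qed

text \<open>A compact support left of t0 has a largest point, hence a gap before t0 remains. The
  empty support is treated separately, with s = t2.\<close>

lemma supp_zero_after:
  assumes \<phi>: "\<phi> \<in> test I" and s: "supp I \<phi> \<subseteq> {t \<in> I. t < t0}" and "t2 < t0"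
  shows "\<exists>s. t2 \<le> s \<and> s < t0 \<and> zero_after s \<phi>"
proof -
  have K: "compact (supp I \<phi>)" using \<phi> by (simp add: test_def)
  have mem: "t \<in> supp I \<phi>" if "t \<in> I" "ess_lim b \<phi> t \<noteq> 0" for t b
  proof -
    have "t \<in> {t \<in> I. \<exists>b. ess_lim b \<phi> t \<noteq> 0}" using that by blast
    then show ?thesis using closure_subset[of "{t \<in> I. \<exists>b. ess_lim b \<phi> t \<noteq> 0}"] that(1)
      unfolding supp_iff by (meson IntI subsetD)
  qed
  show ?thesis
  proof (cases "supp I \<phi> = {}")
    case True
    then have "zero_after t2 \<phi>" unfolding zero_after_def using mem by blast
    then show ?thesis using assms(3) by blast
  next
    case False
    obtain m where m: "m \<in> supp I \<phi>" "\<forall>t\<in>supp I \<phi>. t \<le> m" using compact_attains_sup[OF K False] by blast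
    have "zero_after (max t2 m) \<phi>"
      unfolding zero_after_def
    proof (intro ballI impI allI)
      fix t b assume t: "t \<in> I" "max t2 m < t"
      show "ess_lim b \<phi> t = 0"
      proof (rule ccontr)
        assume "ess_lim b \<phi> t \<noteq> 0"
        then have "t \<le> m" using mem t(1) m(2) by blast
        with t(2) show False by simp
      qed
    qed
    moreover have "m < t0" using m(1) s by auto
    ultimately show ?thesis using assms(3) by (intro exI[of _ "max t2 m"]) auto
  qed
qed

end

text \<open>Between t1 and t2 there is room for a continuous cut-off to rise from 0 to 1 strictly
  before t0, where functionals that vanish before t0 cannot see it.\<close>

locale linear_problem = ival +
  fixes A :: "(real \<Rightarrow> complex)^'n^'n" and t0 t1 t2 :: real
  assumes A: "\<And>i j. A $ i $ j \<in> Ginf I"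
    and t012: "t1 < t2" "t2 < t0" "{t1..t0} \<subseteq> I"
begin

text \<open>The index order \<open>A $ j $ i\<close> is that of the transpose, as in the formal
  adjoint of x' - A x.\<close>

definition defect :: "('n \<Rightarrow> real \<Rightarrow> complex) \<Rightarrow> ('n \<Rightarrow> real \<Rightarrow> complex) \<Rightarrow> 'n \<Rightarrow> real \<Rightarrow> complex" where
  "defect \<psi> w i = (\<lambda>t. \<psi> i t + (gder I (w i) t + (\<Sum>j\<in>UNIV. (A $ j $ i) t * w j t)))"

text \<open>\<open>w\<close> solves \<open>\<psi> + w' + A\<^sup>T w = 0\<close> on \<open>{t. s < t}\<close>. To the left of \<open>s\<close> it is arbitrary, which does not matter
  for functionals that vanish before some \<open>t0 > s\<close>.\<close>

definition adjoint_after :: "real \<Rightarrow> ('n \<Rightarrow> real \<Rightarrow> complex) \<Rightarrow> ('n \<Rightarrow> real \<Rightarrow> complex) \<Rightarrow> bool" where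
  "adjoint_after s \<psi> w \<longleftrightarrow> (\<forall>i. w i \<in> test I \<and> jump_free (w i) \<and> zero_after s (defect \<psi> w i))"

lemma adjoint_after_mono: "adjoint_after s \<psi> w \<Longrightarrow> s \<le> s' \<Longrightarrow> adjoint_after s' \<psi> w"
  by (auto simp: adjoint_after_def zero_after_def)

lemma ess_lim_defect:
  assumes "\<And>i. \<psi> i \<in> test I" "\<And>i. w i \<in> test I" "t \<in> I"
  shows "ess_lim b (defect \<psi> w i) t = ess_lim b (\<psi> i) t + (ess_lim b (gder I (w i)) t + (\<Sum>j\<in>UNIV. ess_lim b (A $ j $ i) t * ess_lim b (w j) t))"
proof -
  have G: "\<psi> i \<in> GG I" "w j \<in> GG I" "gder I (w i) \<in> GG I" "A $ j $ i \<in> GG I" for i j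
    using assms A Ginf_GG test_Ginf gder_Ginf by blast+
  show ?thesis unfolding defect_def
    by (intro ess_lim_eq tendsto_add tendsto_sum tendsto_mult GG_lim G assms(3))
qed

lemma defect_test:
  assumes "\<And>i. \<psi> i \<in> test I" "\<And>i. w i \<in> test I"
  shows "defect \<psi> w i \<in> test I"
  unfolding defect_def by (intro test_add test_sum test_gder test_mult assms A)

lemma adjoint_after_lin:
  assumes \<psi>: "\<And>i. \<psi> i \<in> test I" "\<And>i. \<psi>' i \<in> test I" and w: "adjoint_after s \<psi> w" "adjoint_after s \<psi>' w'"
  shows "adjoint_after s (\<lambda>i t. \<alpha> * \<psi> i t + \<beta> * \<psi>' i t) (\<lambda>i t. \<alpha> * w i t + \<beta> * w' i t)"
  unfolding adjoint_after_def
proof (intro allI conjI)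
  have wt: "w i \<in> test I" "w' i \<in> test I" for i using w by (auto simp: adjoint_after_def)
  have G: "w i \<in> GG I" "w' i \<in> GG I" "\<psi> i \<in> GG I" "\<psi>' i \<in> GG I" "gder I (w i) \<in> GG I" "gder I (w' i) \<in> GG I" for i
    using wt \<psi> test_Ginf Ginf_GG gder_Ginf by blast+
  fix i
  show "(\<lambda>t. \<alpha> * w i t + \<beta> * w' i t) \<in> test I" by (intro test_lin wt)
  show "jump_free (\<lambda>t. \<alpha> * w i t + \<beta> * w' i t)" using w by (intro jump_free_lin G) (auto simp: adjoint_after_def)
  show "zero_after s (defect (\<lambda>i t. \<alpha> * \<psi> i t + \<beta> * \<psi>' i t) (\<lambda>i t. \<alpha> * w i t + \<beta> * w' i t) i)"
    unfolding zero_after_def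
  proof (intro ballI impI allI)
    fix t b assume t: "t \<in> I" "s < t"
    have 0: "ess_lim b (defect \<psi> w i) t = 0" "ess_lim b (defect \<psi>' w' i) t = 0"
      using w t by (auto simp: adjoint_after_def zero_after_def)
    have g: "ess_lim b (gder I (\<lambda>t. \<alpha> * w i t + \<beta> * w' i t)) t = \<alpha> * ess_lim b (gder I (w i)) t + \<beta> * ess_lim b (gder I (w' i)) t"
      using ae_eq_ess_lim[OF gder_lin[OF test_Ginf[OF wt(1)] test_Ginf[OF wt(2)]] t(1)] G t(1)
      by (simp add: ess_lim_add ess_lim_cmult GG_cmult)
    have l: "ess_lim b (\<lambda>t. \<alpha> * f t + \<beta> * g t) t = \<alpha> * ess_lim b f t + \<beta> * ess_lim b g t" if "f \<in> GG I" "g \<in> GG I" for f g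
      using that t(1) by (simp add: ess_lim_add ess_lim_cmult GG_cmult)
    have "ess_lim b (defect (\<lambda>i t. \<alpha> * \<psi> i t + \<beta> * \<psi>' i t) (\<lambda>i t. \<alpha> * w i t + \<beta> * w' i t) i) t =
       \<alpha> * ess_lim b (defect \<psi> w i) t + \<beta> * ess_lim b (defect \<psi>' w' i) t"
      by (subst (1 2 3) ess_lim_defect)
        (use \<psi> wt test_lin t in \<open>auto simp: g l G algebra_simps sum.distrib sum_distrib_left\<close>)
    then show "ess_lim b (defect (\<lambda>i t. \<alpha> * \<psi> i t + \<beta> * \<psi>' i t) (\<lambda>i t. \<alpha> * w i t + \<beta> * w' i t) i) t = 0"
      using 0 by simp
  qed
qed

section \<open>Uniqueness for the adjoint system\<close>

lemma A_bound: "\<exists>M\<ge>0. \<forall>i j t. norm (rep (A $ i $ j) t) \<le> M"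
proof -
  have "\<exists>C\<ge>0. \<forall>t. norm (rep (A $ i $ j) t) \<le> C" for i j
    using GG_bound[OF Ginf_GG[OF A]] rep_norm_le[OF Ginf_GG[OF A]] by blast
  then obtain C where C: "\<And>i j. C i j \<ge> 0" "\<And>i j t. norm (rep (A $ i $ j) t) \<le> C i j" by metis
  have "norm (rep (A $ i $ j) t) \<le> (\<Sum>i\<in>UNIV. \<Sum>j\<in>UNIV. C i j)" for i j t
  proof -
    have "C i j \<le> (\<Sum>j\<in>UNIV. C i j)" by (rule member_le_sum) (use C in auto)
    also have "\<dots> \<le> (\<Sum>i\<in>UNIV. \<Sum>j\<in>UNIV. C i j)"
      by (rule member_le_sum[of _ _ "\<lambda>i. \<Sum>j\<in>UNIV. C i j"]) (use C in \<open>auto intro: sum_nonneg\<close>)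
    finally show ?thesis using C(2)[of i j t] by linarith
  qed
  moreover have "0 \<le> (\<Sum>i\<in>UNIV. \<Sum>j\<in>UNIV. C i j)" using C by (intro sum_nonneg)
  ultimately show ?thesis by blast
qed

text \<open>The indices are transposed because it is the adjoint system that gets solved;
  \<open>rep\<close> extends the entries by 0 to the whole line with a bound at every point.\<close>

lemma linsys_A: "\<forall>i j t. norm (rep (A $ i $ j) t) \<le> M \<Longrightarrow> linsys (\<lambda>i j. rep (A $ j $ i)) M"
  by unfold_locales (use rep_measurable[OF Ginf_GG[OF A]] in auto)

lemma rep_cont:
  assumes "g \<in> GG I" "jump_free g" "S \<subseteq> I" shows "continuous_on S (rep g)"
proof -
  have "isCont (rep g) t" if t: "t \<in> I" for t
  proof -
    have "(rep g \<longlongrightarrow> rep g t) (side_at b t)" for b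
      using rep_lim[OF assms(1) t, of b] jump_free_rep[OF assms(2) t, of b] by simp
    from this[of True] this[of False] show ?thesis
      unfolding isCont_def side_at_def by (simp add: filterlim_split_at)
  qed
  then show ?thesis using assms(3) by (meson continuous_at_imp_continuous_on subsetD)
qed

text \<open>Right of all supports w vanishes, which provides the terminal value.
  \<open>gder_FTC\<close>, applicable because w is jump-free, turns the differential relation into
  the homogeneous integral equation, and \<open>solves_bound\<close> with N = 0 forces w =
  0.\<close>

lemma adjoint_after_unique:
  assumes w: "adjoint_after s (\<lambda>_ _. 0) w"
  shows "zero_after s (w i)"
  unfolding zero_after_def
proof (intro ballI impI allI)
  fix t b assume t: "t \<in> I" "s < t"
  have wt: "w i \<in> test I" "jump_free (w i)" for i using w by (auto simp: adjoint_after_def)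
  have wG: "w i \<in> GG I" "w i \<in> Ginf I" "gder I (w i) \<in> GG I" for i
    using wt test_Ginf Ginf_GG gder_Ginf by blast+
  have "\<exists>d. t \<le> d \<and> {t..d} \<subseteq> I \<and> (\<forall>r\<in>I. d \<le> r \<longrightarrow> (\<forall>i b. ess_lim b (w i) r = 0))"
  proof -
    have "\<exists>d\<in>I. \<forall>r\<in>I. d \<le> r \<longrightarrow> (\<forall>b. ess_lim b (w i) r = 0)" for i
    proof -
      obtain c d where cd: "c \<le> d" "{c..d} \<subseteq> I" "w i \<in> test_on I {c..d}" using testE[OF wt(1)] by metis
      have dI: "d \<in> I" using cd by auto
      obtain e where e: "e > 0" "ball d e \<subseteq> I" using open_I dI open_contains_ball by blast
      \<comment> \<open>Membership in \<open>test_on I {c..d}\<close> leaves the limits at d open,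
        so the terminal point is moved slightly beyond d.\<close>
      have "d + e/2 \<in> I" using e by (auto simp: dist_real_def subset_iff)
      moreover have "\<forall>r\<in>I. d + e/2 \<le> r \<longrightarrow> (\<forall>b. ess_lim b (w i) r = 0)"
      proof (intro ballI impI allI)
        fix r b assume r: "r \<in> I" "d + e/2 \<le> r"
        then have "d < r" using e by linarith
        then show "ess_lim b (w i) r = 0" using cd(3) r unfolding test_on_Icc[OF cd(2)] by blast
      qed
      ultimately show ?thesis by blast
    qed
    then obtain D where D: "\<And>i. D i \<in> I" "\<And>i r b. r \<in> I \<Longrightarrow> D i \<le> r \<Longrightarrow> ess_lim b (w i) r = 0" by metis
    define d where "d = Max (insert t (range D))"
    have le: "D i \<le> d" "t \<le> d" for i unfolding d_def by (rule Max_ge; simp)+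
    have "d \<in> insert t (range D)" unfolding d_def by (rule Max_in) auto
    then have "d \<in> I" using D(1) t(1) by auto
    then have "{t..d} \<subseteq> I" using Icc_I t(1) by blast
    moreover have "\<forall>r\<in>I. d \<le> r \<longrightarrow> (\<forall>i b. ess_lim b (w i) r = 0)"
    proof (intro ballI impI allI)
      fix r i b assume r: "r \<in> I" "d \<le> r"
      show "ess_lim b (w i) r = 0" by (rule D(2)[OF r(1)]) (use le(1)[of i] r(2) in linarith)
    qed
    ultimately show ?thesis using le(2) by blast
  qed
  then obtain d where d: "t \<le> d" "{t..d} \<subseteq> I" and z: "\<forall>r\<in>I. d \<le> r \<longrightarrow> (\<forall>i b. ess_lim b (w i) r = 0)" by blast
  obtain M where M: "M \<ge> 0" "\<forall>i j t. norm (rep (A $ i $ j) t) \<le> M" using A_bound by blast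
  interpret L: linsys "\<lambda>i j. rep (A $ j $ i)" M d by (rule linsys_A[OF M(2)])
  \<comment> \<open>The summand 0 is the inhomogeneity, in the shape that \<open>L.solves\<close>
    expects.\<close>
  have eq: "rep (gder I (w i)) r = - ((\<Sum>j\<in>UNIV. rep (A $ j $ i) r * rep (w j) r) + 0)" if r: "r \<in> {t..d}" for r i
  proof -
    have rI: "r \<in> I" "s < r" using r d t by auto
    have "ess_lim True (defect (\<lambda>_ _. 0) w i) r = 0" using w rI by (auto simp: adjoint_after_def zero_after_def)
    then have "ess_lim True (gder I (w i)) r + (\<Sum>j\<in>UNIV. ess_lim True (A $ j $ i) r * ess_lim True (w j) r) = 0"
      using ess_lim_defect[of "\<lambda>_ _. 0" w r True i, OF test_zero wt(1) rI(1)] by simp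
    then show ?thesis using rI by (simp add: rep_in eq_neg_iff_add_eq_0)
  qed
  have "L.solves (\<lambda>_ _. 0) t (\<lambda>i. rep (w i))"
    unfolding L.solves_def
  proof (intro conjI allI ballI)
    fix i show "continuous_on {t..d} (rep (w i))" by (rule rep_cont[OF wG(1) wt(2) d(2)])
    fix r assume r: "r \<in> {t..d}"
    have dI: "d \<in> I" using d by auto
    have "integral {r..d} (rep (gder I (w i))) = rep (w i) d - rep (w i) r"
      by (rule gder_FTC[OF wG(1) Ginf_gder[OF wG(2)]]) (use wt(2) r d in \<open>auto simp: jump_free_def\<close>)
    moreover have "rep (w i) d = 0" using z dI rep_in[OF dI] by auto
    moreover have "integral {r..d} (rep (gder I (w i))) =
        integral {r..d} (\<lambda>s. - ((\<Sum>j\<in>UNIV. rep (A $ j $ i) s * rep (w j) s) + 0))"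
      by (rule integral_cong) (use eq r in auto)
    ultimately show "rep (w i) r = integral {r..d} (\<lambda>s. (\<Sum>j\<in>UNIV. rep (A $ j $ i) s * rep (w j) s) + 0)"
      unfolding integral_neg by simp
  qed
  then have "norm (rep (w i) t) \<le> 2 / L.lam * L.wt t * 0"
    by (rule L.solves_bound[rotated 2]) (use d in auto)
  then show "ess_lim b (w i) t = 0" using jump_free_rep[OF wt(2) t(1)] by simp
qed

text \<open>From either side the quotient of the integral is, up to sign, an average of
  \<open>r\<close> near t and converges to the one-sided limit of \<open>r\<close>, even where
  \<open>r\<close> jumps. The cut by \<open>ind p e\<close> is locally constant on each side and
  contributes nothing.\<close>

lemma cut_integral_gder:
  assumes pe: "p < e"
    and \<phi>c: "continuous_on UNIV \<phi>" and int: "\<And>x. r integrable_on {x..e}"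
    and \<phi>: "\<And>t. p \<le> t \<Longrightarrow> t \<le> e \<Longrightarrow> \<phi> t = integral {t..e} r"
    and lim: "\<And>t b. t \<in> I \<Longrightarrow> \<exists>l. (r \<longlongrightarrow> l) (side_at b t)"
    and R: "(\<lambda>t. - (ind p e t * r t)) \<in> GG I"
  shows "has_gder I (\<lambda>t. ind p e t * \<phi> t) (\<lambda>t. - (ind p e t * r t))"
  unfolding has_gder_iff
proof (intro conjI ballI allI R)
  fix t b assume t: "t \<in> I"
  have \<phi>at: "isCont \<phi> x" for x using \<phi>c by (simp add: continuous_on_eq_continuous_at)
  obtain \<delta> c where \<delta>: "\<delta> > 0" "\<forall>s\<in>side_nbh b t \<delta>. ind p e s = c" using ind_local[of b t p e] by blast
  let ?Q = "\<lambda>s. (ind p e s * \<phi> s - ess_lim b (\<lambda>t. ind p e t * \<phi> t) t) / of_real (s - t)"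
  obtain s0 where s0: "s0 \<in> side_nbh b t \<delta>" using side_nbh_nonempty[OF \<delta>(1)] by blast
  have "c = 0 \<or> c = 1" using \<delta>(2) s0 by (auto simp: ind_def split: if_splits)
  then show "(?Q \<longlongrightarrow> ess_lim b (\<lambda>t. - (ind p e t * r t)) t) (ess b t)"
  proof
    assume c: "c = 0"
    have "((\<lambda>t. ind p e t * \<phi> t) \<longlongrightarrow> 0) (side_at b t)" "((\<lambda>t. - (ind p e t * r t)) \<longlongrightarrow> 0) (side_at b t)"
      by (subst side_at_cong[OF \<delta>(1), of b t _ "\<lambda>_. 0"]; use \<delta>(2) c in simp)+
    then have 0: "ess_lim b (\<lambda>t. ind p e t * \<phi> t) t = 0" "ess_lim b (\<lambda>t. - (ind p e t * r t)) t = 0"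
      using ess_lim_side by blast+
    have "(?Q \<longlongrightarrow> 0) (side_at b t)"
      by (subst side_at_cong[OF \<delta>(1), of b t _ "\<lambda>_. 0"]) (use \<delta>(2) c 0 in auto)
    then show ?thesis unfolding 0 by (rule tendsto_mono[OF ess_le])
  next
    assume c: "c = 1"
    obtain l where l: "(r \<longlongrightarrow> l) (side_at b t)" using lim[OF t] by blast
    have in_pe: "p \<le> s \<and> s < e" if "s \<in> side_nbh b t \<delta>" for s
      using \<delta>(2) that c by (auto simp: ind_def split: if_splits)
    \<comment> \<open>The side neighbourhood lies in [p, e), so its endpoint t lies in the closure;
      a violation is refuted by a point of the neighbourhood that is still outside [p, e).\<close>
    have tpe: "p \<le> t" "t \<le> e"
    proof -
      have "p \<le> t \<and> t \<le> e"
      proof (rule ccontr)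
        assume "\<not> (p \<le> t \<and> t \<le> e)"
        then obtain s where "s \<in> side_nbh b t \<delta>" "\<not> (p \<le> s \<and> s < e)"
        proof (cases b)
          case True
          show ?thesis
          proof (cases "t < p")
            case True
            then show ?thesis using that[of "t + min (\<delta>/2) ((p - t)/2)"] \<open>b\<close> \<delta>(1)
              by (simp add: side_nbh_def min_def field_simps split: if_splits)
          next
            case False
            then show ?thesis using that[of "t + \<delta>/2"] \<open>b\<close> \<delta>(1) \<open>\<not> (p \<le> t \<and> t \<le> e)\<close> by (simp add: side_nbh_def)
          qed
        next
          case False
          show ?thesis
          proof (cases "t < p")
            case True
            then show ?thesis using that[of "t - \<delta>/2"] \<open>\<not> b\<close> \<delta>(1) by (simp add: side_nbh_def)
          next
            case False
            then show ?thesis using that[of "t - min (\<delta>/2) ((t - e)/2)"] \<open>\<not> b\<close> \<delta>(1) \<open>\<not> (p \<le> t \<and> t \<le> e)\<close>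
              by (simp add: side_nbh_def min_def field_simps split: if_splits)
          qed
        qed
        then show False using in_pe by blast
      qed
      then show "p \<le> t" "t \<le> e" by auto
    qed
    have "(\<phi> \<longlongrightarrow> \<phi> t) (side_at b t)" using \<phi>at[of t] tendsto_mono[OF side_at_le] unfolding continuous_within by blast
    then have "((\<lambda>t. ind p e t * \<phi> t) \<longlongrightarrow> \<phi> t) (side_at b t)"
      by (subst side_at_cong[OF \<delta>(1), of b t _ \<phi>]) (use \<delta>(2) c in auto)
    then have lu: "ess_lim b (\<lambda>t. ind p e t * \<phi> t) t = \<phi> t" by (rule ess_lim_side)
    have "((\<lambda>t. - (ind p e t * r t)) \<longlongrightarrow> - l) (side_at b t)"
      by (subst side_at_cong[OF \<delta>(1), of b t _ "\<lambda>t. - r t"]) (use \<delta>(2) c tendsto_minus[OF l] in auto)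
    then have lr: "ess_lim b (\<lambda>t. - (ind p e t * r t)) t = - l" by (rule ess_lim_side)
    have int': "r integrable_on {x..y}" if "x \<le> y" "y \<le> e" for x y
      by (rule integrable_subinterval_real[OF int[of x]]) (use that in auto)
    have comb: "\<phi> x - \<phi> y = integral {x..y} r" if "p \<le> x" "x \<le> y" "y \<le> e" for x y
    proof -
      have "integral {x..y} r + integral {y..e} r = integral {x..e} r"
        by (rule Henstock_Kurzweil_Integration.integral_combine[OF that(2,3) int])
      then show ?thesis using \<phi>[of x] \<phi>[of y] that by (simp add: algebra_simps)
    qed
    have "(?Q \<longlongrightarrow> - l) (side_at b t)"
    proof (rule tendstoI)
      fix \<epsilon> :: real assume \<epsilon>: "\<epsilon> > 0"
      obtain \<eta> where \<eta>: "\<eta> > 0" "\<forall>s\<in>side_nbh b t \<eta>. dist (r s) l < \<epsilon>/2"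
        using tendstoD[OF l, of "\<epsilon>/2"] \<epsilon> unfolding eventually_side_at by auto
      have "dist (?Q s) (- l) < \<epsilon>" if s: "s \<in> side_nbh b t (min \<delta> \<eta>)" for s
      proof -
        have s1: "s \<in> side_nbh b t \<delta>" and s2: "s \<in> side_nbh b t \<eta>"
          using s side_nbh_mono[of "min \<delta> \<eta>" \<delta> b t] side_nbh_mono[of "min \<delta> \<eta>" \<eta> b t] by auto
        have spe: "p \<le> s" "s \<le> e" using in_pe[OF s1] by auto
        have st: "of_real (s - t) \<noteq> (0::complex)" using side_nbh_not_self[OF s] by (simp del: of_real_diff)
        \<comment> \<open>The plus sign appears because \<phi> is an integral with variable lower
          limit, so its derivative is minus \<open>r\<close>.\<close>
        have "norm ((\<phi> s - \<phi> t) + of_real (s - t) * l) \<le> \<epsilon>/2 * \<bar>s - t\<bar>"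
        proof (cases b)
          case True
          then have ts: "t < s" using s2 by (simp add: side_nbh_def)
          have "norm (integral {t..s} r - of_real (s - t) * l) \<le> \<epsilon>/2 * (s - t)"
          proof (rule integral_minus_const_bound)
            fix x assume "t < x" "x < s"
            then have "x \<in> side_nbh b t \<eta>" using s2 True by (simp add: side_nbh_def)
            then show "norm (r x - l) \<le> \<epsilon>/2" using \<eta>(2) by (auto simp: dist_norm less_imp_le)
          qed (use ts spe \<epsilon> int' in auto)
          moreover have "(\<phi> s - \<phi> t) + of_real (s - t) * l = - (integral {t..s} r - of_real (s - t) * l)"
            using comb[of t s] tpe spe ts by (simp add: algebra_simps)
          ultimately show ?thesis using ts by (simp only: norm_minus_cancel abs_of_pos diff_gt_0_iff_gt)
        next
          case False
          then have ts: "s < t" using s2 by (simp add: side_nbh_def)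
          have "norm (integral {s..t} r - of_real (t - s) * l) \<le> \<epsilon>/2 * (t - s)"
          proof (rule integral_minus_const_bound)
            fix x assume "s < x" "x < t"
            then have "x \<in> side_nbh b t \<eta>" using s2 False by (simp add: side_nbh_def)
            then show "norm (r x - l) \<le> \<epsilon>/2" using \<eta>(2) by (auto simp: dist_norm less_imp_le)
          qed (use ts tpe \<epsilon> int' in auto)
          moreover have "(\<phi> s - \<phi> t) + of_real (s - t) * l = integral {s..t} r - of_real (t - s) * l"
            using comb[of s t] tpe spe ts by (simp add: algebra_simps)
          ultimately show ?thesis using ts by simp
        qed
        moreover have "?Q s + l = ((\<phi> s - \<phi> t) + of_real (s - t) * l) / of_real (s - t)"
          using \<delta>(2) s1 c st by (simp add: lu add_divide_distrib del: of_real_diff)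
        ultimately have "norm (?Q s + l) \<le> \<epsilon>/2"
          using st by (simp only: norm_divide norm_of_real) (simp add: divide_le_eq del: of_real_diff)
        then show ?thesis using \<epsilon> by (simp add: dist_norm)
      qed
      then show "eventually (\<lambda>s. dist (?Q s) (- l) < \<epsilon>) (side_at b t)"
        unfolding eventually_side_at using \<delta>(1) \<eta>(1) by (intro exI[of _ "min \<delta> \<eta>"]) auto
    qed
    then show ?thesis unfolding lr by (rule tendsto_mono[OF ess_le])
  qed
qed

lemma ind_continuous_GG:
  assumes "continuous_on UNIV \<phi>" and B: "\<And>t. p \<le> t \<Longrightarrow> t < e \<Longrightarrow> norm (\<phi> t) \<le> B"
  shows "(\<lambda>t. ind p e t * \<phi> t) \<in> GG I"
proof (rule GG_I)
  have [measurable]: "\<phi> \<in> borel_measurable borel" using assms(1) by (rule borel_measurable_continuous_onI)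
  show "(\<lambda>t. ind p e t * \<phi> t) \<in> borel_measurable (lebesgue_on I)"
    by (intro borel_I) measurable
  have "norm (ind p e t * \<phi> t) \<le> max B 0" for t
    using B[of t] by (auto simp: ind_def le_max_iff_disj)
  then show "AE t in lebesgue_on I. norm (ind p e t * \<phi> t) \<le> max B 0" by simp
  fix t b assume t: "t \<in> I"
  have "isCont \<phi> t" using assms(1) by (simp add: continuous_on_eq_continuous_at)
  then have "(\<phi> \<longlongrightarrow> \<phi> t) (ess b t)"
    using tendsto_mono[OF order_trans[OF ess_le side_at_le]] unfolding continuous_within by blast
  then show "\<exists>l. ((\<lambda>t. ind p e t * \<phi> t) \<longlongrightarrow> l) (ess b t)"
    using tendsto_mult[OF GG_lim[OF ind_chain(1) t]] by blast
qed

lemma ess_lim_isCont_mult: "isCont g t \<Longrightarrow> f \<in> GG I \<Longrightarrow> t \<in> I \<Longrightarrow> ess_lim b (\<lambda>s. f s * g s) t = ess_lim b f t * g t"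
  by (intro ess_lim_eq tendsto_mult GG_lim)
    (use tendsto_mono[OF order_trans[OF ess_le side_at_le]] in \<open>auto simp: continuous_within\<close>)

text \<open>Carries the derivative of u over to \<zeta> u, which agrees with u on an open half-line.
  As \<open>gder\<close> is known only through \<open>has_gder\<close>, locality has to be read off
  from the quotients.\<close>

lemma ess_lim_gder_local:
  assumes "has_gder I f f'" "has_gder I g g'" "t \<in> I" "open U" "t \<in> U" "AE s in lebesgue. s \<in> U \<longrightarrow> f s = g s"
  shows "ess_lim b f' t = ess_lim b g' t" "ess_lim b f t = ess_lim b g t"
proof -
  have ev: "eventually (\<lambda>s. f s = g s) (ess b t)" by (rule eventually_ess_open[OF assms(6,4,5)])
  show l: "ess_lim b f t = ess_lim b g t" by (rule ess_lim_cong[OF ev])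
  have "eventually (\<lambda>s. (f s - ess_lim b f t) / of_real (s - t) = (g s - ess_lim b g t) / of_real (s - t)) (ess b t)"
    using ev by eventually_elim (simp add: l)
  from tendsto_cong[OF this] have "((\<lambda>s. (g s - ess_lim b g t) / of_real (s - t)) \<longlongrightarrow> ess_lim b f' t) (ess b t)"
    using has_gder_quot[OF assms(1,3)] by blast
  then show "ess_lim b f' t = ess_lim b g' t"
    using tendsto_unique[OF ess_neq_bot _ has_gder_quot[OF assms(2,3)]] by blast
qed

text \<open>The derivative of the cut solution u, expressed through u itself rather than through the
  uncut integral solution; this self-reference makes the bootstrap on the order possible.\<close>

definition cut_rhs :: "real \<Rightarrow> ('n \<Rightarrow> real \<Rightarrow> complex) \<Rightarrow> ('n \<Rightarrow> real \<Rightarrow> complex) \<Rightarrow> 'n \<Rightarrow> real \<Rightarrow> complex" where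
  "cut_rhs e \<psi> u i t = - ((\<Sum>j\<in>UNIV. rep (A $ j $ i) t * u j t) + ind t1 e t * rep (\<psi> i) t)"

text \<open>Since \<open>cut_rhs\<close> is the derivative of u, bounds of order k on u and \<psi>
  give one of order k on that derivative, that is, order k + 1 for u. The bound with K0 starts the
  induction. K depends on k, K0, the coefficients and the cut, but not on \<psi> or u.\<close>

lemma gnorm_le_bootstrap:
  assumes K0: "0 \<le> K0"
  shows "\<exists>K\<ge>0. \<forall>\<psi> u N. (\<forall>i. gnorm_le k N (\<psi> i) \<and> u i \<in> GG I \<and> has_gder I (u i) (cut_rhs e \<psi> u i) \<and>
      (\<forall>t. norm (u i t) \<le> K0 * N)) \<longrightarrow> (\<forall>i. gnorm_le k (K * N) (u i))"
proof (induction k)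
  case 0
  show ?case
  proof (intro exI[of _ K0] conjI allI impI K0)
    fix \<psi> u N i
    assume "\<forall>i. gnorm_le 0 N (\<psi> i) \<and> u i \<in> GG I \<and> has_gder I (u i) (cut_rhs e \<psi> u i) \<and> (\<forall>t. norm (u i t) \<le> K0 * N)"
    then show "gnorm_le 0 (K0 * N) (u i)" by simp
  qed
next
  case (Suc k)
  then obtain K where K: "K \<ge> 0" "\<And>\<psi> u N i. (\<And>i. gnorm_le k N (\<psi> i)) \<Longrightarrow> (\<And>i. u i \<in> GG I) \<Longrightarrow>
      (\<And>i. has_gder I (u i) (cut_rhs e \<psi> u i)) \<Longrightarrow> (\<And>i t. norm (u i t) \<le> K0 * N) \<Longrightarrow> gnorm_le k (K * N) (u i)"
    by metis
  have ex: "\<exists>C. gnorm_le k C (rep (A $ j $ i))" for i j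
    using A[of j i] unfolding Ginf_iff using gnorm_le_ae_eq rep_ae[OF Ginf_GG[OF A]] by blast
  define C where "C i j = (SOME C. gnorm_le k C (rep (A $ j $ i)))" for i j
  have C: "gnorm_le k (C i j) (rep (A $ j $ i))" for i j
    unfolding C_def by (rule someI_ex[OF ex])
  obtain Ci where Ci: "gnorm_le k Ci (ind t1 e)" using ind_Ginf unfolding Ginf_iff by blast
  \<comment> \<open>The bound for \<open>cut_rhs\<close> divided by N: powers of 2 come from
    \<open>gnorm_le_mult\<close>, \<open>C i j\<close> bounds the coefficients and \<open>Ci\<close>
    the indicator.\<close>
  define K' where "K' i = (\<Sum>j\<in>UNIV. 2 ^ k * C i j * K) + 2 ^ k * Ci" for i
  have K'0: "0 \<le> K' i" for i
    unfolding K'_def using K(1) gnorm_le_nonneg[OF C] gnorm_le_nonneg[OF Ci] by (intro add_nonneg_nonneg sum_nonneg) auto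
  define L where "L = K0 + (\<Sum>i\<in>UNIV. K' i)"
  have L: "K0 \<le> L" "K' i \<le> L" for i
  proof -
    show "K0 \<le> L" unfolding L_def using K'0 by (simp add: sum_nonneg)
    have "K' i \<le> (\<Sum>i\<in>UNIV. K' i)" by (rule member_le_sum) (use K'0 in auto)
    then show "K' i \<le> L" unfolding L_def using K0 by simp
  qed
  show ?case
  proof (intro exI[of _ L] conjI allI impI)
    show "0 \<le> L" using L(1) K0 by simp
    fix \<psi> u N i
    assume *: "\<forall>i. gnorm_le (Suc k) N (\<psi> i) \<and> u i \<in> GG I \<and> has_gder I (u i) (cut_rhs e \<psi> u i) \<and> (\<forall>t. norm (u i t) \<le> K0 * N)"
    have \<psi>: "gnorm_le k N (\<psi> i)" for i using * gnorm_le_le[of "Suc k" N "\<psi> i" k] by simp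
    have N: "0 \<le> N" using gnorm_le_nonneg[OF \<psi>] .
    have u: "gnorm_le k (K * N) (u i)" for i by (rule K(2)[OF \<psi>]) (use * in auto)
    have "gnorm_le k (norm (-1 :: complex) * ((\<Sum>j\<in>UNIV. 2 ^ k * C i j * (K * N)) + 2 ^ k * Ci * N))
       (\<lambda>t. (-1) * ((\<Sum>j\<in>UNIV. rep (A $ j $ i) t * u j t) + ind t1 e t * rep (\<psi> i) t))"
      by (intro gnorm_le_cmult gnorm_le_add gnorm_le_sum gnorm_le_mult C u Ci gnorm_le_ae_eq[OF \<psi> rep_ae] gnorm_le_GG[OF \<psi>]) auto
    moreover have "norm (-1 :: complex) * ((\<Sum>j\<in>UNIV. 2 ^ k * C i j * (K * N)) + 2 ^ k * Ci * N) = K' i * N"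
      by (simp add: K'_def algebra_simps sum_distrib_left)
    ultimately have "gnorm_le k (K' i * N) (cut_rhs e \<psi> u i)" by (simp add: cut_rhs_def[abs_def])
    then have g: "gnorm_le k (L * N) (cut_rhs e \<psi> u i)"
      by (rule gnorm_le_mono) (rule mult_right_mono[OF L(2) N])
    have "norm (u i t) \<le> L * N" for t
      using * mult_right_mono[OF L(1) N] order_trans by blast
    then have "AE t in lebesgue_on I. norm (u i t) \<le> L * N" by simp
    with g * show "gnorm_le (Suc k) (L * N) (u i)" unfolding gnorm_le.simps by blast
  qed
qed

text \<open>The supporting interval is chosen before k, and K before \<psi>; this uniformity makes
  the solution functional continuous on each step of the test space. The solution is \<zeta> u,
  where u solves the system on \<open>{t1..e}\<close> and is 0 outside.\<close>

lemma adjoint_after_exists: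
  assumes cd: "c \<le> d" "{c..d} \<subseteq> I"
  shows "\<exists>c' d'. c' \<le> d' \<and> {c'..d'} \<subseteq> I \<and> (\<forall>k. \<exists>K\<ge>0. \<forall>\<psi> N. (\<forall>i. \<psi> i \<in> test_on I {c..d} \<and> gnorm_le k N (\<psi> i)) \<longrightarrow>
     (\<exists>w. adjoint_after t2 \<psi> w \<and> (\<forall>i. w i \<in> test_on I {c'..d'} \<and> gnorm_le k (K * N) (w i))))"
proof -
  have "max d t0 \<in> I" using cd t012 by (auto simp: max_def)
  then obtain \<rho> where \<rho>: "\<rho> > 0" "ball (max d t0) \<rho> \<subseteq> I" using open_I open_contains_ball by blast
  \<comment> \<open>Strictly beyond d, so that \<psi> is 0 near e and after it, and beyond t0, so
    that \<open>{t1..e}\<close> contains t0.\<close>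
  define e where "e = max d t0 + \<rho>/2"
  have eI: "e \<in> I" using \<rho> by (auto simp: e_def dist_real_def subset_iff)
  have e: "d < e" "t0 < e" using \<rho>(1) by (auto simp: e_def)
  have t1I: "t1 \<in> I" using t012 by auto
  have t1e: "t1 < e" "{t1..e} \<subseteq> I" using Icc_I[OF t1I eI] t012 e by auto
  obtain M where M: "M \<ge> 0" "\<forall>i j t. norm (rep (A $ i $ j) t) \<le> M" using A_bound by blast
  interpret L: linsys "\<lambda>i j. rep (A $ j $ i)" M e by (rule linsys_A[OF M(2)])
  define K0 where "K0 = 2 / L.lam * L.wt t1"
  have K0: "0 \<le> K0" using L.lam_pos L.wt_pos[of t1] by (simp add: K0_def less_imp_le)
  define \<zeta> where "\<zeta> = ramp t1 t2"
  have \<zeta>: "\<zeta> \<in> Ginf I" unfolding \<zeta>_def by (rule ramp_Ginf[OF t012(1)])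
  have \<zeta>1: "\<zeta> t = 1" if "t2 < t" for t using that t012 by (simp add: \<zeta>_def ramp_def min_def max_def field_simps)
  have sol: "\<exists>u. (\<forall>i. u i \<in> GG I \<and> has_gder I (u i) (cut_rhs e \<psi> u i) \<and>
      (\<forall>k N. (\<forall>i. gnorm_le k N (\<psi> i)) \<longrightarrow> (\<forall>t. norm (u i t) \<le> K0 * N)) \<and>
      (\<forall>t. t < t1 \<or> e \<le> t \<longrightarrow> u i t = 0)) \<and> (\<forall>i. jump_free (\<lambda>t. \<zeta> t * u i t))"
    if \<psi>: "\<And>i. \<psi> i \<in> test_on I {c..d}" for \<psi> :: "'n \<Rightarrow> real \<Rightarrow> complex"
  proof -
    have G\<psi>: "\<psi> i \<in> GG I" for i using \<psi>[of i] by (simp add: test_on_def Ginf_GG)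
    have mP: "rep (\<psi> i) \<in> borel_measurable lebesgue" for i by (rule rep_measurable[OF G\<psi>])
    have "\<exists>C\<ge>0. \<forall>t. norm (rep (\<psi> i) t) \<le> C" for i
      using GG_bound[OF G\<psi>] rep_norm_le[OF G\<psi>] by blast
    then obtain C where C: "\<And>i. C i \<ge> 0" "\<And>i t. norm (rep (\<psi> i) t) \<le> C i" by metis
    have bP: "norm (rep (\<psi> i) t) \<le> (\<Sum>i\<in>UNIV. C i)" for i t
    proof -
      have "C i \<le> (\<Sum>i\<in>UNIV. C i)" by (rule member_le_sum) (use C in auto)
      then show ?thesis using C(2)[of i t] by linarith
    qed
    obtain \<phi> where \<phi>c: "\<forall>i. continuous_on UNIV (\<phi> i)" and \<phi>0: "\<forall>i t. e \<le> t \<longrightarrow> \<phi> i t = 0" and \<phi>s: "\<forall>t1. L.solves (\<lambda>i. rep (\<psi> i)) t1 \<phi>"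
    proof (rule L.solves_exists[where \<psi>="\<lambda>i. rep (\<psi> i)" and N="\<Sum>i\<in>UNIV. C i", OF mP bP], goal_cases)
      case (1 \<phi>)
      show ?case by (rule that[of \<phi>]) (use 1 in simp_all)
    qed
    define u where "u i t = ind t1 e t * \<phi> i t" for i t
    define r where "r i s = (\<Sum>j\<in>UNIV. rep (A $ j $ i) s * \<phi> j s) + rep (\<psi> i) s" for i s
    have \<phi>sub: "continuous_on S (\<phi> i)" for S i using \<phi>c continuous_on_subset by blast
    have b\<phi>: "norm (\<phi> i t) \<le> K0 * N" if t: "t1 \<le> t" "t < e" and N: "\<forall>i t. norm (rep (\<psi> i) t) \<le> N" for i t N
      using L.solves_bound[of "\<lambda>i. rep (\<psi> i)" N t1 \<phi> t i, OF mP] \<phi>s t N by (simp add: K0_def)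
    have Gu: "u i \<in> GG I" for i
      unfolding u_def[abs_def] by (rule ind_continuous_GG[OF \<phi>c[rule_format] b\<phi>]) (use bP in auto)
    have int: "r i integrable_on {x..e}" for i x
      unfolding r_def by (rule L.rhs_integrable[OF mP bP \<phi>sub])
    have ueq: "- (ind t1 e t * r i t) = cut_rhs e \<psi> u i t" for i t
      by (simp add: cut_rhs_def u_def r_def sum_distrib_left algebra_simps)
    have Gcut: "cut_rhs e \<psi> u i \<in> GG I" for i
    proof -
      have "(\<lambda>t. (-1) * ((\<Sum>j\<in>UNIV. rep (A $ j $ i) t * u j t) + ind t1 e t * rep (\<psi> i) t)) \<in> GG I"
        by (intro GG_cmult GG_add GG_sum GG_mult rep_GG Ginf_GG[OF A] Gu ind_chain G\<psi>)
      then show ?thesis by (simp add: cut_rhs_def[abs_def])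
    qed
    have lim: "\<exists>l. (r i \<longlongrightarrow> l) (side_at b t)" if t: "t \<in> I" for i b t
    proof -
      have "(\<phi> j \<longlongrightarrow> \<phi> j t) (side_at b t)" for j
        using \<phi>c tendsto_mono[OF side_at_le] unfolding continuous_on_eq_continuous_at[OF open_UNIV] continuous_within by blast
      then have "((\<lambda>s. (\<Sum>j\<in>UNIV. rep (A $ j $ i) s * \<phi> j s) + rep (\<psi> i) s) \<longlongrightarrow>
         (\<Sum>j\<in>UNIV. ess_lim b (A $ j $ i) t * \<phi> j t) + ess_lim b (\<psi> i) t) (side_at b t)"
        by (intro tendsto_add tendsto_sum tendsto_mult rep_lim Ginf_GG[OF A] G\<psi> t)
      then show ?thesis unfolding r_def by blast
    qed
    have der: "has_gder I (u i) (cut_rhs e \<psi> u i)" for i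
    proof -
      have "has_gder I (\<lambda>t. ind t1 e t * \<phi> i t) (\<lambda>t. - (ind t1 e t * r i t))"
      proof (rule cut_integral_gder[OF t1e(1) \<phi>c[rule_format] int])
        show "\<phi> i t = integral {t..e} (r i)" if "t1 \<le> t" "t \<le> e" for t
          using \<phi>s that unfolding L.solves_def r_def by auto
        show "(\<lambda>t. - (ind t1 e t * r i t)) \<in> GG I" unfolding ueq using Gcut by simp
      qed (rule lim)
      then show ?thesis unfolding ueq by (simp add: u_def[abs_def])
    qed
    have ub: "norm (u i t) \<le> K0 * N" if N: "\<forall>i. gnorm_le k N (\<psi> i)" for i t k N
    proof -
      have N0: "0 \<le> N" using N gnorm_le_nonneg by blast
      have "\<forall>i t. norm (rep (\<psi> i) t) \<le> N"
        using rep_norm_le[OF G\<psi> gnorm_le_bound[OF N[rule_format]] N0] by blast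
      then show ?thesis using b\<phi>[of t N i] K0 N0 by (auto simp: u_def ind_def)
    qed
    have jf: "jump_free (\<lambda>t. \<zeta> t * u i t)" for i
      unfolding jump_free_def
    proof
      fix t assume t: "t \<in> I"
      have "isCont (\<lambda>t. \<phi> i t * \<zeta> t) t"
        using \<phi>c unfolding \<zeta>_def by (intro continuous_mult ramp_isCont) (simp add: continuous_on_eq_continuous_at)
      then have l: "ess_lim b (\<lambda>t. ind t1 e t * (\<phi> i t * \<zeta> t)) t = ess_lim b (ind t1 e) t * (\<phi> i t * \<zeta> t)" for b
        by (rule ess_lim_isCont_mult[OF _ ind_chain(1) t])
      \<comment> \<open>At t1 the cut-off vanishes and at e the integral solution does, so neither
        cut of u leaves a jump in \<zeta> u.\<close>
      have "\<phi> i t * \<zeta> t = 0" if "t \<in> {t1, e}"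
        using that \<phi>0 t012 by (auto simp: \<zeta>_def ramp_def)
      from jump_free_ind[OF t this] show "ess_lim True (\<lambda>t. \<zeta> t * u i t) t = ess_lim False (\<lambda>t. \<zeta> t * u i t) t"
        using l by (simp add: u_def mult_ac)
    qed
    show ?thesis
      using Gu der ub jf by (intro exI[of _ u]) (auto simp: u_def ind_def)
  qed
  have adjoint_after: "adjoint_after t2 \<psi> (\<lambda>i t. \<zeta> t * u i t)" and on: "\<And>i. (\<lambda>t. \<zeta> t * u i t) \<in> test_on I {t1..e}"
    if \<psi>: "\<And>i. \<psi> i \<in> test_on I {c..d}" and uG: "\<And>i. u i \<in> Ginf I" and der: "\<And>i. has_gder I (u i) (cut_rhs e \<psi> u i)"
      and u0: "\<And>i t. t < t1 \<or> e \<le> t \<Longrightarrow> u i t = 0" and jf: "\<And>i. jump_free (\<lambda>t. \<zeta> t * u i t)" for \<psi> u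
  proof -
    have G\<psi>: "\<psi> i \<in> GG I" and t\<psi>: "\<psi> i \<in> test I" for i
      using \<psi>[of i] test_onI[OF cd(2)] by (auto simp: test_on_def Ginf_GG)
    have wG: "(\<lambda>t. \<zeta> t * u i t) \<in> Ginf I" for i by (rule Ginf_mult[OF \<zeta> uG])
    show on: "(\<lambda>t. \<zeta> t * u i t) \<in> test_on I {t1..e}" for i
      unfolding test_on_def
    proof (intro CollectI conjI wG)
      show "AE t in lebesgue_on I. t \<notin> {t1..e} \<longrightarrow> \<zeta> t * u i t = 0"
        by (rule AE_I2) (use u0 in \<open>auto simp: not_le\<close>)
    qed
    have wt: "(\<lambda>t. \<zeta> t * u i t) \<in> test I" for i by (rule test_onI[OF t1e(2) on])
    show "adjoint_after t2 \<psi> (\<lambda>i t. \<zeta> t * u i t)"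
      unfolding adjoint_after_def zero_after_def
    proof (intro allI conjI wt jf ballI impI)
      fix i t b assume t: "t \<in> I" "t2 < t"
      have ae: "AE s in lebesgue. s \<in> {t2<..} \<longrightarrow> \<zeta> s * u j s = u j s" for j
        by (rule AE_I2) (simp add: \<zeta>1)
      note loc = ess_lim_gder_local[OF _ _ t(1) open_greaterThan _ ae]
      have w_u: "ess_lim b (\<lambda>t. \<zeta> t * u j t) t = ess_lim b (u j) t" for j
        by (rule loc(2)[OF Ginf_gder[OF wG] der]) (use t in simp)
      have dw: "ess_lim b (gder I (\<lambda>t. \<zeta> t * u i t)) t = ess_lim b (cut_rhs e \<psi> u i) t"
        by (rule loc(1)[OF Ginf_gder[OF wG] der]) (use t in simp)
      have "ess_lim b (cut_rhs e \<psi> u i) t = - ((\<Sum>j\<in>UNIV. ess_lim b (A $ j $ i) t * ess_lim b (u j) t) + ess_lim b (ind t1 e) t * ess_lim b (\<psi> i) t)"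
      proof -
        have rl: "(rep g \<longlongrightarrow> ess_lim b g t) (ess b t)" if "g \<in> GG I" for g
          using rep_lim[OF that t(1)] tendsto_mono[OF ess_le] by blast
        show ?thesis unfolding cut_rhs_def
          by (intro ess_lim_eq tendsto_minus tendsto_add tendsto_sum tendsto_mult rl[OF Ginf_GG[OF A]] rl[OF G\<psi>]
              GG_lim[OF Ginf_GG[OF uG] t(1)] GG_lim[OF ind_chain(1) t(1)])
      qed
      \<comment> \<open>From e > d on, where the indicator switches off, \<psi> is already
        0.\<close>
      moreover have "ess_lim b (ind t1 e) t * ess_lim b (\<psi> i) t = ess_lim b (\<psi> i) t"
      proof (cases "t < e")
        case True
        then have "ess_lim b (ind t1 e) t = 1" using ind_ess_lim[of t t1 e b] t t012 by (simp add: ind_def)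
        then show ?thesis by simp
      next
        case False
        then have "d < t" using e by simp
        then have "ess_lim b (\<psi> i) t = 0" using \<psi>[of i] t(1) unfolding test_on_Icc[OF cd(2)] by blast
        then show ?thesis by simp
      qed
      ultimately show "ess_lim b (defect \<psi> (\<lambda>i t. \<zeta> t * u i t) i) t = 0"
        unfolding ess_lim_defect[of \<psi> "\<lambda>i t. \<zeta> t * u i t", OF t\<psi> wt t(1)] w_u dw by simp
    qed
  qed
  show ?thesis
  proof (rule exI[of _ t1], rule exI[of _ e], intro conjI allI)
    fix k
    obtain K where K: "K \<ge> 0" "\<And>\<psi> u N i. (\<And>i. gnorm_le k N (\<psi> i)) \<Longrightarrow> (\<And>i. u i \<in> GG I) \<Longrightarrow>
      (\<And>i. has_gder I (u i) (cut_rhs e \<psi> u i)) \<Longrightarrow> (\<And>i t. norm (u i t) \<le> K0 * N) \<Longrightarrow> gnorm_le k (K * N) (u i)"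
      using gnorm_le_bootstrap[OF K0, of k e] by metis
    obtain C where C: "gnorm_le k C \<zeta>" using \<zeta> unfolding Ginf_iff by blast
    show "\<exists>K\<ge>0. \<forall>\<psi> N. (\<forall>i. \<psi> i \<in> test_on I {c..d} \<and> gnorm_le k N (\<psi> i)) \<longrightarrow>
     (\<exists>w. adjoint_after t2 \<psi> w \<and> (\<forall>i. w i \<in> test_on I {t1..e} \<and> gnorm_le k (K * N) (w i)))"
    proof (intro exI[of _ "2 ^ k * C * K"] conjI allI impI)
      show "0 \<le> 2 ^ k * C * K" using K(1) gnorm_le_nonneg[OF C] by simp
      fix \<psi> :: "'n \<Rightarrow> real \<Rightarrow> complex" and N assume *: "\<forall>i. \<psi> i \<in> test_on I {c..d} \<and> gnorm_le k N (\<psi> i)"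
      then have \<psi>: "\<psi> i \<in> test_on I {c..d}" for i by blast
      obtain u where u: "\<forall>i. u i \<in> GG I \<and> has_gder I (u i) (cut_rhs e \<psi> u i) \<and>
        (\<forall>k N. (\<forall>i. gnorm_le k N (\<psi> i)) \<longrightarrow> (\<forall>t. norm (u i t) \<le> K0 * N)) \<and>
        (\<forall>t. t < t1 \<or> e \<le> t \<longrightarrow> u i t = 0)" "\<forall>i. jump_free (\<lambda>t. \<zeta> t * u i t)"
        using sol[of \<psi>, OF \<psi>] by blast
      \<comment> \<open>Smoothness of u comes from the same bootstrap at every order k', with the
        bounds of \<psi> summed over the components to get a common N.\<close>
      have uG: "u i \<in> Ginf I" for i
        unfolding Ginf_iff
      proof
        fix k'
        have "\<exists>C. gnorm_le k' C (\<psi> i)" for i using \<psi>[of i] by (simp add: test_on_def Ginf_iff)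
        then obtain D where D: "\<And>i. gnorm_le k' (D i) (\<psi> i)" by metis
        have D': "gnorm_le k' (\<Sum>i\<in>UNIV. D i) (\<psi> i)" for i
          by (rule gnorm_le_mono[OF D], rule member_le_sum) (use gnorm_le_nonneg[OF D] in auto)
        obtain K' where K': "K' \<ge> 0" "\<forall>\<psi> u N. (\<forall>i. gnorm_le k' N (\<psi> i) \<and> u i \<in> GG I \<and> has_gder I (u i) (cut_rhs e \<psi> u i) \<and>
           (\<forall>t. norm (u i t) \<le> K0 * N)) \<longrightarrow> (\<forall>i. gnorm_le k' (K' * N) (u i))"
          using gnorm_le_bootstrap[OF K0, of k' e] by blast
        have "\<forall>i. gnorm_le k' (K' * (\<Sum>i\<in>UNIV. D i)) (u i)"
          by (rule K'(2)[rule_format, of _ \<psi>, THEN allI]) (use u D' in blast)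
        then show "\<exists>C. gnorm_le k' C (u i)" by blast
      qed
      have uB: "gnorm_le k (K * N) (u i)" for i by (rule K(2)[of N \<psi>]) (use u * in blast)+
      have wB: "gnorm_le k (2 ^ k * C * K * N) (\<lambda>t. \<zeta> t * u i t)" for i
        using gnorm_le_mult[OF C uB[of i]] by (simp add: mult.assoc)
      show "\<exists>w. adjoint_after t2 \<psi> w \<and> (\<forall>i. w i \<in> test_on I {t1..e} \<and> gnorm_le k (2 ^ k * C * K * N) (w i))"
      proof -
        have der: "has_gder I (u i) (cut_rhs e \<psi> u i)" for i using u(1) by blast
        have u0: "u i t = 0" if "t < t1 \<or> e \<le> t" for i t using u(1) that by blast
        have jf: "jump_free (\<lambda>t. \<zeta> t * u i t)" for i using u(2) by blast
        have "adjoint_after t2 \<psi> (\<lambda>i t. \<zeta> t * u i t)"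
          by (rule adjoint_after[of \<psi> u]; (rule \<psi> uG der u0 jf)?; assumption?)
        moreover have "(\<lambda>t. \<zeta> t * u i t) \<in> test_on I {t1..e}" for i
          by (rule on[of \<psi> u]; (rule \<psi> uG der u0 jf)?; assumption?)
        ultimately show ?thesis using wB by blast
      qed
    qed
  qed (use t1e in auto)
qed

end

subsection \<open>Operations on distributions\<close>

context ival begin

lemma test_restrict [simp]: "\<phi> \<in> test I \<Longrightarrow> restrict f (test I) \<phi> = f \<phi>" by simp

lemma distI:
  assumes "f \<in> extensional (test I)"
    and "\<And>\<phi> \<psi>. \<phi> \<in> test I \<Longrightarrow> \<psi> \<in> test I \<Longrightarrow> ae_eq I \<phi> \<psi> \<Longrightarrow> f \<phi> = f \<psi>"
    and "\<And>\<phi> \<psi> \<alpha> \<beta>. \<phi> \<in> test I \<Longrightarrow> \<psi> \<in> test I \<Longrightarrow> f (\<lambda>t. \<alpha> * \<phi> t + \<beta> * \<psi> t) = \<alpha> * f \<phi> + \<beta> * f \<psi>"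
    and "\<And>c d. c \<le> d \<Longrightarrow> {c..d} \<subseteq> I \<Longrightarrow>
      \<exists>k C. C \<ge> 0 \<and> (\<forall>\<phi>\<in>test_on I {c..d}. \<forall>M. gnorm_le k M \<phi> \<longrightarrow> norm (f \<phi>) \<le> C * M)"
  shows "f \<in> dist_space I"
  unfolding dist_iff seminorm_bounded_def
  by (intro conjI assms(1) ballI impI allI assms(2) assms(3)) (assumption | (elim conjE, rule assms(4)))+

lemma dist_closed_add:
  assumes f: "f \<in> dist_space I" and g: "g \<in> dist_space I"
  shows "(\<lambda>\<phi>\<in>test I. f \<phi> + g \<phi>) \<in> dist_space I"
proof (rule distI)
  fix \<phi> \<psi> assume \<phi>: "\<phi> \<in> test I" and \<psi>: "\<psi> \<in> test I"
  show "(\<lambda>\<phi>\<in>test I. f \<phi> + g \<phi>) \<phi> = (\<lambda>\<phi>\<in>test I. f \<phi> + g \<phi>) \<psi>" if "ae_eq I \<phi> \<psi>"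
    using \<phi> \<psi> dist_ae[OF f \<phi> that] dist_ae[OF g \<phi> that] by simp
  show "(\<lambda>\<phi>\<in>test I. f \<phi> + g \<phi>) (\<lambda>t. \<alpha> * \<phi> t + \<beta> * \<psi> t) =
      \<alpha> * (\<lambda>\<phi>\<in>test I. f \<phi> + g \<phi>) \<phi> + \<beta> * (\<lambda>\<phi>\<in>test I. f \<phi> + g \<phi>) \<psi>" for \<alpha> \<beta>
    using \<phi> \<psi> test_lin[OF \<phi> \<psi>] dist_lin[OF f \<phi> \<psi>] dist_lin[OF g \<phi> \<psi>] by (simp add: algebra_simps)
next
  fix c d :: real assume cd: "c \<le> d" "{c..d} \<subseteq> I"
  obtain k C where C: "C \<ge> 0" "\<forall>\<phi>\<in>test_on I {c..d}. \<forall>M. gnorm_le k M \<phi> \<longrightarrow> norm (f \<phi>) \<le> C * M"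
    using dist_bound[OF f cd] by blast
  obtain k' C' where C': "C' \<ge> 0" "\<forall>\<phi>\<in>test_on I {c..d}. \<forall>M. gnorm_le k' M \<phi> \<longrightarrow> norm (g \<phi>) \<le> C' * M"
    using dist_bound[OF g cd] by blast
  show "\<exists>k C. C \<ge> 0 \<and> (\<forall>\<phi>\<in>test_on I {c..d}. \<forall>M. gnorm_le k M \<phi> \<longrightarrow> norm ((\<lambda>\<phi>\<in>test I. f \<phi> + g \<phi>) \<phi>) \<le> C * M)"
  proof (rule exI[of _ "max k k'"], rule exI[of _ "C + C'"], intro conjI ballI allI impI)
    fix \<phi> M assume \<phi>: "\<phi> \<in> test_on I {c..d}" and M: "gnorm_le (max k k') M \<phi>"
    have "norm (f \<phi>) \<le> C * M" "norm (g \<phi>) \<le> C' * M"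
      using C(2) C'(2) \<phi> gnorm_le_le[OF M, of k] gnorm_le_le[OF M, of k'] by auto
    then have "norm (f \<phi> + g \<phi>) \<le> C * M + C' * M" by (rule norm_triangle_mono)
    then show "norm ((\<lambda>\<phi>\<in>test I. f \<phi> + g \<phi>) \<phi>) \<le> (C + C') * M"
      using test_onI[OF cd(2) \<phi>] by (simp add: algebra_simps)
  qed (use C C' in auto)
qed (rule restrict_extensional)

lemma dist_closed_cmult:
  assumes f: "f \<in> dist_space I"
  shows "(\<lambda>\<phi>\<in>test I. a * f \<phi>) \<in> dist_space I"
proof (rule distI)
  fix \<phi> \<psi> assume \<phi>: "\<phi> \<in> test I" and \<psi>: "\<psi> \<in> test I"
  show "(\<lambda>\<phi>\<in>test I. a * f \<phi>) \<phi> = (\<lambda>\<phi>\<in>test I. a * f \<phi>) \<psi>" if "ae_eq I \<phi> \<psi>"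
    using \<phi> \<psi> dist_ae[OF f \<phi> that] by simp
  show "(\<lambda>\<phi>\<in>test I. a * f \<phi>) (\<lambda>t. \<alpha> * \<phi> t + \<beta> * \<psi> t) =
      \<alpha> * (\<lambda>\<phi>\<in>test I. a * f \<phi>) \<phi> + \<beta> * (\<lambda>\<phi>\<in>test I. a * f \<phi>) \<psi>" for \<alpha> \<beta>
    using \<phi> \<psi> test_lin[OF \<phi> \<psi>] dist_lin[OF f \<phi> \<psi>] by (simp add: algebra_simps)
next
  fix c d :: real assume cd: "c \<le> d" "{c..d} \<subseteq> I"
  obtain k C where C: "C \<ge> 0" "\<forall>\<phi>\<in>test_on I {c..d}. \<forall>M. gnorm_le k M \<phi> \<longrightarrow> norm (f \<phi>) \<le> C * M"
    using dist_bound[OF f cd] by blast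
  show "\<exists>k C. C \<ge> 0 \<and> (\<forall>\<phi>\<in>test_on I {c..d}. \<forall>M. gnorm_le k M \<phi> \<longrightarrow> norm ((\<lambda>\<phi>\<in>test I. a * f \<phi>) \<phi>) \<le> C * M)"
  proof (rule exI[of _ k], rule exI[of _ "norm a * C"], intro conjI ballI allI impI)
    fix \<phi> M assume \<phi>: "\<phi> \<in> test_on I {c..d}" and M: "gnorm_le k M \<phi>"
    have "norm a * norm (f \<phi>) \<le> norm a * (C * M)" using C(2) \<phi> M by (intro mult_left_mono) auto
    then show "norm ((\<lambda>\<phi>\<in>test I. a * f \<phi>) \<phi>) \<le> norm a * C * M"
      using test_onI[OF cd(2) \<phi>] by (simp add: norm_mult mult.assoc)
  qed (use C in auto)
qed (rule restrict_extensional)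

lemma dist_closed_zero: "(\<lambda>\<phi>\<in>test I. 0) \<in> dist_space I"
  by (rule distI) (auto intro!: exI[of _ 0] simp: test_lin test_onI)

lemma dist_closed_sum:
  assumes "\<And>j. j \<in> S \<Longrightarrow> f j \<in> dist_space I"
  shows "(\<lambda>\<phi>\<in>test I. \<Sum>j\<in>S. f j \<phi>) \<in> dist_space I"
  using assms
proof (induction S rule: infinite_finite_induct)
  case (insert x F)
  then have "(\<lambda>\<phi>\<in>test I. f x \<phi> + (\<lambda>\<phi>\<in>test I. \<Sum>j\<in>F. f j \<phi>) \<phi>) \<in> dist_space I"
    by (intro dist_closed_add) auto
  moreover have "(\<lambda>\<phi>\<in>test I. f x \<phi> + (\<lambda>\<phi>\<in>test I. \<Sum>j\<in>F. f j \<phi>) \<phi>) = (\<lambda>\<phi>\<in>test I. \<Sum>j\<in>insert x F. f j \<phi>)"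
    using insert by (intro restrict_ext) simp
  ultimately show ?case by (simp only:)
qed (auto simp: dist_closed_zero simp del: test_restrict)

lemma dist_closed_mult:
  assumes f: "f \<in> dist_space I" and g: "g \<in> Ginf I"
  shows "mult_dist I g f \<in> dist_space I"
  unfolding mult_dist_def
proof (rule distI)
  fix \<phi> \<psi> assume \<phi>: "\<phi> \<in> test I" and \<psi>: "\<psi> \<in> test I"
  note g\<phi> = test_mult[OF g \<phi>] and g\<psi> = test_mult[OF g \<psi>]
  show "(\<lambda>\<phi>\<in>test I. f (\<lambda>t. g t * \<phi> t)) \<phi> = (\<lambda>\<phi>\<in>test I. f (\<lambda>t. g t * \<phi> t)) \<psi>" if "ae_eq I \<phi> \<psi>"
  proof -
    have "ae_eq I (\<lambda>t. g t * \<phi> t) (\<lambda>t. g t * \<psi> t)"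
      using that unfolding ae_eq_def by eventually_elim simp
    from dist_ae[OF f g\<phi> this] show ?thesis using \<phi> \<psi> by simp
  qed
  show "(\<lambda>\<phi>\<in>test I. f (\<lambda>t. g t * \<phi> t)) (\<lambda>t. \<alpha> * \<phi> t + \<beta> * \<psi> t) =
      \<alpha> * (\<lambda>\<phi>\<in>test I. f (\<lambda>t. g t * \<phi> t)) \<phi> + \<beta> * (\<lambda>\<phi>\<in>test I. f (\<lambda>t. g t * \<phi> t)) \<psi>" for \<alpha> \<beta>
    using \<phi> \<psi> test_lin[OF \<phi> \<psi>] dist_lin[OF f g\<phi> g\<psi>, of \<alpha> \<beta>] by (simp add: algebra_simps)
next
  fix c d :: real assume cd: "c \<le> d" "{c..d} \<subseteq> I"
  obtain k C where C: "C \<ge> 0" "\<forall>\<phi>\<in>test_on I {c..d}. \<forall>M. gnorm_le k M \<phi> \<longrightarrow> norm (f \<phi>) \<le> C * M"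
    using dist_bound[OF f cd] by blast
  obtain D where D: "gnorm_le k D g" using g unfolding Ginf_iff by blast
  show "\<exists>k C. C \<ge> 0 \<and> (\<forall>\<phi>\<in>test_on I {c..d}. \<forall>M. gnorm_le k M \<phi> \<longrightarrow> norm ((\<lambda>\<phi>\<in>test I. f (\<lambda>t. g t * \<phi> t)) \<phi>) \<le> C * M)"
  proof (rule exI[of _ k], rule exI[of _ "C * (2 ^ k * D)"], intro conjI ballI allI impI)
    fix \<phi> M assume \<phi>: "\<phi> \<in> test_on I {c..d}" and M: "gnorm_le k M \<phi>"
    have "norm (f (\<lambda>t. g t * \<phi> t)) \<le> C * (2 ^ k * D * M)"
      using C(2) test_on_mult[OF g \<phi>] gnorm_le_mult[OF D M] by blast
    then show "norm ((\<lambda>\<phi>\<in>test I. f (\<lambda>t. g t * \<phi> t)) \<phi>) \<le> C * (2 ^ k * D) * M"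
      using test_onI[OF cd(2) \<phi>] by (simp add: mult.assoc)
  qed (use C gnorm_le_nonneg[OF D] in auto)
qed (rule restrict_extensional)

text \<open>\<open>gder\<close> is linear only up to null sets because of the choice it makes;
  functionals respect that identification. The seminorm bound costs one order.\<close>

lemma dist_closed_gder:
  assumes f: "f \<in> dist_space I"
  shows "(\<lambda>\<phi>\<in>test I. f (gder I \<phi>)) \<in> dist_space I"
proof (rule distI)
  fix \<phi> \<psi> assume \<phi>: "\<phi> \<in> test I" and \<psi>: "\<psi> \<in> test I"
  show "(\<lambda>\<phi>\<in>test I. f (gder I \<phi>)) \<phi> = (\<lambda>\<phi>\<in>test I. f (gder I \<phi>)) \<psi>" if "ae_eq I \<phi> \<psi>"
  proof -
    have "ae_eq I (gder I \<phi>) (gder I \<psi>)"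
      by (rule gder_ae_eq[OF has_gder_ae_eq[OF Ginf_gder[OF test_Ginf[OF \<psi>]] ae_eq_sym[OF that] ae_eq_refl]])
    from dist_ae[OF f test_gder[OF \<phi>] this] show ?thesis using \<phi> \<psi> by simp
  qed
  show "(\<lambda>\<phi>\<in>test I. f (gder I \<phi>)) (\<lambda>t. \<alpha> * \<phi> t + \<beta> * \<psi> t) =
      \<alpha> * (\<lambda>\<phi>\<in>test I. f (gder I \<phi>)) \<phi> + \<beta> * (\<lambda>\<phi>\<in>test I. f (gder I \<phi>)) \<psi>" for \<alpha> \<beta>
    using dist_ae[OF f test_gder[OF test_lin[OF \<phi> \<psi>]] gder_lin[OF test_Ginf[OF \<phi>] test_Ginf[OF \<psi>]], of \<alpha> \<beta>]
      dist_lin[OF f test_gder[OF \<phi>] test_gder[OF \<psi>], of \<alpha> \<beta>] \<phi> \<psi> test_lin[OF \<phi> \<psi>] by simp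
next
  fix c d :: real assume cd: "c \<le> d" "{c..d} \<subseteq> I"
  obtain k C where C: "C \<ge> 0" "\<forall>\<phi>\<in>test_on I {c..d}. \<forall>M. gnorm_le k M \<phi> \<longrightarrow> norm (f \<phi>) \<le> C * M"
    using dist_bound[OF f cd] by blast
  show "\<exists>k C. C \<ge> 0 \<and> (\<forall>\<phi>\<in>test_on I {c..d}. \<forall>M. gnorm_le k M \<phi> \<longrightarrow> norm ((\<lambda>\<phi>\<in>test I. f (gder I \<phi>)) \<phi>) \<le> C * M)"
  proof (rule exI[of _ "Suc k"], rule exI[of _ C], intro conjI ballI allI impI)
    fix \<phi> M assume \<phi>: "\<phi> \<in> test_on I {c..d}" and M: "gnorm_le (Suc k) M \<phi>"
    have "norm (f (gder I \<phi>)) \<le> C * M"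
      using C(2) test_on_gder[OF cd(2) \<phi>] M unfolding gnorm_le_Suc_gder by blast
    then show "norm ((\<lambda>\<phi>\<in>test I. f (gder I \<phi>)) \<phi>) \<le> C * M" using test_onI[OF cd(2) \<phi>] by simp
  qed (use C in auto)
qed (rule restrict_extensional)

lemma delta_dist:
  assumes t0: "t0 \<in> I"
  shows "delta I \<alpha> t0 \<in> dist_space I"
  unfolding delta_def rlim_ess_lim llim_ess_lim
proof (rule distI)
  let ?f = "\<lambda>\<phi>. \<alpha> * ess_lim True \<phi> t0 + (1 - \<alpha>) * ess_lim False \<phi> t0"
  fix \<phi> \<psi> assume \<phi>: "\<phi> \<in> test I" and \<psi>: "\<psi> \<in> test I"
  show "(\<lambda>\<phi>\<in>test I. ?f \<phi>) \<phi> = (\<lambda>\<phi>\<in>test I. ?f \<phi>) \<psi>" if "ae_eq I \<phi> \<psi>"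
    using \<phi> \<psi> ae_eq_ess_lim[OF that t0] by simp
  have "\<phi> \<in> GG I" "\<psi> \<in> GG I" using \<phi> \<psi> test_Ginf Ginf_GG by blast+
  then show "(\<lambda>\<phi>\<in>test I. ?f \<phi>) (\<lambda>t. a * \<phi> t + b * \<psi> t) = a * (\<lambda>\<phi>\<in>test I. ?f \<phi>) \<phi> + b * (\<lambda>\<phi>\<in>test I. ?f \<phi>) \<psi>" for a b
    using \<phi> \<psi> test_lin[OF \<phi> \<psi>] t0 by (simp add: ess_lim_add ess_lim_cmult GG_cmult algebra_simps)
next
  let ?f = "\<lambda>\<phi>. \<alpha> * ess_lim True \<phi> t0 + (1 - \<alpha>) * ess_lim False \<phi> t0"
  fix c d :: real assume cd: "c \<le> d" "{c..d} \<subseteq> I"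
  show "\<exists>k C. C \<ge> 0 \<and> (\<forall>\<phi>\<in>test_on I {c..d}. \<forall>M. gnorm_le k M \<phi> \<longrightarrow> norm ((\<lambda>\<phi>\<in>test I. ?f \<phi>) \<phi>) \<le> C * M)"
  proof (rule exI[of _ 0], rule exI[of _ "norm \<alpha> + norm (1 - \<alpha>)"], intro conjI ballI allI impI)
    fix \<phi> M assume \<phi>: "\<phi> \<in> test_on I {c..d}" and M: "gnorm_le 0 M \<phi>"
    have "norm (ess_lim b \<phi> t0) \<le> M" for b
      by (rule ess_lim_norm_le[OF gnorm_le_GG[OF M] t0 gnorm_le_bound[OF M]])
    then have "norm (\<alpha> * ess_lim True \<phi> t0) \<le> norm \<alpha> * M" "norm ((1 - \<alpha>) * ess_lim False \<phi> t0) \<le> norm (1 - \<alpha>) * M"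
      by (simp_all add: norm_mult mult_left_mono)
    then have "norm (?f \<phi>) \<le> norm \<alpha> * M + norm (1 - \<alpha>) * M" by (rule norm_triangle_mono)
    then show "norm ((\<lambda>\<phi>\<in>test I. ?f \<phi>) \<phi>) \<le> (norm \<alpha> + norm (1 - \<alpha>)) * M"
      using test_onI[OF cd(2) \<phi>] by (simp add: algebra_simps)
  qed auto
qed (rule restrict_extensional)

lemma delta_vanishes:
  assumes t0: "t0 \<in> I" shows "vanishes_before I t0 (delta I \<alpha> t0)"
  unfolding vanishes_before_def
proof (intro ballI impI)
  fix \<phi> assume \<phi>: "\<phi> \<in> test I" and s: "supp I \<phi> \<subseteq> {t \<in> I. t < t0}"
  obtain s where "s < t0" "zero_after s \<phi>" using supp_zero_after[OF \<phi> s, of "t0 - 1"] by auto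
  then have "ess_lim b \<phi> t0 = 0" for b using t0 by (simp add: zero_after_def)
  then show "delta I \<alpha> t0 \<phi> = 0" using \<phi> by (simp add: delta_def rlim_ess_lim llim_ess_lim)
qed

end

subsection \<open>The solution formula\<close>

context linear_problem begin

definition admits :: "('n \<Rightarrow> (real \<Rightarrow> complex) \<Rightarrow> complex) \<Rightarrow> bool" where
  "admits h \<longleftrightarrow> (\<forall>i. h i \<in> dist_space I \<and> vanishes_before I t0 (h i))"

definition adjoint_solution :: "('n \<Rightarrow> real \<Rightarrow> complex) \<Rightarrow> 'n \<Rightarrow> real \<Rightarrow> complex" where
  "adjoint_solution \<psi> = (SOME w. adjoint_after t2 \<psi> w)"

definition pairing :: "('n \<Rightarrow> (real \<Rightarrow> complex) \<Rightarrow> complex) \<Rightarrow> ('n \<Rightarrow> real \<Rightarrow> complex) \<Rightarrow> complex" where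
  "pairing h \<psi> = (\<Sum>i\<in>UNIV. h i (adjoint_solution \<psi> i))"

definition unit_at :: "'n \<Rightarrow> (real \<Rightarrow> complex) \<Rightarrow> 'n \<Rightarrow> real \<Rightarrow> complex" where
  "unit_at m \<psi> i = (if i = m then \<psi> else (\<lambda>_. 0))"

definition sol :: "('n \<Rightarrow> (real \<Rightarrow> complex) \<Rightarrow> complex) \<Rightarrow> 'n \<Rightarrow> (real \<Rightarrow> complex) \<Rightarrow> complex" where
  "sol h m = (\<lambda>\<psi>\<in>test I. pairing h (unit_at m \<psi>))"

lemma unit_at_test: "\<psi> \<in> test I \<Longrightarrow> unit_at m \<psi> i \<in> test I"
  by (simp add: unit_at_def test_zero)

lemma test_family:
  fixes \<psi> :: "'n \<Rightarrow> real \<Rightarrow> complex"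
  assumes "\<And>i. \<psi> i \<in> test I"
  shows "\<exists>c d. c \<le> d \<and> {c..d} \<subseteq> I \<and> (\<forall>i. \<psi> i \<in> test_on I {c..d})"
proof -
  have "\<exists>c d. c \<le> d \<and> {c..d} \<subseteq> I \<and> \<psi> i \<in> test_on I {c..d}" for i using testE[OF assms] by metis
  then obtain c d where cd: "\<And>i. c i \<le> d i" "\<And>i. {c i..d i} \<subseteq> I" "\<And>i. \<psi> i \<in> test_on I {c i..d i}" by metis
  define C where "C = Min (range c)"
  define D where "D = Max (range d)"
  have C: "C \<le> c i" "d i \<le> D" for i by (auto simp: C_def D_def)
  have "C \<in> range c" "D \<in> range d" unfolding C_def D_def by (rule Min_in Max_in; simp)+
  then have "C \<in> I" "D \<in> I" using cd(1,2) by (auto simp: subset_iff)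
  \<comment> \<open>\<open>undefined\<close> serves as an index, the index type being
    nonempty.\<close>
  moreover have "C \<le> D" using C[of undefined] cd(1)[of undefined] by linarith
  moreover have "\<psi> i \<in> test_on I {C..D}" for i by (rule test_on_mono[OF cd(3)]) (use C in auto)
  ultimately have "C \<le> D \<and> {C..D} \<subseteq> I \<and> (\<forall>i. \<psi> i \<in> test_on I {C..D})"
    using Icc_I[of C D] by simp
  then show ?thesis by (intro exI)
qed

lemma adjoint_solution:
  assumes "\<And>i. \<psi> i \<in> test I" shows "adjoint_after t2 \<psi> (adjoint_solution \<psi>)"
proof -
  obtain c d where cd: "c \<le> d" "{c..d} \<subseteq> I" "\<forall>i. \<psi> i \<in> test_on I {c..d}" using test_family[of \<psi>, OF assms] by blast
  have "\<exists>C. gnorm_le 0 C (\<psi> i)" for i using test_Ginf[OF assms] Ginf_iff by blast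
  then obtain C where C: "\<And>i. gnorm_le 0 (C i) (\<psi> i)" by metis
  have "gnorm_le 0 (\<Sum>i\<in>UNIV. C i) (\<psi> i)" for i
    by (rule gnorm_le_mono[OF C], rule member_le_sum) (use gnorm_le_nonneg[OF C] in auto)
  then have "\<exists>w. adjoint_after t2 \<psi> w" using adjoint_after_exists[OF cd(1,2)] cd(3) by meson
  then show ?thesis unfolding adjoint_solution_def by (rule someI_ex)
qed

text \<open>Two adjoint solutions for the same \<psi> differ by a solution of the homogeneous
  problem after the larger of s and t2. By uniqueness the difference vanishes from there on, still
  strictly before t0, so \<open>h\<close> does not notice it.\<close>

lemma pairing_eq:
  assumes h: "admits h" and \<psi>: "\<And>i. \<psi> i \<in> test I" and w: "adjoint_after s \<psi> w" and s: "s < t0"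
  shows "pairing h \<psi> = (\<Sum>i\<in>UNIV. h i (w i))"
  unfolding pairing_def
proof (rule sum.cong[OF refl])
  fix i
  define W where "W = adjoint_solution \<psi>"
  have W: "adjoint_after t2 \<psi> W" unfolding W_def by (rule adjoint_solution[OF \<psi>])
  define s' where "s' = max s t2"
  have s': "s' < t0" "s \<le> s'" "t2 \<le> s'" using s t012 by (auto simp: s'_def)
  have "adjoint_after s' (\<lambda>i t. 1 * \<psi> i t + (-1) * \<psi> i t) (\<lambda>i t. 1 * W i t + (-1) * w i t)"
    by (rule adjoint_after_lin[OF \<psi> \<psi>]) (use W w adjoint_after_mono s' in blast)+
  then have "adjoint_after s' (\<lambda>_ _. 0) (\<lambda>i t. W i t - w i t)" by simp
  then have z: "zero_after s' (\<lambda>t. W i t - w i t)" by (rule adjoint_after_unique)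
  have t: "W i \<in> test I" "w i \<in> test I" using W w by (auto simp: adjoint_after_def)
  have "(\<lambda>t. W i t - w i t) \<in> test I" using test_lin[OF t, of 1 "-1"] by simp
  then have "h i (\<lambda>t. W i t - w i t) = 0" using vanishes_zero_after[OF _ _ z s'(1)] h by (simp add: admits_def)
  then show "h i (adjoint_solution \<psi> i) = h i (w i)" using dist_diff[OF _ t, of "h i"] h by (simp add: admits_def W_def)
qed

lemma adjoint_after_zero: "adjoint_after s (\<lambda>_ _. 0) (\<lambda>_ _. 0)"
  unfolding adjoint_after_def zero_after_def
proof (intro allI conjI ballI impI test_zero)
  show "jump_free (\<lambda>_. 0)" by (simp add: jump_free_def)
  fix i t b assume t: "t \<in> I"
  have "ess_lim b (gder I (\<lambda>_. 0)) t = 0"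
    using ae_eq_ess_lim[OF gder_ae_eq[OF has_gder_const[of 0]] t, of b] by simp
  then show "ess_lim b (defect (\<lambda>_ _. 0) (\<lambda>_ _. 0) i) t = 0"
    using ess_lim_defect[of "\<lambda>_ _. 0" "\<lambda>_ _. 0" t b i, OF test_zero test_zero t] by simp
qed

lemma adjoint_after_sum:
  assumes "finite S" "\<And>l i. l \<in> S \<Longrightarrow> \<psi> l i \<in> test I" "\<And>l. l \<in> S \<Longrightarrow> adjoint_after s (\<psi> l) (w l)"
  shows "adjoint_after s (\<lambda>i t. \<Sum>l\<in>S. \<psi> l i t) (\<lambda>i t. \<Sum>l\<in>S. w l i t)"
  using assms
proof (induction S rule: finite_induct)
  case empty then show ?case using adjoint_after_zero by simp
next
  case (insert x F)
  have "adjoint_after s (\<lambda>i t. 1 * \<psi> x i t + 1 * (\<Sum>l\<in>F. \<psi> l i t)) (\<lambda>i t. 1 * w x i t + 1 * (\<Sum>l\<in>F. w l i t))"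
    by (rule adjoint_after_lin) (use insert in \<open>auto intro: test_sum\<close>)
  then show ?case using insert by simp
qed

lemma adjoint_after_ae:
  assumes "\<And>i. \<psi> i \<in> test I" "\<And>i. ae_eq I (\<psi> i) (\<psi>' i)" "adjoint_after s \<psi> w"
  shows "adjoint_after s \<psi>' w"
  unfolding adjoint_after_def zero_after_def
proof (intro allI conjI ballI impI)
  have wt: "w i \<in> test I" for i using assms(3) by (auto simp: adjoint_after_def)
  have p': "\<psi>' i \<in> test I" for i by (rule test_ae_eq[OF assms(1,2)])
  show "w i \<in> test I" "jump_free (w i)" for i using assms(3) by (auto simp: adjoint_after_def)
  fix i t b assume t: "t \<in> I" "s < t"
  have "ess_lim b (defect \<psi> w i) t = 0" using assms(3) t by (auto simp: adjoint_after_def zero_after_def)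
  then show "ess_lim b (defect \<psi>' w i) t = 0"
    unfolding ess_lim_defect[OF assms(1) wt t(1)] ess_lim_defect[OF p' wt t(1)] ae_eq_ess_lim[OF assms(2) t(1)] .
qed

text \<open>Linearity and invariance follow from \<open>pairing_eq\<close>, because combinations of
  adjoint solutions are adjoint solutions. For the seminorm bound the chosen solution, which carries
  no estimates, is traded for the one from \<open>adjoint_after_exists\<close>.\<close>

lemma sol_dist:
  assumes h: "admits h"
  shows "sol h m \<in> dist_space I"
  unfolding sol_def
proof (rule distI)
  have hd: "h i \<in> dist_space I" for i using h by (simp add: admits_def)
  fix \<phi> \<psi> assume \<phi>: "\<phi> \<in> test I" and \<psi>: "\<psi> \<in> test I"
  have wt: "adjoint_solution (unit_at m \<phi>) i \<in> test I" "adjoint_solution (unit_at m \<psi>) i \<in> test I" for i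
    using adjoint_solution unit_at_test \<phi> \<psi> unfolding adjoint_after_def by blast+
  show "(\<lambda>\<psi>\<in>test I. pairing h (unit_at m \<psi>)) \<phi> = (\<lambda>\<psi>\<in>test I. pairing h (unit_at m \<psi>)) \<psi>" if e: "ae_eq I \<phi> \<psi>"
  proof -
    have "adjoint_after t2 (unit_at m \<psi>) (adjoint_solution (unit_at m \<phi>))"
      by (rule adjoint_after_ae[OF unit_at_test[OF \<phi>, of m] _ adjoint_solution[OF unit_at_test[OF \<phi>]]]) (simp add: unit_at_def e)
    from pairing_eq[OF h unit_at_test[OF \<psi>] this t012(2)] show ?thesis
      using \<phi> \<psi> by (simp add: pairing_def[of h "unit_at m \<phi>"])
  qed
  show "(\<lambda>\<psi>\<in>test I. pairing h (unit_at m \<psi>)) (\<lambda>t. \<alpha> * \<phi> t + \<beta> * \<psi> t) =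
      \<alpha> * (\<lambda>\<psi>\<in>test I. pairing h (unit_at m \<psi>)) \<phi> + \<beta> * (\<lambda>\<psi>\<in>test I. pairing h (unit_at m \<psi>)) \<psi>" for \<alpha> \<beta>
  proof -
    have u: "unit_at m (\<lambda>t. \<alpha> * \<phi> t + \<beta> * \<psi> t) = (\<lambda>i t. \<alpha> * unit_at m \<phi> i t + \<beta> * unit_at m \<psi> i t)"
      by (auto simp: unit_at_def fun_eq_iff)
    have "adjoint_after t2 (unit_at m (\<lambda>t. \<alpha> * \<phi> t + \<beta> * \<psi> t))
       (\<lambda>i t. \<alpha> * adjoint_solution (unit_at m \<phi>) i t + \<beta> * adjoint_solution (unit_at m \<psi>) i t)"
      unfolding u by (intro adjoint_after_lin unit_at_test adjoint_solution \<phi> \<psi>)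
    from pairing_eq[OF h unit_at_test[OF test_lin[OF \<phi> \<psi>]] this t012(2)]
    have "pairing h (unit_at m (\<lambda>t. \<alpha> * \<phi> t + \<beta> * \<psi> t)) = \<alpha> * pairing h (unit_at m \<phi>) + \<beta> * pairing h (unit_at m \<psi>)"
      by (simp add: dist_lin[OF hd wt] pairing_def sum.distrib sum_distrib_left)
    then show ?thesis using \<phi> \<psi> test_lin[OF \<phi> \<psi>] by simp
  qed
next
  fix c d :: real assume cd: "c \<le> d" "{c..d} \<subseteq> I"
  have hd: "h i \<in> dist_space I" for i using h by (simp add: admits_def)
  obtain c' d' where cd': "c' \<le> d'" "{c'..d'} \<subseteq> I" and ex: "\<forall>k. \<exists>K\<ge>0. \<forall>\<psi> N. (\<forall>i. \<psi> i \<in> test_on I {c..d} \<and> gnorm_le k N (\<psi> i)) \<longrightarrow>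
     (\<exists>w. adjoint_after t2 \<psi> w \<and> (\<forall>i. w i \<in> test_on I {c'..d'} \<and> gnorm_le k (K * N) (w i)))"
    using adjoint_after_exists[OF cd] by blast
  have "\<exists>k C. C \<ge> 0 \<and> (\<forall>\<phi>\<in>test_on I {c'..d'}. \<forall>M. gnorm_le k M \<phi> \<longrightarrow> norm (h i \<phi>) \<le> C * M)" for i
    by (rule dist_bound[OF hd cd'])
  then obtain kk C where C: "\<And>i. C i \<ge> 0" "\<And>i \<phi> M. \<phi> \<in> test_on I {c'..d'} \<Longrightarrow> gnorm_le (kk i) M \<phi> \<Longrightarrow> norm (h i \<phi>) \<le> C i * M"
    by metis
  \<comment> \<open>One order that serves all the finitely many components of
    \<open>h\<close>.\<close>
  define k where "k = Max (range kk)"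
  have k: "kk i \<le> k" for i unfolding k_def by (rule Max_ge) auto
  obtain K where K: "K \<ge> 0" "\<forall>\<psi> N. (\<forall>i. \<psi> i \<in> test_on I {c..d} \<and> gnorm_le k N (\<psi> i)) \<longrightarrow>
     (\<exists>w. adjoint_after t2 \<psi> w \<and> (\<forall>i. w i \<in> test_on I {c'..d'} \<and> gnorm_le k (K * N) (w i)))"
    using ex by blast
  show "\<exists>k C. C \<ge> 0 \<and> (\<forall>\<phi>\<in>test_on I {c..d}. \<forall>M. gnorm_le k M \<phi> \<longrightarrow>
      norm ((\<lambda>\<psi>\<in>test I. pairing h (unit_at m \<psi>)) \<phi>) \<le> C * M)"
  proof (rule exI[of _ k], rule exI[of _ "(\<Sum>i\<in>UNIV. C i) * K"], intro conjI ballI allI impI)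
    show "0 \<le> (\<Sum>i\<in>UNIV. C i) * K" using C(1) K(1) by (simp add: sum_nonneg)
    fix \<phi> M assume \<phi>: "\<phi> \<in> test_on I {c..d}" and M: "gnorm_le k M \<phi>"
    have \<phi>t: "\<phi> \<in> test I" by (rule test_onI[OF cd(2) \<phi>])
    have "\<forall>i. unit_at m \<phi> i \<in> test_on I {c..d} \<and> gnorm_le k M (unit_at m \<phi> i)"
      using \<phi> M gnorm_le_nonneg[OF M] by (auto simp: unit_at_def test_on_def Ginf_const intro: gnorm_le_const)
    then obtain w where w: "adjoint_after t2 (unit_at m \<phi>) w" "\<forall>i. w i \<in> test_on I {c'..d'} \<and> gnorm_le k (K * M) (w i)"
      using K(2) by blast
    have "norm (\<Sum>i\<in>UNIV. h i (w i)) \<le> (\<Sum>i\<in>UNIV. C i * (K * M))"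
      by (rule sum_norm_le) (use w(2) C(2) k gnorm_le_le in blast)
    also have "\<dots> = (\<Sum>i\<in>UNIV. C i) * K * M" by (simp add: sum_distrib_right mult.assoc)
    finally show "norm ((\<lambda>\<psi>\<in>test I. pairing h (unit_at m \<psi>)) \<phi>) \<le> (\<Sum>i\<in>UNIV. C i) * K * M"
      using pairing_eq[OF h unit_at_test[OF \<phi>t] w(1) t012(2)] \<phi>t by simp
  qed
qed (rule restrict_extensional)

text \<open>If \<phi> is 0 after some s < t0, the zero family is already an adjoint solution after
  s.\<close>

lemma sol_vanishes:
  assumes h: "admits h"
  shows "vanishes_before I t0 (sol h m)"
  unfolding vanishes_before_def
proof (intro ballI impI)
  fix \<phi> assume \<phi>: "\<phi> \<in> test I" and "supp I \<phi> \<subseteq> {t \<in> I. t < t0}"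
  then obtain s where s: "t2 \<le> s" "s < t0" "zero_after s \<phi>" using supp_zero_after t012(2) by blast
  have "adjoint_after s (unit_at m \<phi>) (\<lambda>_ _. 0)"
    unfolding adjoint_after_def zero_after_def
  proof (intro allI conjI ballI impI)
    show "(\<lambda>_. 0) \<in> test I" "jump_free (\<lambda>_. 0)" using adjoint_after_zero by (auto simp: adjoint_after_def)
    fix i t b assume t: "t \<in> I" "s < t"
    have "ess_lim b (unit_at m \<phi> i) t = 0" using s(3) t by (auto simp: unit_at_def zero_after_def)
    moreover have "ess_lim b (defect (\<lambda>_ _. 0) (\<lambda>_ _. 0) i) t = 0"
      using adjoint_after_zero[of s] t by (auto simp: adjoint_after_def zero_after_def)
    ultimately show "ess_lim b (defect (unit_at m \<phi>) (\<lambda>_ _. 0) i) t = 0"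
      using ess_lim_defect[of "\<lambda>_ _. 0" "\<lambda>_ _. 0" t b i, OF test_zero test_zero t(1)]
        ess_lim_defect[of "unit_at m \<phi>" "\<lambda>_ _. 0" t b i, OF unit_at_test[OF \<phi>] test_zero t(1)] by simp
  qed
  from pairing_eq[OF h unit_at_test[OF \<phi>] this s(2)] show "sol h m \<phi> = 0"
  proof -
    have "h i (\<lambda>_. 0) = 0" for i using h by (simp add: admits_def dist_zero)
    then show ?thesis using \<phi> \<open>pairing h (unit_at m \<phi>) = _\<close> by (simp add: sol_def)
  qed
qed

lemma solution_pairing:
  assumes h: "admits h" and x: "is_solution I A h x" and xv: "\<And>i. vanishes_before I t0 (x i)"
    and \<psi>: "\<And>i. \<psi> i \<in> test I"
  shows "(\<Sum>i\<in>UNIV. x i (\<psi> i)) = pairing h \<psi>"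
proof -
  have xd: "x i \<in> dist_space I" for i using x by (simp add: is_solution_def)
  obtain x' where x': "\<forall>i. x' i \<in> DD I (x i)" and
    eq: "\<forall>\<phi>\<in>test I. \<forall>i. x' i \<phi> - (\<Sum>j\<in>UNIV. mult_dist I (A $ i $ j) (x j) \<phi>) = h i \<phi>"
    using x unfolding is_solution_def by blast
  define w where "w = adjoint_solution \<psi>"
  have w: "adjoint_after t2 \<psi> w" unfolding w_def by (rule adjoint_solution[OF \<psi>])
  have wt: "w i \<in> test I" "jump_free (w i)" "zero_after t2 (defect \<psi> w i)" for i using w by (auto simp: adjoint_after_def)
  have Aw: "(\<lambda>t. (A $ j $ i) t * w j t) \<in> test I" for i j by (rule test_mult[OF A wt(1)])
  have hw: "h i (w i) = - x i (gder I (w i)) - (\<Sum>j\<in>UNIV. x j (\<lambda>t. (A $ i $ j) t * w i t))" for i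
  proof -
    obtain \<delta> where \<delta>: "\<delta> \<in> Delta I" "x' i = (\<lambda>\<phi>\<in>test I. ddt I (x i) \<phi> + \<delta> \<phi>)"
      using x' unfolding DD_def by blast
    \<comment> \<open>The multivalued part of the derivative drops out here, \<open>w i\<close>
      being jump-free.\<close>
    have "x' i (w i) = - x i (gder I (w i))"
      using Delta_jump_free[OF \<delta>(1) wt(1,2)] wt(1) by (simp add: \<delta>(2) ddt_def)
    moreover have "x' i (w i) - (\<Sum>j\<in>UNIV. mult_dist I (A $ i $ j) (x j) (w i)) = h i (w i)"
      using eq wt(1) by blast
    ultimately show ?thesis using wt(1) by (simp add: mult_dist_def)
  qed
  have "x i (\<psi> i) = - x i (gder I (w i)) - (\<Sum>j\<in>UNIV. x i (\<lambda>t. (A $ j $ i) t * w j t))" for i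
  proof -
    \<comment> \<open>w solves its equation only after t2 < t0; further left the assumption that x
      vanishes before t0 takes over.\<close>
    have "x i (defect \<psi> w i) = 0"
      by (rule vanishes_zero_after[OF xv defect_test[OF \<psi> wt(1)] wt(3) t012(2)])
    moreover have "x i (defect \<psi> w i) = x i (\<psi> i) + (x i (gder I (w i)) + (\<Sum>j\<in>UNIV. x i (\<lambda>t. (A $ j $ i) t * w j t)))"
    proof -
      have s: "(\<lambda>t. \<Sum>j\<in>UNIV. (A $ j $ i) t * w j t) \<in> test I" by (rule test_sum[OF Aw])
      show ?thesis unfolding defect_def
        by (subst dist_add[OF xd \<psi> test_add[OF test_gder[OF wt(1)] s]], subst dist_add[OF xd test_gder[OF wt(1)] s],
            subst dist_sum[OF xd Aw]) (rule refl)
    qed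
    ultimately have "x i (\<psi> i) + (x i (gder I (w i)) + (\<Sum>j\<in>UNIV. x i (\<lambda>t. (A $ j $ i) t * w j t))) = 0"
      by (simp only:)
    then show ?thesis by algebra
  qed
  then have "(\<Sum>i\<in>UNIV. x i (\<psi> i)) = (\<Sum>i\<in>UNIV. - x i (gder I (w i))) - (\<Sum>i\<in>UNIV. \<Sum>j\<in>UNIV. x i (\<lambda>t. (A $ j $ i) t * w j t))"
    by (simp add: sum_subtractf)
  \<comment> \<open>Exchanging the sums passes from the transposed matrix of the adjoint system back
    to A.\<close>
  also have "(\<Sum>i\<in>UNIV. \<Sum>j\<in>UNIV. x i (\<lambda>t. (A $ j $ i) t * w j t)) = (\<Sum>j\<in>UNIV. \<Sum>i\<in>UNIV. x i (\<lambda>t. (A $ j $ i) t * w j t))"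
    by (rule sum.swap)
  also have "(\<Sum>i\<in>UNIV. - x i (gder I (w i))) - \<dots> = (\<Sum>i\<in>UNIV. h i (w i))"
    by (simp add: hw sum_subtractf)
  also have "\<dots> = pairing h \<psi>" by (simp add: pairing_def w_def)
  finally show ?thesis .
qed

lemma sum_unit_at: "\<psi> \<in> test I \<Longrightarrow> (\<And>i. x i \<in> dist_space I) \<Longrightarrow> (\<Sum>i\<in>UNIV. x i (unit_at m \<psi> i)) = x m \<psi>"
proof -
  assume *: "\<psi> \<in> test I" "\<And>i. x i \<in> dist_space I"
  have "(\<Sum>i\<in>UNIV. x i (unit_at m \<psi> i)) = (\<Sum>i\<in>UNIV. if i = m then x i \<psi> else 0)"
    by (rule sum.cong) (auto simp: unit_at_def dist_zero[OF *(2)])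
  then show ?thesis by simp
qed

lemma solution_unique:
  assumes h: "admits h" and x: "is_solution I A h x" and xv: "\<And>i. vanishes_before I t0 (x i)"
  shows "x = sol h"
proof
  fix m
  have xd: "x i \<in> dist_space I" for i using x by (simp add: is_solution_def)
  show "x m = sol h m"
  proof (rule extensionalityI[of _ "test I"])
    show "x m \<in> extensional (test I)" by (rule dist_ext[OF xd])
    show "sol h m \<in> extensional (test I)" by (rule dist_ext[OF sol_dist[OF h]])
    fix \<psi> assume \<psi>: "\<psi> \<in> test I"
    show "x m \<psi> = sol h m \<psi>"
      using solution_pairing[of h x "unit_at m \<psi>", OF h x xv unit_at_test[OF \<psi>]] sum_unit_at[of \<psi> x m, OF \<psi> xd] \<psi> by (simp add: sol_def)
  qed
qed

text \<open>The residual \<delta> has to annihilate every jump-free \<phi>. Put \<phi> into the i-th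
  slot of a zero family and let \<psi> be the right-hand side for which that family solves the
  adjoint system. Being jump-free, the family is a legitimate adjoint solution, so pairing
  \<open>sol h\<close> with \<psi> must return the value of \<open>h i\<close> at \<phi>, which is
  the equation in component i.\<close>

lemma sol_solution:
  assumes h: "admits h"
  shows "is_solution I A h (sol h)"
proof -
  define y where "y = sol h"
  have yd: "y i \<in> dist_space I" for i unfolding y_def by (rule sol_dist[OF h])
  have hd: "h i \<in> dist_space I" for i using h by (simp add: admits_def)
  \<comment> \<open>The nested restrictions reproduce the shape of the closure lemmas for
    distributions.\<close>
  define \<delta> where "\<delta> i = (\<lambda>\<phi>\<in>test I. h i \<phi> + (\<lambda>\<phi>\<in>test I. (\<lambda>\<phi>\<in>test I. y i (gder I \<phi>)) \<phi> +
     (\<lambda>\<phi>\<in>test I. \<Sum>j\<in>UNIV. mult_dist I (A $ i $ j) (y j) \<phi>) \<phi>) \<phi>)" for i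
  have \<delta>d: "\<delta> i \<in> dist_space I" for i
    unfolding \<delta>_def by (intro dist_closed_add dist_closed_sum dist_closed_mult dist_closed_gder hd yd A)
  have \<delta>v: "\<delta> i \<phi> = h i \<phi> + (y i (gder I \<phi>) + (\<Sum>j\<in>UNIV. y j (\<lambda>t. (A $ i $ j) t * \<phi> t)))" if "\<phi> \<in> test I" for i \<phi>
    using that by (simp add: \<delta>_def mult_dist_def)
  have "\<delta> i \<in> Delta I" for i
  proof (rule DeltaI[OF \<delta>d])
    fix \<phi> assume \<phi>: "\<phi> \<in> test I" and jf: "jump_free \<phi>"
    have g\<phi>: "gder I \<phi> \<in> test I" and A\<phi>: "(\<lambda>t. (A $ i $ l) t * \<phi> t) \<in> test I" for l
      using test_gder[OF \<phi>] test_mult[OF A \<phi>] by blast+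
    define \<psi> where "\<psi> l = (\<lambda>t. (-1) * unit_at i (gder I \<phi>) l t + (-1) * ((A $ i $ l) t * \<phi> t))" for l
    have \<psi>t: "\<psi> l \<in> test I" for l unfolding \<psi>_def by (rule test_lin[OF unit_at_test[OF g\<phi>] A\<phi>])
    have lz: "ess_lim b (unit_at i f l) t = (if l = i then ess_lim b f t else 0)" for b f l t
      by (simp add: unit_at_def)
    have adj1: "adjoint_after t2 \<psi> (unit_at i \<phi>)"
      unfolding adjoint_after_def zero_after_def
    proof (intro allI conjI ballI impI)
      show "unit_at i \<phi> l \<in> test I" "jump_free (unit_at i \<phi> l)" for l
        using unit_at_test[OF \<phi>] jf by (auto simp: unit_at_def jump_free_def)
      fix l t b assume t: "t \<in> I"
      have G: "unit_at i (gder I \<phi>) l \<in> GG I" "(\<lambda>t. (A $ i $ l) t * \<phi> t) \<in> GG I" "A $ i $ l \<in> GG I" "\<phi> \<in> GG I" for l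
        using unit_at_test[OF g\<phi>] A\<phi> test_Ginf Ginf_GG \<phi> A by blast+
      have p: "ess_lim b (\<psi> l) t = (-1) * (if l = i then ess_lim b (gder I \<phi>) t else 0) + (-1) * (ess_lim b (A $ i $ l) t * ess_lim b \<phi> t)"
        unfolding \<psi>_def ess_lim_add[OF GG_cmult[OF G(1)] GG_cmult[OF G(2)] t] ess_lim_cmult[OF G(1) t] ess_lim_cmult[OF G(2) t]
          ess_lim_mult[OF G(3,4) t] lz ..
      have g: "ess_lim b (gder I (unit_at i \<phi> l)) t = (if l = i then ess_lim b (gder I \<phi>) t else 0)"
        using ae_eq_ess_lim[OF gder_ae_eq[OF has_gder_const[of 0]] t, of b] by (simp add: unit_at_def)
      have s: "(\<Sum>j\<in>UNIV. ess_lim b (A $ j $ l) t * ess_lim b (unit_at i \<phi> j) t) = ess_lim b (A $ i $ l) t * ess_lim b \<phi> t"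
      proof -
        have "(\<Sum>j\<in>UNIV. ess_lim b (A $ j $ l) t * ess_lim b (unit_at i \<phi> j) t) = (\<Sum>j\<in>UNIV. if j = i then ess_lim b (A $ j $ l) t * ess_lim b \<phi> t else 0)"
          by (rule sum.cong) (auto simp: lz)
        then show ?thesis by simp
      qed
      show "ess_lim b (defect \<psi> (unit_at i \<phi>) l) t = 0"
        unfolding ess_lim_defect[OF \<psi>t unit_at_test[OF \<phi>] t] p g s by simp
    qed
    have yl: "y l (\<psi> l) = (\<Sum>k\<in>UNIV. h k (adjoint_solution (unit_at l (\<psi> l)) k))" for l
      using \<psi>t by (simp add: y_def sol_def pairing_def)
    have wt: "adjoint_solution (unit_at l (\<psi> l)) k \<in> test I" for k l
      using adjoint_solution[of "unit_at l (\<psi> l)", OF unit_at_test[OF \<psi>t]] unfolding adjoint_after_def by blast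
    \<comment> \<open>\<open>sol\<close> solves one adjoint problem per component of \<psi>; the sum
      of these solutions is a second adjoint solution for \<psi>, and \<open>pairing_eq\<close>
      compares it with the first.\<close>
    have "adjoint_after t2 (\<lambda>k t. \<Sum>l\<in>UNIV. unit_at l (\<psi> l) k t) (\<lambda>k t. \<Sum>l\<in>UNIV. adjoint_solution (unit_at l (\<psi> l)) k t)"
      by (rule adjoint_after_sum) (auto intro: adjoint_solution unit_at_test \<psi>t)
    moreover have "(\<lambda>k t. \<Sum>l\<in>UNIV. unit_at l (\<psi> l) k t) = \<psi>"
    proof (intro ext)
      fix k t
      have "(\<Sum>l\<in>UNIV. unit_at l (\<psi> l) k t) = (\<Sum>l\<in>UNIV. if k = l then \<psi> l t else 0)"
        by (rule sum.cong) (auto simp: unit_at_def)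
      then show "(\<Sum>l\<in>UNIV. unit_at l (\<psi> l) k t) = \<psi> k t" by simp
    qed
    ultimately have adj2: "adjoint_after t2 \<psi> (\<lambda>k t. \<Sum>l\<in>UNIV. adjoint_solution (unit_at l (\<psi> l)) k t)" by simp
    have "(\<Sum>l\<in>UNIV. y l (\<psi> l)) = (\<Sum>k\<in>UNIV. \<Sum>l\<in>UNIV. h k (adjoint_solution (unit_at l (\<psi> l)) k))"
      unfolding yl by (rule sum.swap)
    also have "\<dots> = (\<Sum>k\<in>UNIV. h k (\<lambda>t. \<Sum>l\<in>UNIV. adjoint_solution (unit_at l (\<psi> l)) k t))"
      by (intro sum.cong refl dist_sum[OF hd wt, symmetric])
    also have "\<dots> = pairing h \<psi>" by (rule pairing_eq[OF h \<psi>t adj2 t012(2), symmetric])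
    also have "\<dots> = (\<Sum>l\<in>UNIV. h l (unit_at i \<phi> l))" by (rule pairing_eq[OF h \<psi>t adj1 t012(2)])
    also have "\<dots> = h i \<phi>" by (rule sum_unit_at[OF \<phi> hd])
    finally have 1: "(\<Sum>l\<in>UNIV. y l (\<psi> l)) = h i \<phi>" .
    have "y l (\<psi> l) = (-1) * y l (unit_at i (gder I \<phi>) l) + (-1) * y l (\<lambda>t. (A $ i $ l) t * \<phi> t)" for l
      unfolding \<psi>_def by (rule dist_lin[OF yd unit_at_test[OF g\<phi>] A\<phi>])
    then have "(\<Sum>l\<in>UNIV. y l (\<psi> l)) = - (\<Sum>l\<in>UNIV. y l (unit_at i (gder I \<phi>) l)) - (\<Sum>l\<in>UNIV. y l (\<lambda>t. (A $ i $ l) t * \<phi> t))"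
      by (simp add: sum_subtractf sum_negf)
    then show "\<delta> i \<phi> = 0" using 1 sum_unit_at[of "gder I \<phi>" y i, OF g\<phi> yd] by (simp add: \<delta>v[OF \<phi>])
  qed
  then have "\<forall>i. (\<lambda>\<phi>\<in>test I. ddt I (y i) \<phi> + \<delta> i \<phi>) \<in> DD I (y i)" unfolding DD_def by blast
  moreover have "\<forall>\<phi>\<in>test I. \<forall>i. (\<lambda>\<phi>\<in>test I. ddt I (y i) \<phi> + \<delta> i \<phi>) \<phi> - (\<Sum>j\<in>UNIV. mult_dist I (A $ i $ j) (y j) \<phi>) = h i \<phi>"
    by (simp add: ddt_def mult_dist_def \<delta>v)
  ultimately show ?thesis
    unfolding is_solution_def y_def[symmetric] using yd
    by (intro conjI allI exI[of _ "\<lambda>i. \<lambda>\<phi>\<in>test I. ddt I (y i) \<phi> + \<delta> i \<phi>"]) blast+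
qed

section \<open>The Cauchy problem and its continuity\<close>

lemma cauchy_solution_eq:
  assumes f: "admits f"
  shows "cauchy_solution I A t0 \<alpha> f x0 = sol (\<lambda>i. \<lambda>\<phi>\<in>test I. f i \<phi> + x0 $ i * delta I \<alpha> t0 \<phi>)"
    and "admits (\<lambda>i. \<lambda>\<phi>\<in>test I. f i \<phi> + x0 $ i * delta I \<alpha> t0 \<phi>)"
proof -
  have t0: "t0 \<in> I" using t012 by auto
  let ?h = "\<lambda>i. \<lambda>\<phi>\<in>test I. f i \<phi> + x0 $ i * delta I \<alpha> t0 \<phi>"
  have "?h i \<in> dist_space I" for i
  proof -
    have "(\<lambda>\<phi>\<in>test I. f i \<phi> + (\<lambda>\<phi>\<in>test I. x0 $ i * delta I \<alpha> t0 \<phi>) \<phi>) \<in> dist_space I"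
      by (intro dist_closed_add dist_closed_cmult delta_dist[OF t0]) (use f in \<open>simp add: admits_def\<close>)
    moreover have "(\<lambda>\<phi>\<in>test I. f i \<phi> + (\<lambda>\<phi>\<in>test I. x0 $ i * delta I \<alpha> t0 \<phi>) \<phi>) = ?h i"
      by (rule restrict_ext) simp
    ultimately show ?thesis by simp
  qed
  moreover have "vanishes_before I t0 (?h i)" for i
    using f delta_vanishes[OF t0] by (simp add: admits_def vanishes_before_def)
  ultimately show h: "admits ?h" by (simp add: admits_def)
  show "cauchy_solution I A t0 \<alpha> f x0 = sol ?h"
    unfolding cauchy_solution_def
    by (rule the_equality) (use sol_solution[OF h] sol_vanishes[OF h] solution_unique[OF h] in blast)+
qed

lemma cauchy_solution_continuous:
  "continuous_map
    (prod_topology (subtopology (vweak_star I) {f. \<forall>i. vanishes_before I t0 (f i)})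
                   (euclidean :: (complex^'n) topology))
    (vweak_star I)
    (\<lambda>(f, x0). cauchy_solution I A t0 \<alpha> f x0)"
proof -
  let ?X = "prod_topology (subtopology (vweak_star I) {f :: 'n \<Rightarrow> (real \<Rightarrow> complex) \<Rightarrow> complex. \<forall>i. vanishes_before I t0 (f i)}) (euclidean :: (complex^'n) topology)"
  have tX: "admits (fst p)" if "p \<in> topspace ?X" for p
  proof -
    have "fst p \<in> topspace (vweak_star I)" "\<forall>i. vanishes_before I t0 (fst p i)" using that by auto
    then have "fst p i \<in> topspace (weak_star I)" for i by (auto simp: vweak_star_def)
    then have "fst p i \<in> dist_space I" for i by (auto simp: weak_star_def)
    then show ?thesis using \<open>\<forall>i. vanishes_before I t0 (fst p i)\<close> by (simp add: admits_def)
  qed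
  have ev: "continuous_map ?X euclidean (\<lambda>p. fst p i \<phi>)" if \<phi>: "\<phi> \<in> test I" for i \<phi>
  proof -
    have 1: "continuous_map ?X (vweak_star I) fst"
      using continuous_map_fst continuous_map_into_fulltopology by blast
    have 2: "continuous_map (vweak_star I :: ('n \<Rightarrow> (real \<Rightarrow> complex) \<Rightarrow> complex) topology) (weak_star I) (\<lambda>f. f i)"
      unfolding vweak_star_def by (rule continuous_map_product_projection) simp
    have 3: "continuous_map (weak_star I) euclidean (\<lambda>g. g \<phi>)"
      unfolding weak_star_def by (rule continuous_map_from_subtopology) (rule continuous_map_product_projection[OF \<phi>])
    from continuous_map_compose[OF continuous_map_compose[OF 1 2] 3] show ?thesis by (simp add: comp_def)
  qed
  have pt: "continuous_map ?X euclidean (\<lambda>p. (case p of (f, x0) \<Rightarrow> cauchy_solution I A t0 \<alpha> f x0) m \<psi>)" if \<psi>: "\<psi> \<in> test I" for m \<psi>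
  proof -
    let ?w = "adjoint_solution (unit_at m \<psi>)"
    have w: "?w i \<in> test I" for i using adjoint_solution[of "unit_at m \<psi>", OF unit_at_test[OF \<psi>]] unfolding adjoint_after_def by blast
    have sn: "continuous_map ?X euclidean (\<lambda>p. snd p $ i * z)" for i and z :: complex
    proof -
      have "continuous_map euclidean euclidean (\<lambda>x :: complex^'n. x $ i * z)"
        by (simp add: continuous_map_iff_continuous2) (intro continuous_intros)
      from continuous_map_compose[OF continuous_map_snd this] show ?thesis by (simp add: comp_def)
    qed
    have "continuous_map ?X euclidean (\<lambda>p. \<Sum>i\<in>UNIV. fst p i (?w i) + snd p $ i * delta I \<alpha> t0 (?w i))"
      by (intro continuous_map_sum continuous_map_add ev w sn) auto
    then show ?thesis
    proof (rule continuous_map_eq)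
      fix p assume "p \<in> topspace ?X"
      then have a: "admits (fst p)" by (rule tX)
      show "(\<Sum>i\<in>UNIV. fst p i (?w i) + snd p $ i * delta I \<alpha> t0 (?w i)) = (case p of (f, x0) \<Rightarrow> cauchy_solution I A t0 \<alpha> f x0) m \<psi>"
        using \<psi> w by (simp add: case_prod_beta cauchy_solution_eq(1)[OF a] sol_def pairing_def)
    qed
  qed
  \<comment> \<open>\<open>weak_star\<close> is a subtopology, so besides pointwise continuity the
    values must be shown to be distributions.\<close>
  have dom: "(case p of (f, x0) \<Rightarrow> cauchy_solution I A t0 \<alpha> f x0) m \<in> dist_space I" if "p \<in> topspace ?X" for p m
  proof -
    have a: "admits (fst p)" using that by (rule tX)
    show ?thesis using sol_dist[OF cauchy_solution_eq(2)[OF a]]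
      by (simp add: case_prod_beta cauchy_solution_eq(1)[OF a])
  qed
  have "continuous_map ?X (weak_star I) (\<lambda>p. (case p of (f, x0) \<Rightarrow> cauchy_solution I A t0 \<alpha> f x0) m)" for m
    unfolding weak_star_def continuous_map_in_subtopology continuous_map_componentwise
  proof (intro conjI ballI)
    show "(\<lambda>p. (case p of (f, x0) \<Rightarrow> cauchy_solution I A t0 \<alpha> f x0) m) \<in> topspace ?X \<rightarrow> dist_space I"
      using dom by blast
    show "(\<lambda>p. (case p of (f, x0) \<Rightarrow> cauchy_solution I A t0 \<alpha> f x0) m) ` topspace ?X \<subseteq> extensional (test I)"
      using dom dist_ext by blast
  qed (rule pt)
  then show ?thesis
    by (subst (2) vweak_star_def) (simp only: continuous_map_componentwise_UNIV, blast)
qed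

end

theorem theorem3p5:
  fixes a b :: ereal and I :: "real set" and t0 :: real and \<alpha> :: complex
    and A :: "(real \<Rightarrow> complex)^'n^'n"
  assumes "I = einterval a b" and "t0 \<in> I"
    and "\<And>i j. A $ i $ j \<in> Ginf I"
  shows "continuous_map
    (prod_topology (subtopology (vweak_star I) {f. \<forall>i. vanishes_before I t0 (f i)})
                   (euclidean :: (complex^'n) topology))
    (vweak_star I)
    (\<lambda>(f, x0). cauchy_solution I A t0 \<alpha> f x0)"
proof -
  have I: "open I" "is_interval I"
  proof -
    show "open I" using assms(1) by simp
    show "is_interval I"
      unfolding is_interval_1
    proof (intro ballI allI impI)
      fix x y z assume x: "x \<in> I" and y: "y \<in> I" and z: "x \<le> z \<and> z \<le> y"
      have "a < ereal x" "ereal y < b" using x y assms(1) by (auto simp: einterval_iff)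
      moreover have "ereal x \<le> ereal z" "ereal z \<le> ereal y" using z by auto
      ultimately have "a < ereal z" "ereal z < b" by (meson order_less_le_trans order_le_less_trans)+
      then show "z \<in> I" using assms(1) by (simp add: einterval_iff)
    qed
  qed
  \<comment> \<open>Openness of \<open>I\<close> leaves a closed interval of length e to the left of
    t0; its left end and its midpoint become t1 and t2.\<close>
  obtain e where e: "e > 0" "cball t0 e \<subseteq> I" using I(1) assms(2) open_contains_cball by blast
  have "{t0 - e..t0} \<subseteq> I" using e(2) by (auto simp: cball_def dist_real_def subset_iff)
  then interpret linear_problem I A t0 "t0 - e" "t0 - e / 2"
    using I assms(2,3) e(1) by unfold_locales auto
  show ?thesis by (rule cauchy_solution_continuous)
qed

end
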